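(* Let $d\in\mathbb{N}$, and let $H_\omega=-\Delta+\lambda V_\omega$ be the discrete alloy-type model on $\ell^2(\mathbb{Z}^d)$ with potential $V_\omega(x)=\sum_{k\in\mathbb{Z}^d}\omega_k u(x-k)$, where the $\omega_k$, $k\in\mathbb{Z}^d$, are i.i.d. real random variables whose common distribution $\mu$ has compact support. Assume that $u:\mathbb{Z}^d\to\mathbb{R}$ has compact (i.e. finite) support, that $\hat u(\theta)=\sum_{k\in\mathbb{Z}^d}u(k)e^{\mathrm{i}k\cdot\theta}$ satisfies $\hat u(\theta)\neq 0$ for all $\theta\in[0,2\pi)^d$, and that $\mu$ has a density $\rho\in W^{2,1}(\mathbb{R})$. Let $\Lambda\subset\mathbb{Z}^d$ be finite. Then for all $x,y\in\Lambda$ with $x\neq y$, all $z\in\mathbb{C}$ with $\operatorname{Im} z>0$ and all $\lambda>0$, \[ \mathbb{E}\left(\det\left\{\operatorname{Im}\begin{pmatrix} G_{\omega,\Lambda}(z;x,x) & G_{\omega,\Lambda}(z;x,y)\\ G_{\omega,\Lambda}(z;y,x) & G_{\omega,\Lambda}(z;y,y)\end{pmatrix}\right\}\right)\le\left(\frac{\pi}{\lambda}\right)^2 C_{\rm Min}, \] where \[ C_{\rm Min}=\frac{C_u^2}{4}\max\{\lVert\rho'\rVert_1^2,\lVert\rho''\rVert_1\},\qquad C_u=\lVert A^{-1}\rVert_1 . \]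
   Context: $\Delta$ is the discrete Laplacian on $\ell^2(\mathbb{Z}^d)$, $(\Delta\psi)(x)=\sum_{|y-x|_1=1}\psi(y)$, and $V_\omega$ acts as a multiplication operator. The probability space is $\Omega=\prod_{k\in\mathbb{Z}^d}\mathbb{R}$ with the product $\sigma$-algebra and $\mathbb{P}=\prod_{k\in\mathbb{Z}^d}\mu$; $\mathbb{E}$ is the expectation with respect to $\mathbb{P}$. For $\Lambda\subset\mathbb{Z}^d$, $H_{\omega,\Lambda}:\ell^2(\Lambda)\to\ell^2(\Lambda)$ is the natural restriction of $H_\omega$ to $\Lambda$ (matrix elements $\langle\delta_x,H_\omega\delta_y\rangle$, $x,y\in\Lambda$). For $z\in\mathbb{C}\setminus\sigma(H_{\omega,\Lambda})$, $G_{\omega,\Lambda}(z;x,y)=\langle\delta_x,(H_{\omega,\Lambda}-z)^{-1}\delta_y\rangle$. For a square matrix $M$, $\operatorname{Im}M=(M-M^* )/(2\mathrm{i})$. $\rho',\rho''$ are weak derivatives, and $\lVert\cdot\rVert_1$ applied to them is the $L^1(\mathbb{R})$ norm. $A:\ell^1(\mathbb{Z}^d)\to\ell^1(\mathbb{Z}^d)$ is the bounded linear operator with matrix coefficients $A(j,k)=u(j-k)$, $j,k\in\mathbb{Z}^d$; since $\hat u$ has no zeros, $A$ has a bounded inverse on $\ell^1(\mathbb{Z}^d)$ (Wiener's $1/f$ theorem), and $\lVert A^{-1}\rVert_1<\infty$ denotes its operator norm on $\ell^1(\mathbb{Z}^d)$. *)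

theory Defs
  imports "HOL-Probability.Probability"
begin

text \<open>The lattice \<open>\<int>\<^sup>d\<close> is rendered as \<open>int ^ 'd\<close> with \<open>'d :: finite\<close>, so \<open>d = CARD('d) \<ge> 1\<close>.\<close>

definition lattice_norm1 :: "int ^ 'd::finite \<Rightarrow> int" where
  "lattice_norm1 x = (\<Sum>i\<in>UNIV. \<bar>x $ i\<bar>)"

definition laplacian :: "(int ^ 'd::finite \<Rightarrow> complex) \<Rightarrow> int ^ 'd \<Rightarrow> complex" where
  "laplacian \<psi> x = (\<Sum>y | lattice_norm1 (y - x) = 1. \<psi> y)"

definition alloy_potential ::
    "(int ^ 'd::finite \<Rightarrow> real) \<Rightarrow> (int ^ 'd \<Rightarrow> real) \<Rightarrow> int ^ 'd \<Rightarrow> real" where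
  "alloy_potential u \<omega> x = (\<Sum>\<^sub>\<infinity>k\<in>UNIV. \<omega> k * u (x - k))"

text \<open>The expression is local, so it is written for arbitrary functions on \<open>\<int>\<^sup>d\<close>; below it is
  only applied to the unit vectors \<open>\<delta>\<^sub>y\<close>.\<close>

definition hamiltonian ::
    "(int ^ 'd::finite \<Rightarrow> real) \<Rightarrow> real \<Rightarrow> (int ^ 'd \<Rightarrow> real) \<Rightarrow>
     (int ^ 'd \<Rightarrow> complex) \<Rightarrow> int ^ 'd \<Rightarrow> complex" where
  "hamiltonian u lam \<omega> \<psi> x =
     - laplacian \<psi> x + of_real (lam * alloy_potential u \<omega> x) * \<psi> x"

definition delta :: "'a \<Rightarrow> 'a \<Rightarrow> complex" where
  "delta y x = (if x = y then 1 else 0)"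

definition l2_inner :: "('a \<Rightarrow> complex) \<Rightarrow> ('a \<Rightarrow> complex) \<Rightarrow> complex" where
  "l2_inner \<phi> \<psi> = (\<Sum>\<^sub>\<infinity>x\<in>UNIV. cnj (\<phi> x) * \<psi> x)"

text \<open>For finite \<open>\<Lambda>\<close>, \<open>\<ell>\<^sup>2(\<Lambda>)\<close> is identified with the functions vanishing outside \<open>\<Lambda>\<close>.\<close>

definition l2_on :: "'a set \<Rightarrow> ('a \<Rightarrow> complex) set" where
  "l2_on \<Lambda> = {\<psi>. \<forall>x. x \<notin> \<Lambda> \<longrightarrow> \<psi> x = 0}"

definition hamiltonian_on ::
    "(int ^ 'd::finite \<Rightarrow> real) \<Rightarrow> real \<Rightarrow> (int ^ 'd \<Rightarrow> real) \<Rightarrow> (int ^ 'd) set \<Rightarrow>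
     (int ^ 'd \<Rightarrow> complex) \<Rightarrow> int ^ 'd \<Rightarrow> complex" where
  "hamiltonian_on u lam \<omega> \<Lambda> \<psi> x =
     (if x \<in> \<Lambda> then \<Sum>y\<in>\<Lambda>. l2_inner (delta x) (hamiltonian u lam \<omega> (delta y)) * \<psi> y else 0)"

text \<open>The resolvent is the inverse of \<open>H - z\<close> as a map on \<open>\<ell>\<^sup>2(\<Lambda>)\<close>; it is meaningful for \<open>z\<close>
  outside the spectrum, where that map is bijective (in particular for \<open>Im z > 0\<close>).\<close>

definition resolvent_on ::
    "(int ^ 'd::finite \<Rightarrow> real) \<Rightarrow> real \<Rightarrow> (int ^ 'd \<Rightarrow> real) \<Rightarrow> (int ^ 'd) set \<Rightarrow> complex \<Rightarrow>
     (int ^ 'd \<Rightarrow> complex) \<Rightarrow> int ^ 'd \<Rightarrow> complex" where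
  "resolvent_on u lam \<omega> \<Lambda> z =
     inv_into (l2_on \<Lambda>) (\<lambda>\<psi> x. hamiltonian_on u lam \<omega> \<Lambda> \<psi> x - z * \<psi> x)"

definition green ::
    "(int ^ 'd::finite \<Rightarrow> real) \<Rightarrow> real \<Rightarrow> (int ^ 'd \<Rightarrow> real) \<Rightarrow> (int ^ 'd) set \<Rightarrow> complex \<Rightarrow>
     int ^ 'd \<Rightarrow> int ^ 'd \<Rightarrow> complex" where
  "green u lam \<omega> \<Lambda> z x y = l2_inner (delta x) (resolvent_on u lam \<omega> \<Lambda> z (delta y))"

definition conj_transpose :: "complex ^ 'n ^ 'm \<Rightarrow> complex ^ 'm ^ 'n" where
  "conj_transpose M = (\<chi> i j. cnj (M $ j $ i))"

definition matrix_Im :: "complex ^ 'n ^ 'n \<Rightarrow> complex ^ 'n ^ 'n" where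
  "matrix_Im M = (\<chi> i j. (M - conj_transpose M) $ i $ j / (2 * \<i>))"

definition green_matrix ::
    "(int ^ 'd::finite \<Rightarrow> real) \<Rightarrow> real \<Rightarrow> (int ^ 'd \<Rightarrow> real) \<Rightarrow> (int ^ 'd) set \<Rightarrow> complex \<Rightarrow>
     int ^ 'd \<Rightarrow> int ^ 'd \<Rightarrow> complex ^ 2 ^ 2" where
  "green_matrix u lam \<omega> \<Lambda> z x y =
     vector [vector [green u lam \<omega> \<Lambda> z x x, green u lam \<omega> \<Lambda> z x y],
             vector [green u lam \<omega> \<Lambda> z y x, green u lam \<omega> \<Lambda> z y y]]"

definition disorder_measure :: "real measure \<Rightarrow> (int ^ 'd::finite \<Rightarrow> real) measure" where
  "disorder_measure \<mu> = (\<Pi>\<^sub>M k\<in>UNIV. \<mu>)"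

definition symbol :: "(int ^ 'd::finite \<Rightarrow> real) \<Rightarrow> real ^ 'd \<Rightarrow> complex" where
  "symbol u \<theta> =
     (\<Sum>\<^sub>\<infinity>k\<in>UNIV. of_real (u k) * exp (\<i> * of_real (\<Sum>i\<in>UNIV. of_int (k $ i) * \<theta> $ i)))"

definition ell1 :: "('a \<Rightarrow> complex) set" where
  "ell1 = {f. (\<lambda>k. norm (f k)) summable_on UNIV}"

definition ell1_norm :: "('a \<Rightarrow> complex) \<Rightarrow> real" where
  "ell1_norm f = (\<Sum>\<^sub>\<infinity>k\<in>UNIV. norm (f k))"

definition ell1_onorm :: "(('a \<Rightarrow> complex) \<Rightarrow> 'b \<Rightarrow> complex) \<Rightarrow> real" where
  "ell1_onorm T = (SUP f\<in>{f\<in>ell1. ell1_norm f \<le> 1}. ell1_norm (T f))"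

definition alloy_operator ::
    "(int ^ 'd::finite \<Rightarrow> real) \<Rightarrow> (int ^ 'd \<Rightarrow> complex) \<Rightarrow> int ^ 'd \<Rightarrow> complex" where
  "alloy_operator u f j = (\<Sum>\<^sub>\<infinity>k\<in>UNIV. of_real (u (j - k)) * f k)"

text \<open>If the symbol of \<open>u\<close> has no zeros, Wiener's theorem makes \<open>alloy_operator u\<close> a bijection of
  \<open>ell1\<close> with bounded inverse, so that the following is the genuine norm of \<open>A\<^sup>-\<^sup>1\<close>.\<close>

definition C_u :: "(int ^ 'd::finite \<Rightarrow> real) \<Rightarrow> real" where
  "C_u u = ell1_onorm (inv_into ell1 (alloy_operator u))"

definition measure_support :: "real measure \<Rightarrow> real set" where
  "measure_support \<mu> = {x. \<forall>U. open U \<and> x \<in> U \<longrightarrow> emeasure \<mu> U \<noteq> 0}"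

definition test_functions :: "(real \<Rightarrow> real) set" where
  "test_functions = {\<phi>. (\<forall>n x. (deriv ^^ n) \<phi> field_differentiable at x)
     \<and> compact (closure {x. \<phi> x \<noteq> 0})}"

definition has_weak_derivative :: "(real \<Rightarrow> real) \<Rightarrow> (real \<Rightarrow> real) \<Rightarrow> bool" where
  "has_weak_derivative f g \<longleftrightarrow>
     (\<forall>K. compact K \<longrightarrow> set_integrable lborel K f \<and> set_integrable lborel K g) \<and>
     (\<forall>\<phi>\<in>test_functions. (\<integral>x. f x * deriv \<phi> x \<partial>lborel) = - (\<integral>x. g x * \<phi> x \<partial>lborel))"

text \<open>\<open>\<rho> \<in> W\<^sup>2\<^sup>,\<^sup>1(\<real>)\<close>, with \<open>\<rho>'\<close> and \<open>\<rho>''\<close> representatives of its first and second weak derivatives.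
  These are unique almost everywhere, so their \<open>L\<^sup>1\<close> norms depend on \<open>\<rho>\<close> only.\<close>

definition sobolev_W21 :: "(real \<Rightarrow> real) \<Rightarrow> (real \<Rightarrow> real) \<Rightarrow> (real \<Rightarrow> real) \<Rightarrow> bool" where
  "sobolev_W21 \<rho> \<rho>' \<rho>'' \<longleftrightarrow>
     integrable lborel \<rho> \<and> integrable lborel \<rho>' \<and> integrable lborel \<rho>'' \<and>
     has_weak_derivative \<rho> \<rho>' \<and> has_weak_derivative \<rho>' \<rho>''"

definition L1_norm :: "(real \<Rightarrow> real) \<Rightarrow> real" where
  "L1_norm f = (\<integral>x. \<bar>f x\<bar> \<partial>lborel)"

definition C_Min ::
    "(int ^ 'd::finite \<Rightarrow> real) \<Rightarrow> (real \<Rightarrow> real) \<Rightarrow> (real \<Rightarrow> real) \<Rightarrow> real" where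
  "C_Min u \<rho>' \<rho>'' = (C_u u)\<^sup>2 / 4 * max ((L1_norm \<rho>')\<^sup>2) (L1_norm \<rho>'')"

end

theory Submission
  imports Defs "HOL-Computational_Algebra.Polynomial"
begin

text \<open>
  The potential \<open>V\<^sub>\<omega>\<close> need not be monotone in the single coordinates nor of rank one in them, but the linear map
  \<open>\<omega> \<mapsto> V\<^sub>\<omega>\<close>, which is convolution with \<open>u\<close>, is invertible on \<open>\<ell>\<^sup>1\<close>.  Let \<open>a\<close> and \<open>b\<close> be the columns of the
  inverse at \<open>x\<close> and at \<open>y\<close>.  Then replacing \<open>\<omega>\<close> by \<open>\<omega> + s a + t b\<close> adds exactly \<open>s\<close> to the potential at \<open>x\<close> and
  \<open>t\<close> to the potential at \<open>y\<close>, and changes nothing else.  Write \<open>F \<omega>\<close> for the determinant in question.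

  Two facts combine.  First, the average of \<open>F\<close> over such a plane is bounded: for every \<open>\<omega>\<close> the integral of
  \<open>F (\<omega> + s a + t b)\<close> over all \<open>s\<close> and \<open>t\<close> is at most \<open>(\<pi> / \<lambda>)\<^sup>2\<close>
  (\<open>nn_integral_im_det_two_sites_scaled_le\<close>).  Indeed the \<open>2 \<times> 2\<close> Green matrix \<open>g\<close> of the perturbed operator satisfies
  \<open>det Im g\<^sub>s\<^sub>,\<^sub>t = det Im g / \<bar>det (1 + g diag(s, t))\<bar>\<^sup>2\<close>, which can be integrated explicitly.  Second, the joint density
  \<open>R\<close> of the finitely many \<open>\<omega>\<^sub>i\<close> that enter satisfies
  \<open>R \<omega> \<le> 1/4 \<integral>\<integral> \<bar>\<partial>\<^sub>a \<partial>\<^sub>b R\<bar> (\<omega> - s a - t b) ds dt\<close>, since a compactly supported function on a line is at most half of its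
  total variation.  Inserting this into the expectation of \<open>F\<close> and translating \<open>\<omega>\<close> puts the plane average onto \<open>F\<close>,
  so that the expectation is at most \<open>1/4 (\<pi> / \<lambda>)\<^sup>2\<close> times the \<open>L\<^sup>1\<close> norm of \<open>\<partial>\<^sub>a \<partial>\<^sub>b R\<close>.  As \<open>R\<close> is a product, that norm
  is at most the sum over \<open>i\<close> and \<open>j\<close> of \<open>\<bar>a\<^sub>i\<bar> \<bar>b\<^sub>j\<bar>\<close> times \<open>\<parallel>\<rho>''\<parallel>\<^sub>1\<close> (for \<open>i = j\<close>) or \<open>\<parallel>\<rho>'\<parallel>\<^sub>1\<^sup>2\<close> (for \<open>i \<noteq> j\<close>), and the
  \<open>\<ell>\<^sup>1\<close> norms of \<open>a\<close> and \<open>b\<close> are at most \<open>C\<^sub>u\<close> (\<open>nn_integral_tensor_density_le\<close>).  Because \<open>a\<close> and \<open>b\<close> live on the whole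
  lattice while only the finitely many coordinates that influence \<open>\<Lambda>\<close> are shifted, no finite section of \<open>A\<close> ever has
  to be inverted.

  Two points need preparation.  The density is only weakly differentiable; it is replaced by smooth mollifications
  \<open>\<rho> * \<eta>\<close>, whose derivatives have \<open>L\<^sup>1\<close> norms bounded by those of \<open>\<rho>'\<close> and \<open>\<rho>''\<close>.  This amounts to adding small independent
  noise to \<open>\<omega>\<close>, and the expectation is stable under it because \<open>F\<close> is Lipschitz continuous in the potential by the
  resolvent identity.  Furthermore \<open>C\<^sub>u\<close> is a norm of the inverse only if convolution with \<open>u\<close> really is
  boundedly invertible on \<open>\<ell>\<^sup>1\<close>.  For finitely supported \<open>u\<close> this follows from the Neumann series of the positive
  operator \<open>u\<^sup>* * u\<close>: convolution powers of \<open>v = \<delta> - u\<^sup>* * u / M\<close> are exponentially small in each point, being Fourier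
  coefficients of powers of a symbol with values in \<open>[0, q]\<close>, \<open>q < 1\<close>, and are supported in boxes of polynomial size.
\<close>

section \<open>Convolution with a finitely supported kernel on \<open>\<ell>\<^sup>1\<close>\<close>

text \<open>Summing over the support of \<open>v\<close> lets a finitely supported \<open>v\<close> act on arbitrary functions, bounded or not.\<close>

definition conv :: "('a::ab_group_add \<Rightarrow> complex) \<Rightarrow> ('a \<Rightarrow> complex) \<Rightarrow> 'a \<Rightarrow> complex" where
  "conv v f k = (\<Sum>m | v m \<noteq> 0. v m * f (k - m))"

lemma conv_eq_sum:
  assumes "finite S" "{m. v m \<noteq> 0} \<subseteq> S"
  shows "conv v f k = (\<Sum>m\<in>S. v m * f (k - m))"
  unfolding conv_def using assms by (intro sum.mono_neutral_left) auto

lemma ell1I: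
  assumes "\<And>F. finite F \<Longrightarrow> (\<Sum>k\<in>F. norm (f k)) \<le> B"
  shows "f \<in> ell1" and "ell1_norm f \<le> B"
proof -
  have "(\<lambda>k. norm (f k)) summable_on UNIV"
    by (rule nonneg_bdd_above_summable_on) (auto intro!: bdd_aboveI[where M = B] assms)
  then show "f \<in> ell1" "ell1_norm f \<le> B"
    unfolding ell1_def ell1_norm_def by (auto intro!: infsum_le_finite_sums assms)
qed

lemma sum_le_ell1_norm:
  assumes "f \<in> ell1" "finite F"
  shows "(\<Sum>k\<in>F. norm (f k)) \<le> ell1_norm f"
  using assms unfolding ell1_def ell1_norm_def by (auto intro!: finite_sum_le_infsum)

lemma ell1_norm_nonneg: "0 \<le> ell1_norm f"
  unfolding ell1_norm_def by (auto intro!: infsum_nonneg)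

lemma ell1_norm_eq_sum:
  assumes "finite S" "{m. v m \<noteq> 0} \<subseteq> S"
  shows "ell1_norm v = (\<Sum>m\<in>S. norm (v m))"
proof -
  have "ell1_norm v = (\<Sum>\<^sub>\<infinity>m\<in>S. norm (v m))"
    unfolding ell1_norm_def using assms by (intro infsum_cong_neutral) auto
  then show ?thesis using assms by simp
qed

lemma finite_support_ell1:
  assumes "finite {m. v m \<noteq> 0}"
  shows "v \<in> ell1"
proof (rule ell1I)
  fix F :: "'a set" assume "finite F"
  then show "(\<Sum>k\<in>F. norm (v k)) \<le> (\<Sum>k\<in>{m. v m \<noteq> 0}. norm (v k))"
    using assms
    by (subst sum.mono_neutral_right[of F "F \<inter> {m. v m \<noteq> 0}"]) (auto intro!: sum_mono2)
qed

lemma ell1_norm_add_le: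
  assumes "f \<in> ell1" "g \<in> ell1"
  shows "(\<lambda>k. f k + g k) \<in> ell1" "ell1_norm (\<lambda>k. f k + g k) \<le> ell1_norm f + ell1_norm g"
proof -
  have *: "(\<Sum>k\<in>F. norm (f k + g k)) \<le> ell1_norm f + ell1_norm g" if "finite F" for F
  proof -
    have "(\<Sum>k\<in>F. norm (f k + g k)) \<le> (\<Sum>k\<in>F. norm (f k)) + (\<Sum>k\<in>F. norm (g k))"
      by (subst sum.distrib[symmetric]) (intro sum_mono norm_triangle_ineq)
    with sum_le_ell1_norm[OF assms(1) that] sum_le_ell1_norm[OF assms(2) that] show ?thesis
      by linarith
  qed
  show "(\<lambda>k. f k + g k) \<in> ell1" "ell1_norm (\<lambda>k. f k + g k) \<le> ell1_norm f + ell1_norm g"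
    by (rule ell1I[OF *]; assumption)+
qed

text \<open>Young's inequality: convolution with \<open>v\<close> is a combination of translations, which are
  isometries, weighted by the values of \<open>v\<close>.\<close>

lemma ell1_conv:
  assumes v: "finite {m. v m \<noteq> 0}" and f: "f \<in> ell1"
  shows "conv v f \<in> ell1" "ell1_norm (conv v f) \<le> ell1_norm v * ell1_norm f"
proof -
  let ?S = "{m. v m \<noteq> 0}"
  have *: "(\<Sum>k\<in>F. norm (conv v f k)) \<le> ell1_norm v * ell1_norm f" if F: "finite F" for F
  proof -
    have "(\<Sum>k\<in>F. norm (conv v f k)) \<le> (\<Sum>k\<in>F. \<Sum>m\<in>?S. norm (v m) * norm (f (k - m)))"
      unfolding conv_def by (intro sum_mono order.trans[OF norm_sum]) (simp add: norm_mult)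
    also have "\<dots> = (\<Sum>m\<in>?S. norm (v m) * (\<Sum>k\<in>F. norm (f (k - m))))"
      by (subst sum.swap) (simp add: sum_distrib_left)
    also have "\<dots> \<le> (\<Sum>m\<in>?S. norm (v m) * ell1_norm f)"
    proof (intro sum_mono mult_left_mono)
      fix m
      have "(\<Sum>k\<in>F. norm (f (k - m))) = (\<Sum>k\<in>(\<lambda>k. k - m) ` F. norm (f k))"
        by (subst sum.reindex) (auto simp: inj_on_def)
      then show "(\<Sum>k\<in>F. norm (f (k - m))) \<le> ell1_norm f"
        using sum_le_ell1_norm[OF f] F by simp
    qed auto
    also have "\<dots> = ell1_norm v * ell1_norm f"
      using ell1_norm_eq_sum[OF v] by (simp add: sum_distrib_right)
    finally show ?thesis .
  qed
  show "conv v f \<in> ell1" "ell1_norm (conv v f) \<le> ell1_norm v * ell1_norm f"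
    by (rule ell1I[OF *]; assumption)+
qed

lemma delta_0_conv: "conv (delta 0) f = f"
  by (rule ext, subst conv_eq_sum[of "{0}"]) (auto simp: delta_def)

lemma conv_nonzeroE:
  assumes "conv v f k \<noteq> 0"
  obtains m where "v m \<noteq> 0" "f (k - m) \<noteq> 0"
  using assms unfolding conv_def by (auto elim: sum.not_neutral_contains_not_neutral)

lemma finite_support_conv:
  assumes "finite {m. v m \<noteq> 0}" "finite {m. w m \<noteq> 0}"
  shows "finite {m. conv v w m \<noteq> 0}"
proof (rule finite_subset)
  show "{m. conv v w m \<noteq> 0} \<subseteq> (\<lambda>(a, b). a + b) ` ({m. v m \<noteq> 0} \<times> {m. w m \<noteq> 0})"
  proof
    fix k assume "k \<in> {m. conv v w m \<noteq> 0}"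
    then obtain m where "v m \<noteq> 0" "w (k - m) \<noteq> 0"
      by (auto elim: conv_nonzeroE)
    then show "k \<in> (\<lambda>(a, b). a + b) ` ({m. v m \<noteq> 0} \<times> {m. w m \<noteq> 0})"
      by (intro image_eqI[of _ _ "(m, k - m)"]) auto
  qed
qed (use assms in auto)

text \<open>Translations commute, so both sides are the same sum over the product of the two supports.\<close>

lemma conv_commute: "conv v (conv w f) = conv w (conv v f)"
proof
  fix k
  have "conv v (conv w f) k = (\<Sum>m | v m \<noteq> 0. \<Sum>l | w l \<noteq> 0. v m * w l * f (k - m - l))"
    by (simp add: conv_def sum_distrib_left mult.assoc)
  also have "\<dots> = (\<Sum>l | w l \<noteq> 0. \<Sum>m | v m \<noteq> 0. v m * w l * f (k - m - l))"
    by (rule sum.swap)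
  also have "\<dots> = conv w (conv v f) k"
    unfolding conv_def sum_distrib_left
    by (intro sum.cong refl) (simp add: diff_diff_eq add.commute mult_ac)
  finally show "conv v (conv w f) k = conv w (conv v f) k" .
qed

lemma conv_assoc:
  assumes "finite {m. v m \<noteq> 0}" "finite {m. w m \<noteq> 0}"
  shows "conv v (conv w f) = conv (conv v w) f"
proof
  fix k
  let ?V = "{m. v m \<noteq> 0}" and ?W = "{m. w m \<noteq> 0}"
  let ?P = "(\<lambda>(a, b). a + b) ` (?V \<times> ?W) \<union> {m. conv v w m \<noteq> 0}"
  have P: "finite ?P" using assms finite_support_conv by blast
  have "conv (conv v w) f k = (\<Sum>p\<in>?P. \<Sum>m\<in>?V. v m * w (p - m) * f (k - p))"
    by (subst conv_eq_sum[OF P]) (auto simp: conv_def sum_distrib_right)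
  also have "\<dots> = (\<Sum>m\<in>?V. \<Sum>p\<in>?P. v m * w (p - m) * f (k - p))"
    by (rule sum.swap)
  also have "\<dots> = (\<Sum>m\<in>?V. \<Sum>l\<in>?W. v m * w l * f (k - m - l))"
  proof (rule sum.cong[OF refl])
    fix m assume m: "m \<in> ?V"
    have "(\<Sum>p\<in>?P. v m * w (p - m) * f (k - p))
        = (\<Sum>p\<in>(\<lambda>l. m + l) ` ?W. v m * w (p - m) * f (k - p))"
      using P m by (intro sum.mono_neutral_right) (auto intro!: image_eqI)
    also have "\<dots> = (\<Sum>l\<in>?W. v m * w l * f (k - m - l))"
      by (subst sum.reindex) (auto simp: algebra_simps)
    finally show "(\<Sum>p\<in>?P. v m * w (p - m) * f (k - p)) = (\<Sum>l\<in>?W. v m * w l * f (k - m - l))" .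
  qed
  also have "\<dots> = conv v (conv w f) k"
    by (simp add: conv_def sum_distrib_left mult.assoc)
  finally show "conv v (conv w f) k = conv (conv v w) f k" by simp
qed

lemma conv_sum: "conv v (\<lambda>k. \<Sum>i\<in>A. f i k) = (\<lambda>k. \<Sum>i\<in>A. conv v (f i) k)"
  by (rule ext, simp add: conv_def sum_distrib_left) (rule sum.swap)

lemma conv_cmult: "conv v (\<lambda>k. c * f k) = (\<lambda>k. c * conv v f k)"
  by (auto simp: conv_def fun_eq_iff sum_distrib_left mult.left_commute)

lemma conv_diff_left:
  assumes "finite {m. v m \<noteq> 0}" "finite {m. w m \<noteq> 0}"
  shows "conv (\<lambda>m. v m - c * w m) f = (\<lambda>k. conv v f k - c * conv w f k)"
proof
  fix k
  let ?S = "{m. v m \<noteq> 0} \<union> {m. w m \<noteq> 0}"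
  have S: "finite ?S" using assms by simp
  show "conv (\<lambda>m. v m - c * w m) f k = conv v f k - c * conv w f k"
    by (subst (1 2 3) conv_eq_sum[OF S])
      (auto simp: left_diff_distrib sum_subtractf sum_distrib_left mult.assoc)
qed

lemma tendsto_conv:
  assumes "\<And>k. (\<lambda>n. f n k) \<longlonglongrightarrow> g k"
  shows "(\<lambda>n. conv v (f n) k) \<longlonglongrightarrow> conv v g k"
  unfolding conv_def by (intro tendsto_intros assms)

lemma finite_support_iterate:
  assumes "finite {m. v m \<noteq> 0}" "finite {m. f m \<noteq> 0}"
  shows "finite {m. (conv v ^^ n) f m \<noteq> 0}"
  by (induction n) (use assms finite_support_conv in auto)

lemma iterate_conv:
  assumes "finite {m. v m \<noteq> 0}"
  shows "(conv v ^^ n) f = conv ((conv v ^^ n) (delta 0)) f"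
proof (induction n)
  case 0 then show ?case by (simp add: delta_0_conv)
next
  case (Suc n)
  have "finite {m. (conv v ^^ n) (delta 0) m \<noteq> 0}"
    by (rule finite_support_iterate[OF assms]) (auto simp: delta_def)
  then show ?case using Suc conv_assoc[OF assms] by simp
qed

section \<open>Invertibility of convolution operators without zeros of the symbol\<close>

text \<open>The character \<open>k \<mapsto> exp (i k \<cdot> \<theta>)\<close> of the lattice.\<close>

definition char :: "real ^ 'd::finite \<Rightarrow> int ^ 'd \<Rightarrow> complex" where
  "char \<theta> k = exp (\<i> * of_real (\<Sum>i\<in>UNIV. of_int (k $ i) * \<theta> $ i))"

lemma char_add: "char \<theta> (k + l) = char \<theta> k * char \<theta> l"
  by (simp add: char_def exp_add[symmetric] sum.distrib algebra_simps)

lemma norm_char: "norm (char \<theta> k) = 1"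
  by (simp add: char_def)

lemma cnj_char: "cnj (char \<theta> k) = char \<theta> (- k)"
  by (simp add: char_def exp_cnj sum_negf)

lemma symbol_eq_sum:
  assumes "finite {k. u k \<noteq> 0}"
  shows "symbol u \<theta> = (\<Sum>k | u k \<noteq> 0. of_real (u k) * char \<theta> k)"
proof -
  have "symbol u \<theta> = (\<Sum>\<^sub>\<infinity>k\<in>{k. u k \<noteq> 0}. of_real (u k) * char \<theta> k)"
    unfolding symbol_def char_def by (intro infsum_cong_neutral) auto
  then show ?thesis using assms by simp
qed

text \<open>Characters are eigenvectors of every convolution operator; the eigenvalue is the symbol.\<close>

lemma conv_char:
  assumes "finite {k. u k \<noteq> 0}"
  shows "conv (\<lambda>m. of_real (u m)) (\<lambda>k. char \<theta> (- k)) = (\<lambda>k. symbol u \<theta> * char \<theta> (- k))"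
proof
  fix k
  have "char \<theta> (- (k - m)) = char \<theta> m * char \<theta> (- k)" for m
    by (simp add: char_add[symmetric])
  then show "conv (\<lambda>m. of_real (u m)) (\<lambda>k. char \<theta> (- k)) k = symbol u \<theta> * char \<theta> (- k)"
    by (simp add: conv_def symbol_eq_sum[OF assms] sum_distrib_right mult.assoc)
qed

lemma symbol_reflect:
  assumes "finite {k. u k \<noteq> 0}"
  shows "symbol (\<lambda>k. u (- k)) \<theta> = cnj (symbol u \<theta>)"
proof -
  have *: "{k. u (- k) \<noteq> 0} = uminus ` {k. u k \<noteq> 0}"
    by (auto intro!: image_eqI[of _ uminus "- _"])
  then have fin: "finite {k. u (- k) \<noteq> 0}" using assms by simp
  have "symbol (\<lambda>k. u (- k)) \<theta> = (\<Sum>k\<in>uminus ` {k. u k \<noteq> 0}. of_real (u (- k)) * char \<theta> k)"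
    unfolding symbol_eq_sum[OF fin] * ..
  also have "\<dots> = (\<Sum>k | u k \<noteq> 0. of_real (u k) * char \<theta> (- k))"
    by (subst sum.reindex) (auto simp: inj_on_def)
  finally show ?thesis by (simp add: symbol_eq_sum[OF assms] cnj_char)
qed

lemma symbol_lower_bound:
  fixes u :: "int ^ 'd::finite \<Rightarrow> real"
  assumes fin: "finite {k. u k \<noteq> 0}"
    and nz: "\<And>\<theta>. (\<forall>i. 0 \<le> \<theta> $ i \<and> \<theta> $ i < 2 * pi) \<Longrightarrow> symbol u \<theta> \<noteq> 0"
  obtains c where "c > 0" "\<And>\<theta>. (\<forall>i. 0 \<le> \<theta> $ i \<and> \<theta> $ i < 2 * pi) \<Longrightarrow> c \<le> norm (symbol u \<theta>)"
proof -
  let ?B = "cbox 0 (\<chi> i. 2 * pi) :: (real ^ 'd) set"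
  have cont: "continuous_on ?B (\<lambda>\<theta>. norm (symbol u \<theta>))"
    unfolding symbol_eq_sum[OF fin] char_def by (intro continuous_intros)
  have "0 \<in> ?B" by (auto simp: mem_box_cart)
  then obtain \<theta>0 where \<theta>0: "\<theta>0 \<in> ?B" "\<And>\<theta>. \<theta> \<in> ?B \<Longrightarrow> norm (symbol u \<theta>0) \<le> norm (symbol u \<theta>)"
    using continuous_attains_inf[OF compact_cbox _ cont] by blast
  \<comment> \<open>The minimum may lie on a face \<open>\<theta>\<^sub>i = 2\<pi>\<close>; periodicity moves it into the half-open cube.\<close>
  define \<theta>1 where "\<theta>1 = (\<chi> i. if \<theta>0 $ i = 2 * pi then 0 else \<theta>0 $ i)"
  have "char \<theta>0 k = char \<theta>1 k" for k
  proof -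
    have "exp (\<i> * of_real (of_int (k $ i) * \<theta>0 $ i)) = exp (\<i> * of_real (of_int (k $ i) * \<theta>1 $ i))" for i
      using exp_integer_2pi[of "of_int (k $ i)"] by (auto simp: \<theta>1_def mult_ac)
    then show ?thesis
      by (simp add: char_def sum_distrib_left exp_sum)
  qed
  then have "symbol u \<theta>0 = symbol u \<theta>1" by (simp add: symbol_eq_sum[OF fin])
  moreover have "symbol u \<theta>1 \<noteq> 0"
    using \<theta>0(1) by (intro nz) (auto simp: \<theta>1_def mem_box_cart order.order_iff_strict)
  ultimately have "norm (symbol u \<theta>0) > 0" by simp
  then show ?thesis
    by (rule that) (auto intro!: \<theta>0(2) simp: mem_box_cart less_imp_le)
qed

definition torus_grid :: "nat \<Rightarrow> ('d::finite \<Rightarrow> nat) \<Rightarrow> real ^ 'd" where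
  "torus_grid N g = (\<chi> i. 2 * pi * real (g i) / real N)"

lemma sum_roots_of_unity_power:
  assumes N: "N > 0" and l: "\<bar>l\<bar> < int N"
  shows "(\<Sum>j<N. exp (\<i> * of_real (of_int l * (2 * pi * real j / real N)))) = (if l = 0 then of_nat N else 0)"
proof (cases "l = 0")
  case False
  let ?z = "exp (\<i> * of_real (2 * pi * of_int l / real N))"
  have pow: "exp (\<i> * of_real (of_int l * (2 * pi * real j / real N))) = ?z ^ j" for j
    by (simp add: exp_of_nat_mult[symmetric] mult_ac)
  have "?z \<noteq> 1"
  proof
    assume "?z = 1"
    then obtain n :: int where "2 * pi * of_int l / real N = of_int (2 * n) * pi"
      by (auto simp: exp_eq_1)
    then have "of_int l = of_int n * real N" using N by (simp add: field_simps)
    then have "l = n * int N"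
      by (metis of_int_eq_iff of_int_mult of_int_of_nat_eq)
    then have "\<bar>l\<bar> = \<bar>n\<bar> * int N" by (simp add: abs_mult)
    moreover have "\<bar>n\<bar> \<ge> 1" using False \<open>l = n * int N\<close> by auto
    ultimately show False using l N mult_right_mono[of 1 "\<bar>n\<bar>" "int N"] by simp
  qed
  moreover have "?z ^ N = 1"
    using exp_integer_2pi[of "of_int l"] N by (simp add: exp_of_nat_mult[symmetric] mult_ac)
  ultimately have "(\<Sum>j<N. ?z ^ j) = 0"
    by (simp add: geometric_sum)
  then show ?thesis using False by (simp only: pow) simp
qed simp

text \<open>Orthogonality of the characters of \<open>(\<int>/N\<int>)\<^sup>d\<close>: the mean over the grid of \<open>N\<close>-th roots of unity
  is the \<open>N\<close>-periodic extension of the unit mass, so it agrees with the unit mass near \<open>0\<close>.\<close>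

lemma grid_mean_char:
  fixes k :: "int ^ 'd::finite"
  assumes N: "N > 0" and k: "\<And>i. \<bar>k $ i\<bar> < int N"
  shows "(\<Sum>g\<in>(\<Pi>\<^sub>E i\<in>UNIV. {..<N}). char (torus_grid N g) (- k)) / of_nat N ^ CARD('d) = delta 0 k"
proof -
  have "(\<Sum>g\<in>(\<Pi>\<^sub>E i\<in>UNIV. {..<N}). char (torus_grid N g) (- k))
      = (\<Sum>g\<in>(\<Pi>\<^sub>E i\<in>UNIV. {..<N}). \<Prod>i\<in>UNIV. exp (\<i> * of_real (of_int ((- k) $ i) * (2 * pi * real (g i) / real N))))"
    by (simp add: char_def torus_grid_def sum_distrib_left exp_sum)
  also have "\<dots> = (\<Prod>i\<in>(UNIV :: 'd set). \<Sum>j<N. exp (\<i> * of_real (of_int ((- k) $ i) * (2 * pi * real j / real N))))"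
    by (rule prod_sum_PiE[symmetric]) auto
  also have "\<dots> = (\<Prod>i\<in>(UNIV :: 'd set). if (- k) $ i = 0 then of_nat N else 0)"
    by (intro prod.cong refl sum_roots_of_unity_power N) (use k in auto)
  also have "\<dots> = (if k = 0 then of_nat N ^ CARD('d) else 0)"
    by (auto simp: vec_eq_iff)
  finally show ?thesis using N by (simp add: delta_def)
qed

text \<open>If every character is an eigenvector of convolution with \<open>v\<close>, with eigenvalue at most \<open>q\<close> in
  modulus, then the values of the \<open>n\<close>-th convolution power of \<open>v\<close>, being Fourier coefficients of the
  \<open>n\<close>-th power of its symbol, are at most \<open>q\<^sup>n\<close>.\<close>

lemma norm_convolution_power_le:
  fixes v :: "int ^ 'd::finite \<Rightarrow> complex" and t :: "real ^ 'd \<Rightarrow> complex"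
  assumes eig: "\<And>\<theta>. conv v (\<lambda>k. char \<theta> (- k)) = (\<lambda>k. t \<theta> * char \<theta> (- k))"
    and t: "\<And>\<theta>. (\<forall>i. 0 \<le> \<theta> $ i \<and> \<theta> $ i < 2 * pi) \<Longrightarrow> norm (t \<theta>) \<le> q"
  shows "norm ((conv v ^^ n) (delta 0) k) \<le> q ^ n"
proof -
  define G where "G N = (\<Pi>\<^sub>E i\<in>(UNIV :: 'd set). {..<N})" for N :: nat
  define D where "D N k = (\<Sum>g\<in>G N. char (torus_grid N g) (- k)) / of_nat N ^ CARD('d)" for N k
  have iter: "(conv v ^^ n) (D N)
      = (\<lambda>k. (\<Sum>g\<in>G N. t (torus_grid N g) ^ n * char (torus_grid N g) (- k)) / of_nat N ^ CARD('d))" for N n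
  proof (induction n)
    case (Suc n)
    have "conv v (\<lambda>k. (1 / of_nat N ^ CARD('d)) * (\<Sum>g\<in>G N. t (torus_grid N g) ^ n * char (torus_grid N g) (- k)))
       = (\<lambda>k. (1 / of_nat N ^ CARD('d)) * (\<Sum>g\<in>G N. t (torus_grid N g) ^ n * (t (torus_grid N g) * char (torus_grid N g) (- k))))"
      by (simp only: conv_cmult conv_sum eig)
    then show ?case by (simp add: Suc mult_ac)
  qed (auto simp: D_def)
  have bound: "norm ((conv v ^^ n) (D N) k) \<le> q ^ n" if "N > 0" for N
  proof -
    have "norm (\<Sum>g\<in>G N. t (torus_grid N g) ^ n * char (torus_grid N g) (- k)) \<le> (\<Sum>g\<in>G N. q ^ n)"
    proof (intro order.trans[OF norm_sum] sum_mono)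
      fix g assume "g \<in> G N"
      then have "norm (t (torus_grid N g)) \<le> q"
        using that by (intro t) (auto simp: G_def torus_grid_def field_simps PiE_iff)
      then show "norm (t (torus_grid N g) ^ n * char (torus_grid N g) (- k)) \<le> q ^ n"
        by (simp add: norm_mult norm_char norm_power power_mono)
    qed
    also have "\<dots> = real N ^ CARD('d) * q ^ n" by (simp add: G_def card_PiE)
    finally show ?thesis using that by (simp add: iter norm_divide norm_power field_simps)
  qed
  \<comment> \<open>The means \<open>D N\<close> tend to the unit mass pointwise, and convolution is continuous for pointwise convergence.\<close>
  have "(\<lambda>N. (conv v ^^ n) (D N) k) \<longlonglongrightarrow> (conv v ^^ n) (delta 0) k"
  proof (induction n arbitrary: k)
    case 0
    have "\<forall>\<^sub>F N in sequentially. D N k = delta 0 k"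
      using eventually_gt_at_top[of "nat (\<Sum>i\<in>UNIV. \<bar>k $ i\<bar>)"]
    proof eventually_elim
      case (elim N)
      have "\<bar>k $ i\<bar> \<le> (\<Sum>i\<in>UNIV. \<bar>k $ i\<bar>)" for i by (rule member_le_sum) auto
      moreover have "(\<Sum>i\<in>UNIV. \<bar>k $ i\<bar>) < int N" using elim by (simp add: nat_less_iff sum_nonneg)
      ultimately have "\<bar>k $ i\<bar> < int N" for i using order.strict_trans1 by blast
      then show ?case unfolding D_def G_def using elim by (intro grid_mean_char) auto
    qed
    then show ?case by (simp add: tendsto_eventually)
  next
    case (Suc n)
    then show ?case by (auto intro: tendsto_conv)
  qed
  then show ?thesis
    by (rule tendsto_upperbound[OF tendsto_norm])
      (auto intro: eventually_mono[OF eventually_gt_at_top[of 0]] bound)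
qed

lemma card_box:
  "finite {k :: int ^ 'd::finite. \<forall>i. \<bar>k $ i\<bar> \<le> int n}"
  "card {k :: int ^ 'd::finite. \<forall>i. \<bar>k $ i\<bar> \<le> int n} = (2 * n + 1) ^ CARD('d)"
proof -
  have eq: "bij_betw (\<lambda>k i. k $ i) {k :: int ^ 'd. \<forall>i. \<bar>k $ i\<bar> \<le> int n} (\<Pi>\<^sub>E i\<in>UNIV. {- int n..int n})"
    by (rule bij_betw_byWitness[of _ "\<lambda>f. \<chi> i. f i"]) (auto simp: abs_le_iff PiE_iff minus_le_iff)
  show "card {k :: int ^ 'd. \<forall>i. \<bar>k $ i\<bar> \<le> int n} = (2 * n + 1) ^ CARD('d)"
    using bij_betw_same_card[OF eq] by (simp add: card_PiE nat_add_distrib nat_mult_distrib)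
  show "finite {k :: int ^ 'd. \<forall>i. \<bar>k $ i\<bar> \<le> int n}"
    using bij_betw_finite[OF eq] by (simp add: finite_PiE)
qed

text \<open>The convolution powers of \<open>v\<close> live on boxes of polynomially growing cardinality, while their
  values decay like \<open>q\<^sup>n\<close>.\<close>

lemma convolution_power_tendsto_0:
  fixes v :: "int ^ 'd::finite \<Rightarrow> complex"
  assumes v: "finite {m. v m \<noteq> 0}" and q: "0 \<le> q" "q < 1"
    and le: "\<And>n k. norm ((conv v ^^ n) (delta 0) k) \<le> q ^ n"
  shows "(\<lambda>n. ell1_norm ((conv v ^^ n) (delta 0))) \<longlonglongrightarrow> 0"
proof -
  define R where "R = nat (\<Sum>m | v m \<noteq> 0. \<Sum>i\<in>UNIV. \<bar>m $ i\<bar>)"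
  have R: "\<bar>m $ i\<bar> \<le> int R" if "v m \<noteq> 0" for m i
  proof -
    have "\<bar>m $ i\<bar> \<le> (\<Sum>i\<in>UNIV. \<bar>m $ i\<bar>)" by (rule member_le_sum) auto
    also have "\<dots> \<le> (\<Sum>m | v m \<noteq> 0. \<Sum>i\<in>UNIV. \<bar>m $ i\<bar>)"
      using that v by (intro member_le_sum) (auto intro: sum_nonneg)
    also have "\<dots> = int R" unfolding R_def by (simp add: sum_nonneg)
    finally show ?thesis .
  qed
  have supp: "\<bar>k $ i\<bar> \<le> int (n * R)" if "(conv v ^^ n) (delta 0) k \<noteq> 0" for n k i
    using that
  proof (induction n arbitrary: k)
    case 0
    then show ?case by (auto simp: delta_def split: if_splits)
  next
    case (Suc n)
    then obtain m where "v m \<noteq> 0" "(conv v ^^ n) (delta 0) (k - m) \<noteq> 0"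
      by (auto elim: conv_nonzeroE)
    then have "\<bar>m $ i\<bar> \<le> int R" "\<bar>(k - m) $ i\<bar> \<le> int (n * R)"
      using R Suc.IH[of "k - m"] by auto
    then show ?case by (simp add: algebra_simps) 
  qed
  have bound: "ell1_norm ((conv v ^^ n) (delta 0)) \<le> real ((2 * (n * R) + 1) ^ CARD('d)) * q ^ n" for n
  proof -
    let ?B = "{k :: int ^ 'd. \<forall>i. \<bar>k $ i\<bar> \<le> int (n * R)}"
    have "ell1_norm ((conv v ^^ n) (delta 0)) = (\<Sum>k\<in>?B. norm ((conv v ^^ n) (delta 0) k))"
      using supp by (intro ell1_norm_eq_sum card_box) auto
    also have "\<dots> \<le> (\<Sum>k\<in>?B. q ^ n)" by (intro sum_mono le)
    finally show ?thesis using card_box(2)[where 'd = 'd, of "n * R"] by simp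
  qed
  \<comment> \<open>Splitting \<open>q\<^sup>n\<close> into \<open>d\<close> factors reduces the limit to \<open>n r\<^sup>n \<rightarrow> 0\<close>.\<close>
  define r where "r = root CARD('d) q"
  have r: "r ^ CARD('d) = q" "0 \<le> r" "norm r < 1"
    using q by (auto simp: r_def real_root_lt_1_iff)
  have "(\<lambda>n. (2 * real R * (real n * r ^ n) + r ^ n) ^ CARD('d)) \<longlonglongrightarrow> (2 * real R * 0 + 0) ^ CARD('d)"
    using r by (intro tendsto_intros powser_times_n_limit_0 LIMSEQ_power_zero)
  moreover have "(2 * real R * (real n * r ^ n) + r ^ n) ^ CARD('d) = real ((2 * (n * R) + 1) ^ CARD('d)) * q ^ n" for n
  proof -
    have "2 * real R * (real n * r ^ n) + r ^ n = real (2 * (n * R) + 1) * r ^ n"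
      by (simp add: algebra_simps)
    then show ?thesis
      by (simp only: power_mult_distrib power_mult[symmetric] mult.commute[of n] of_nat_power)
        (simp only: power_mult r(1))
  qed
  ultimately have "(\<lambda>n. real ((2 * (n * R) + 1) ^ CARD('d)) * q ^ n) \<longlonglongrightarrow> 0"
    by (simp add: zero_power)
  from tendsto_sandwich[OF _ _ tendsto_const this] show ?thesis
    using bound by (simp add: ell1_norm_nonneg)
qed

text \<open>The operator \<open>v = \<delta> - u\<^sup>* * u / M\<close> has symbol \<open>1 - \<bar>symbol u\<bar>\<^sup>2 / M\<close>, which takes values in \<open>[0, q]\<close>
  with \<open>q < 1\<close>, because the symbol of \<open>u\<close> has no zeros.  A high power of \<open>v\<close> is therefore small in
  \<open>\<ell>\<^sup>1\<close>, and a partial sum of the Neumann series for \<open>(u\<^sup>* * u)\<^sup>-\<^sup>1\<close> provides a finitely supported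
  approximate inverse of \<open>u\<close>.\<close>

lemma approximate_convolution_inverse:
  fixes u :: "int ^ 'd::finite \<Rightarrow> real"
  assumes fin: "finite {k. u k \<noteq> 0}"
    and nz: "\<And>\<theta>. (\<forall>i. 0 \<le> \<theta> $ i \<and> \<theta> $ i < 2 * pi) \<Longrightarrow> symbol u \<theta> \<noteq> 0"
  shows "\<exists>b w. finite {m. b m \<noteq> 0} \<and> finite {m. w m \<noteq> 0} \<and> ell1_norm w \<le> 1 / 2 \<and>
    (\<forall>f. conv (\<lambda>m. of_real (u m)) (conv b f) = (\<lambda>k. f k - conv w f k))"
proof -
  define U where "U = (\<lambda>m. of_real (u m) :: complex)"
  define U' where "U' = (\<lambda>m. of_real (u (- m)) :: complex)"
  define M where "M = (\<Sum>k | u k \<noteq> 0. \<bar>u k\<bar>)\<^sup>2"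
  have U: "finite {m. U m \<noteq> 0}" using fin by (simp add: U_def)
  have "{k. u (- k) \<noteq> 0} = uminus ` {k. u k \<noteq> 0}"
    by (auto intro!: image_eqI[of _ uminus "- _"])
  then have fin': "finite {k. u (- k) \<noteq> 0}" using fin by simp
  then have U': "finite {m. U' m \<noteq> 0}" by (simp add: U'_def)
  obtain c where c: "c > 0" "\<And>\<theta>. (\<forall>i. 0 \<le> \<theta> $ i \<and> \<theta> $ i < 2 * pi) \<Longrightarrow> c \<le> norm (symbol u \<theta>)"
    using symbol_lower_bound[OF fin nz] by blast
  have le_M: "(norm (symbol u \<theta>))\<^sup>2 \<le> M" for \<theta>
    unfolding M_def symbol_eq_sum[OF fin]
    by (intro power_mono order.trans[OF norm_sum]) (auto simp: norm_mult norm_char)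
  have c2: "c\<^sup>2 \<le> (norm (symbol u \<theta>))\<^sup>2" if "\<forall>i. 0 \<le> \<theta> $ i \<and> \<theta> $ i < 2 * pi" for \<theta>
    using c that by (intro power_mono) auto
  have "c\<^sup>2 \<le> (norm (symbol u 0))\<^sup>2" by (rule c2) simp
  with le_M[of 0] zero_less_power[OF c(1), of 2] have M: "M > 0" "c\<^sup>2 \<le> M" by linarith+
  define v where "v = (\<lambda>m. delta 0 m - of_real (1 / M) * conv U' U m)"
  have fin_\<delta>: "finite {m. delta (0 :: int ^ 'd) m \<noteq> 0}" by (simp add: delta_def)
  have fin_v: "finite {m. v m \<noteq> 0}"
    by (rule finite_subset[OF _ finite_UnI[OF fin_\<delta> finite_support_conv[OF U' U]]]) (auto simp: v_def)
  have v: "conv v f = (\<lambda>k. f k - of_real (1 / M) * conv U' (conv U f) k)" for f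
    unfolding v_def conv_diff_left[OF fin_\<delta> finite_support_conv[OF U' U]]
    by (simp add: delta_0_conv conv_assoc[OF U' U])
  define t where "t \<theta> = (1 - of_real ((norm (symbol u \<theta>))\<^sup>2 / M) :: complex)" for \<theta>
  define q where "q = 1 - c\<^sup>2 / M"
  have eig: "conv v (\<lambda>k. char \<theta> (- k)) = (\<lambda>k. t \<theta> * char \<theta> (- k))" for \<theta>
    unfolding v unfolding U_def U'_def conv_char[OF fin] conv_cmult conv_char[OF fin'] symbol_reflect[OF fin]
    by (simp add: t_def fun_eq_iff algebra_simps complex_norm_square del: of_real_power) 
  have q: "0 \<le> q" "q < 1"
    using c(1) M by (auto simp: q_def field_simps)
  have t: "norm (t \<theta>) \<le> q" if "\<forall>i. 0 \<le> \<theta> $ i \<and> \<theta> $ i < 2 * pi" for \<theta>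
  proof -
    have "t \<theta> = of_real (1 - (norm (symbol u \<theta>))\<^sup>2 / M)" by (simp add: t_def)
    then have "norm (t \<theta>) = 1 - (norm (symbol u \<theta>))\<^sup>2 / M"
      using le_M[of \<theta>] M by (simp only: norm_of_real) (simp add: field_simps)
    then show ?thesis using c2[OF that] M by (simp add: q_def divide_right_mono)
  qed
  have "(\<lambda>n. ell1_norm ((conv v ^^ n) (delta 0))) \<longlonglongrightarrow> 0"
    by (rule convolution_power_tendsto_0[OF fin_v q norm_convolution_power_le[OF eig t]])
  then have "\<forall>\<^sub>F n in sequentially. ell1_norm ((conv v ^^ n) (delta 0)) < 1 / 2"
    by (rule order_tendstoD) simp
  then obtain n where n: "ell1_norm ((conv v ^^ n) (delta 0)) < 1 / 2"
    by (auto simp: eventually_sequentially)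
  define w where "w = (conv v ^^ n) (delta 0)"
  define s where "s = (\<lambda>m. \<Sum>j<n. (conv v ^^ j) (delta 0) m)"
  define b where "b = conv (\<lambda>m. of_real (1 / M) * U' m) s"
  have fin_pow: "finite {m. (conv v ^^ j) (delta 0) m \<noteq> 0}" for j
    by (rule finite_support_iterate[OF fin_v fin_\<delta>])
  have fin_s: "finite {m. s m \<noteq> 0}"
  proof (rule finite_subset)
    show "{m. s m \<noteq> 0} \<subseteq> (\<Union>j<n. {m. (conv v ^^ j) (delta 0) m \<noteq> 0})"
      unfolding s_def by (blast elim: sum.not_neutral_contains_not_neutral)
  qed (use fin_pow in auto)
  have fin_MU': "finite {m. of_real (1 / M) * U' m \<noteq> 0}"
    by (rule finite_subset[OF _ U']) auto
  have fin_b: "finite {m. b m \<noteq> 0}" unfolding b_def by (rule finite_support_conv[OF fin_MU' fin_s])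
  have MU': "conv (\<lambda>m. of_real (1 / M) * U' m) f = (\<lambda>k. of_real (1 / M) * conv U' f k)" for f
    by (rule ext, subst conv_eq_sum[OF U']) (auto simp: conv_def sum_distrib_left mult.assoc)
  have s: "conv s f k = (\<Sum>j<n. (conv v ^^ j) f k)" for f k
  proof -
    let ?S = "\<Union>j<n. {m. (conv v ^^ j) (delta 0) m \<noteq> 0}"
    have S: "finite ?S" using fin_pow by auto
    have "conv s f k = (\<Sum>m\<in>?S. \<Sum>j<n. (conv v ^^ j) (delta 0) m * f (k - m))"
      by (subst conv_eq_sum[OF S])
        (simp_all add: s_def sum_distrib_right, blast elim: sum.not_neutral_contains_not_neutral)
    also have "\<dots> = (\<Sum>j<n. \<Sum>m\<in>?S. (conv v ^^ j) (delta 0) m * f (k - m))" by (rule sum.swap)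
    also have "\<dots> = (\<Sum>j<n. conv ((conv v ^^ j) (delta 0)) f k)"
      by (rule sum.cong[OF refl], subst conv_eq_sum[OF S]) auto
    finally show ?thesis by (simp add: iterate_conv[OF fin_v, symmetric])
  qed
  \<comment> \<open>Thus \<open>u * b = (\<delta> - v) * s\<close>, which telescopes to \<open>\<delta> - v\<^sup>n\<close>.\<close>
  have step: "of_real (1 / M) * conv U (conv U' f) k = f k - conv v f k" for f k
    by (simp add: v conv_commute[of U U'])
  have "conv U (conv b f) = (\<lambda>k. f k - conv w f k)" for f
  proof
    fix k
    have "conv U (conv b f) k = of_real (1 / M) * conv U (conv U' (conv s f)) k"
      by (simp only: b_def conv_assoc[OF fin_MU' fin_s, symmetric]) (simp only: MU' conv_cmult)
    also have "\<dots> = conv s f k - conv v (conv s f) k" by (rule step)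
    also have "\<dots> = (\<Sum>j<n. (conv v ^^ j) f k - (conv v ^^ Suc j) f k)"
    proof -
      have "conv s f = (\<lambda>k. \<Sum>j<n. (conv v ^^ j) f k)" using s by auto
      then show ?thesis by (simp add: conv_sum sum_subtractf)
    qed
    also have "\<dots> = f k - (conv v ^^ n) f k"      using sum_lessThan_telescope'[of "\<lambda>j. (conv v ^^ j) f k" n] by simp
    finally show "conv U (conv b f) k = f k - conv w f k"
      unfolding w_def using iterate_conv[OF fin_v, of n f] by simp
  qed
  then show ?thesis
    using fin_b fin_pow[of n] n by (intro exI[of _ b] exI[of _ w]) (auto simp: w_def U_def)
qed

text \<open>Wiener's theorem for finitely supported \<open>u\<close>: the approximate inverse gives the a priori bound
  \<open>\<parallel>f\<parallel>\<^sub>1 \<le> 2 \<parallel>b\<parallel>\<^sub>1 \<parallel>u * f\<parallel>\<^sub>1\<close>, and a Neumann series in \<open>w\<close> gives surjectivity.\<close>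

lemma convolution_bijective_ell1:
  fixes u :: "int ^ 'd::finite \<Rightarrow> real"
  assumes fin: "finite {k. u k \<noteq> 0}"
    and nz: "\<And>\<theta>. (\<forall>i. 0 \<le> \<theta> $ i \<and> \<theta> $ i < 2 * pi) \<Longrightarrow> symbol u \<theta> \<noteq> 0"
  shows "\<exists>C. \<forall>f\<in>ell1. ell1_norm f \<le> C * ell1_norm (conv (\<lambda>m. of_real (u m)) f)"
    and "\<forall>g\<in>ell1. \<exists>f\<in>ell1. conv (\<lambda>m. of_real (u m)) f = g"
proof -
  let ?U = "\<lambda>m. of_real (u m) :: complex"
  have U: "finite {m. ?U m \<noteq> 0}" using fin by simp
  obtain b w where b: "finite {m. b m \<noteq> 0}" and w: "finite {m. w m \<noteq> 0}" "ell1_norm w \<le> 1 / 2"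
    and inv: "\<And>f. conv ?U (conv b f) = (\<lambda>k. f k - conv w f k)"
    using approximate_convolution_inverse[OF fin nz] by blast
  have 1: "ell1_norm f \<le> (2 * ell1_norm b) * ell1_norm (conv ?U f)" if f: "f \<in> ell1" for f
  proof -
    have Uf: "conv ?U f \<in> ell1" by (rule ell1_conv[OF U f])
    have "f = (\<lambda>k. conv b (conv ?U f) k + conv w f k)"
      unfolding conv_commute[of b ?U f] inv by simp
    then have "ell1_norm f \<le> ell1_norm (conv b (conv ?U f)) + ell1_norm (conv w f)"
      using ell1_norm_add_le(2)[OF ell1_conv(1)[OF b Uf] ell1_conv(1)[OF w(1) f]] by simp
    also have "\<dots> \<le> ell1_norm b * ell1_norm (conv ?U f) + 1 / 2 * ell1_norm f"
      using ell1_conv(2)[OF b Uf] ell1_conv(2)[OF w(1) f] mult_right_mono[OF w(2) ell1_norm_nonneg[of f]]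
      by linarith
    finally show ?thesis by simp
  qed
  have 2: "\<exists>f\<in>ell1. conv ?U f = g" if g: "g \<in> ell1" for g
  proof -
    define W where "W n = (conv w ^^ n) g" for n
    have W: "W n \<in> ell1" "ell1_norm (W n) \<le> (1 / 2) ^ n * ell1_norm g" for n
    proof (induction n)
      case (Suc n)
      have "ell1_norm (W (Suc n)) \<le> 1 / 2 * ((1 / 2) ^ n * ell1_norm g)"
        using ell1_conv(2)[OF w(1) Suc.IH(1)] mult_mono[OF w(2) Suc.IH(2)]
        by (simp add: W_def ell1_norm_nonneg)
      then show "ell1_norm (W (Suc n)) \<le> (1 / 2) ^ Suc n * ell1_norm g" by simp
      show "W (Suc n) \<in> ell1" using ell1_conv(1)[OF w(1) Suc.IH(1)] by (simp add: W_def)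
    qed (use g in \<open>auto simp: W_def\<close>)
    have geo: "summable (\<lambda>n. (1 / 2 :: real) ^ n * ell1_norm g)"
      by (intro summable_mult2 summable_geometric) simp
    have pt: "norm (W n k) \<le> (1 / 2) ^ n * ell1_norm g" for n k
      using sum_le_ell1_norm[OF W(1), of "{k}" n] W(2)[of n] by simp
    have sum_n: "summable (\<lambda>n. norm (W n k))" for k
      by (rule summable_comparison_test[OF _ geo]) (use pt in auto)
    define s where "s k = (\<Sum>n. W n k)" for k
    have s: "s \<in> ell1"
    proof (rule ell1I)
      fix F :: "(int ^ 'd) set" assume F: "finite F"
      have "(\<Sum>k\<in>F. norm (s k)) \<le> (\<Sum>k\<in>F. \<Sum>n. norm (W n k))"
        unfolding s_def by (intro sum_mono summable_norm sum_n)
      also have "\<dots> = (\<Sum>n. \<Sum>k\<in>F. norm (W n k))"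
        by (rule suminf_sum[symmetric]) (rule sum_n)
      also have "\<dots> \<le> (\<Sum>n. (1 / 2) ^ n * ell1_norm g)"
        by (intro suminf_le summable_sum geo sum_n order.trans[OF sum_le_ell1_norm[OF W(1) F] W(2)])
      finally show "(\<Sum>k\<in>F. norm (s k)) \<le> (\<Sum>n. (1 / 2) ^ n * ell1_norm g)" .
    qed
    have "(\<lambda>N. \<Sum>n<N. W n k) \<longlonglongrightarrow> s k" for k
      unfolding s_def using summable_norm_cancel[OF sum_n[of k]] by (rule summable_LIMSEQ)
    then have "(\<lambda>N. conv w (\<lambda>k. \<Sum>n<N. W n k) k) \<longlonglongrightarrow> conv w s k" for k by (rule tendsto_conv)
    then have "(\<lambda>N. (\<Sum>n<N. W (Suc n) k)) \<longlonglongrightarrow> conv w s k" for k by (simp add: conv_sum W_def)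
    moreover have "(\<lambda>N. (\<Sum>n<N. W (Suc n) k)) \<longlonglongrightarrow> s k - g k" for k
    proof -
      have "(\<lambda>n. W (Suc n) k) sums (s k - W 0 k)"
        unfolding s_def sums_Suc_iff[of "\<lambda>n. W n k"]
        using summable_sums[OF summable_norm_cancel[OF sum_n[of k]]] by simp
      then show ?thesis by (simp add: sums_def W_def)
    qed
    ultimately have "conv w s k = s k - g k" for k by (rule LIMSEQ_unique)
    then have "conv ?U (conv b s) = g" unfolding inv by simp
    then show ?thesis using ell1_conv(1)[OF b s] by blast
  qed
  show "\<exists>C. \<forall>f\<in>ell1. ell1_norm f \<le> C * ell1_norm (conv ?U f)" using 1 by blast
  show "\<forall>g\<in>ell1. \<exists>f\<in>ell1. conv ?U f = g" using 2 by blast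
qed

lemma alloy_operator_eq_conv:
  assumes fin: "finite {k. u k \<noteq> 0}"
  shows "alloy_operator u = conv (\<lambda>m. of_real (u m))"
proof (intro ext)
  fix f j
  have *: "{k. u (j - k) \<noteq> 0} = (\<lambda>m. j - m) ` {m. u m \<noteq> 0}"
    by (auto intro!: image_eqI[of _ _ "j - _"])
  have "alloy_operator u f j = (\<Sum>\<^sub>\<infinity>k\<in>{k. u (j - k) \<noteq> 0}. of_real (u (j - k)) * f k)"
    unfolding alloy_operator_def by (intro infsum_cong_neutral) auto
  also have "\<dots> = (\<Sum>k\<in>(\<lambda>m. j - m) ` {m. u m \<noteq> 0}. of_real (u (j - k)) * f k)"
    unfolding * using fin by simp
  also have "\<dots> = conv (\<lambda>m. of_real (u m)) f j"
    by (subst sum.reindex) (auto simp: inj_on_def conv_def)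
  finally show "alloy_operator u f j = conv (\<lambda>m. of_real (u m)) f j" .
qed

text \<open>The column of \<open>A\<^sup>-\<^sup>1\<close> at \<open>x\<close>.  It is real because \<open>u\<close> is, so taking real parts loses nothing.\<close>

lemma real_inverse_column:
  fixes u :: "int ^ 'd::finite \<Rightarrow> real"
  assumes fin: "finite {k. u k \<noteq> 0}"
    and nz: "\<And>\<theta>. (\<forall>i. 0 \<le> \<theta> $ i \<and> \<theta> $ i < 2 * pi) \<Longrightarrow> symbol u \<theta> \<noteq> 0"
  shows "\<exists>c :: int ^ 'd \<Rightarrow> real. (\<forall>j. (\<Sum>m | u m \<noteq> 0. u m * c (j - m)) = (if j = x then 1 else 0))
    \<and> (\<forall>I. finite I \<longrightarrow> (\<Sum>i\<in>I. \<bar>c i\<bar>) \<le> C_u u)"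
proof -
  let ?A = "conv (\<lambda>m. of_real (u m) :: complex)"
  let ?B = "inv_into ell1 ?A"
  obtain C where le: "\<And>f. f \<in> ell1 \<Longrightarrow> ell1_norm f \<le> C * ell1_norm (?A f)"
    using convolution_bijective_ell1(1)[OF fin nz] by blast
  have surj: "\<And>g. g \<in> ell1 \<Longrightarrow> \<exists>f\<in>ell1. ?A f = g"
    using convolution_bijective_ell1(2)[OF fin nz] by blast
  have B: "?B g \<in> ell1" "?A (?B g) = g" if "g \<in> ell1" for g
  proof -
    have "g \<in> ?A ` ell1" using surj[OF that] by blast
    then show "?B g \<in> ell1" "?A (?B g) = g" by (rule inv_into_into, rule f_inv_into_f)
  qed
  have Cu: "C_u u = (SUP g\<in>{g\<in>ell1. ell1_norm g \<le> 1}. ell1_norm (?B g))"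
    unfolding C_u_def ell1_onorm_def alloy_operator_eq_conv[OF fin] ..
  have bdd: "bdd_above ((\<lambda>g. ell1_norm (?B g)) ` {g\<in>ell1. ell1_norm g \<le> 1})"
  proof (rule bdd_aboveI2)
    fix g :: "int ^ 'd \<Rightarrow> complex" assume g: "g \<in> {g\<in>ell1. ell1_norm g \<le> 1}"
    have "ell1_norm (?B g) \<le> C * ell1_norm g" using le[OF B(1)[of g]] g by (simp add: B(2))
    also have "\<dots> \<le> \<bar>C\<bar> * 1" using g by (intro mult_mono) (auto simp: ell1_norm_nonneg)
    finally show "ell1_norm (?B g) \<le> \<bar>C\<bar>" by simp
  qed
  have fin_\<delta>: "finite {m. delta x m \<noteq> 0}" by (simp add: delta_def)
  have \<delta>: "delta x \<in> ell1" by (rule finite_support_ell1[OF fin_\<delta>])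
  have "ell1_norm (delta x) = 1"
    by (subst ell1_norm_eq_sum[of "{x}"]) (auto simp: delta_def)
  then have norm: "ell1_norm (?B (delta x)) \<le> C_u u"
    unfolding Cu using \<delta> by (intro cSUP_upper bdd) auto
  show ?thesis
  proof (intro exI[of _ "\<lambda>i. Re (?B (delta x) i)"] conjI allI impI)
    fix j
    have "(\<Sum>m | u m \<noteq> 0. u m * Re (?B (delta x) (j - m))) = Re (?A (?B (delta x)) j)"
      by (simp add: conv_def)
    also have "\<dots> = (if j = x then 1 else 0)" by (simp add: B(2)[OF \<delta>] delta_def)
    finally show "(\<Sum>m | u m \<noteq> 0. u m * Re (?B (delta x) (j - m))) = (if j = x then 1 else 0)" .
  next
    fix I :: "(int ^ 'd) set" assume "finite I"
    from sum_le_ell1_norm[OF B(1)[OF \<delta>] this] norm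
    have "(\<Sum>i\<in>I. norm (?B (delta x) i)) \<le> C_u u" by linarith
    moreover have "(\<Sum>i\<in>I. \<bar>Re (?B (delta x) i)\<bar>) \<le> (\<Sum>i\<in>I. norm (?B (delta x) i))"
      by (intro sum_mono abs_Re_le_cmod)
    ultimately show "(\<Sum>i\<in>I. \<bar>Re (?B (delta x) i)\<bar>) \<le> C_u u" by linarith
  qed
qed

section \<open>Green functions of real symmetric matrices\<close>

text \<open>\<open>H - z\<close> on \<open>\<ell>\<^sup>2(\<Lambda>)\<close> for the matrix \<open>h\<close>.  Off \<open>\<Lambda>\<close> the operator acts as \<open>-z\<close>, so functions that vanish there
  are mapped to such functions.\<close>

definition shifted_op :: "('a \<Rightarrow> 'a \<Rightarrow> real) \<Rightarrow> 'a set \<Rightarrow> complex \<Rightarrow> ('a \<Rightarrow> complex) \<Rightarrow> 'a \<Rightarrow> complex" where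
  "shifted_op h \<Lambda> z \<psi> j = (if j \<in> \<Lambda> then (\<Sum>k\<in>\<Lambda>. of_real (h j k) * \<psi> k) else 0) - z * \<psi> j"

definition finite_green :: "('a \<Rightarrow> 'a \<Rightarrow> real) \<Rightarrow> 'a set \<Rightarrow> complex \<Rightarrow> 'a \<Rightarrow> 'a \<Rightarrow> complex" where
  "finite_green h \<Lambda> z x y = inv_into (l2_on \<Lambda>) (shifted_op h \<Lambda> z) (delta y) x"

text \<open>Symmetry with respect to the bilinear pairing, without complex conjugation: it holds for \<open>z\<close> itself, not
  only for real \<open>z\<close>.\<close>

lemma shifted_op_adjoint:
  assumes sym: "\<forall>j k. h j k = h k j" and fin: "finite \<Lambda>"
  shows "(\<Sum>j\<in>\<Lambda>. a j * shifted_op h \<Lambda> z b j) = (\<Sum>j\<in>\<Lambda>. shifted_op h \<Lambda> z a j * b j)"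
proof -
  have "(\<Sum>j\<in>\<Lambda>. a j * (\<Sum>k\<in>\<Lambda>. of_real (h j k) * b k)) = (\<Sum>j\<in>\<Lambda>. \<Sum>k\<in>\<Lambda>. a j * of_real (h j k) * b k)"
    by (simp add: sum_distrib_left mult.assoc)
  also have "\<dots> = (\<Sum>k\<in>\<Lambda>. \<Sum>j\<in>\<Lambda>. a j * of_real (h j k) * b k)" by (rule sum.swap)
  also have "\<dots> = (\<Sum>j\<in>\<Lambda>. (\<Sum>k\<in>\<Lambda>. of_real (h j k) * a k) * b j)"
    unfolding sum_distrib_right by (intro sum.cong refl) (simp add: sym mult_ac)
  finally show ?thesis
    by (simp add: shifted_op_def left_diff_distrib right_diff_distrib sum_subtractf mult_ac)
qed

text \<open>The operator is real symmetric, so the form \<open>\<langle>\<psi>, H\<psi>\<rangle>\<close> is real and only the shift by \<open>z\<close> contributes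
  to the imaginary part of \<open>\<langle>\<psi>, (H - z)\<psi>\<rangle>\<close>.  This single identity gives the injectivity of
  \<open>H - z\<close> and the a priori bound on the resolvent.\<close>

lemma Im_shifted_op_form:
  assumes sym: "\<forall>j k. h j k = h k j" and fin: "finite \<Lambda>"
  shows "Im (\<Sum>j\<in>\<Lambda>. cnj (\<psi> j) * shifted_op h \<Lambda> z \<psi> j) = - Im z * (\<Sum>j\<in>\<Lambda>. (norm (\<psi> j))\<^sup>2)"
proof -
  let ?Q = "\<Sum>j\<in>\<Lambda>. cnj (\<psi> j) * shifted_op h \<Lambda> z \<psi> j"
  have "cnj ?Q = (\<Sum>j\<in>\<Lambda>. \<psi> j * shifted_op h \<Lambda> (cnj z) (\<lambda>k. cnj (\<psi> k)) j)"
    by (simp add: shifted_op_def)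
  also have "\<dots> = (\<Sum>j\<in>\<Lambda>. shifted_op h \<Lambda> (cnj z) \<psi> j * cnj (\<psi> j))"
    by (rule shifted_op_adjoint[OF sym fin])
  also have "\<dots> = (\<Sum>j\<in>\<Lambda>. cnj (\<psi> j) * shifted_op h \<Lambda> z \<psi> j + (z - cnj z) * of_real ((norm (\<psi> j))\<^sup>2))"
    by (intro sum.cong refl) (simp add: shifted_op_def algebra_simps complex_norm_square del: of_real_power)
  also have "\<dots> = ?Q + (z - cnj z) * of_real (\<Sum>j\<in>\<Lambda>. (norm (\<psi> j))\<^sup>2)"
    by (simp add: sum.distrib sum_distrib_left del: of_real_power)
  finally have eq: "cnj ?Q = ?Q + (z - cnj z) * of_real (\<Sum>j\<in>\<Lambda>. (norm (\<psi> j))\<^sup>2)" .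
  have "Im (cnj ?Q) = Im ?Q + 2 * Im z * (\<Sum>j\<in>\<Lambda>. (norm (\<psi> j))\<^sup>2)"
    unfolding eq by simp
  moreover have "Im (cnj ?Q) = - Im ?Q" by (rule cnj.simps(2))
  ultimately show ?thesis by linarith
qed

lemma shifted_op_zero:
  assumes sym: "\<forall>j k. h j k = h k j" and fin: "finite \<Lambda>" and z: "Im z > 0"
    and \<psi>: "\<psi> \<in> l2_on \<Lambda>" and 0: "\<And>j. j \<in> \<Lambda> \<Longrightarrow> shifted_op h \<Lambda> z \<psi> j = 0"
  shows "\<psi> j = 0"
proof -
  have "(\<Sum>j\<in>\<Lambda>. (norm (\<psi> j))\<^sup>2) = 0"
    using Im_shifted_op_form[OF sym fin, of \<psi> z] z 0 by simp
  then show ?thesis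
    using fin \<psi> by (cases "j \<in> \<Lambda>") (auto simp: sum_nonneg_eq_0_iff l2_on_def)
qed

text \<open>Surjectivity by adding one site at a time: a Schur complement reduces the larger system to the
  smaller one, and the scalar that remains is nonzero because it would otherwise produce a vector
  in the kernel.\<close>

lemma shifted_op_surj:
  assumes sym: "\<forall>j k. h j k = h k j" and fin: "finite \<Lambda>" and z: "Im z > 0"
  shows "\<exists>\<psi>\<in>l2_on \<Lambda>. \<forall>j\<in>\<Lambda>. shifted_op h \<Lambda> z \<psi> j = g j"
  using fin
proof (induction \<Lambda> arbitrary: g rule: finite_induct)
  case empty
  have "(\<lambda>_. 0) \<in> l2_on {}" by (simp add: l2_on_def)
  then show ?case by auto
next
  case (insert s \<Lambda>)
  obtain \<psi> where \<psi>: "\<psi> \<in> l2_on \<Lambda>" "\<And>j. j \<in> \<Lambda> \<Longrightarrow> shifted_op h \<Lambda> z \<psi> j = g j"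
    using insert.IH[of g] by blast
  obtain \<phi> where \<phi>: "\<phi> \<in> l2_on \<Lambda>" "\<And>j. j \<in> \<Lambda> \<Longrightarrow> shifted_op h \<Lambda> z \<phi> j = of_real (h j s)"
    using insert.IH[of "\<lambda>j. of_real (h j s)"] by blast
  \<comment> \<open>The trial vector \<open>d \<psi> + c (\<delta>\<^sub>s - \<phi>)\<close> solves the equations on \<open>\<Lambda>\<close> with right-hand side \<open>d g\<close>; \<open>c\<close> is left to
    fit the equation at \<open>s\<close>.\<close>
  define \<chi>' where "\<chi>' c d j = (if j = s then c else d * \<psi> j - c * \<phi> j)" for c d j
  define D where "D = of_real (h s s) - z - (\<Sum>k\<in>\<Lambda>. of_real (h s k) * \<phi> k)"
  have supp: "\<chi>' c d \<in> l2_on (insert s \<Lambda>)" for c d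
    using \<psi>(1) \<phi>(1) by (auto simp: l2_on_def \<chi>'_def)
  have sum_\<Lambda>: "(\<Sum>k\<in>\<Lambda>. of_real (h j k) * \<chi>' c d k)
      = d * (\<Sum>k\<in>\<Lambda>. of_real (h j k) * \<psi> k) - c * (\<Sum>k\<in>\<Lambda>. of_real (h j k) * \<phi> k)" for j c d
    unfolding sum_distrib_left sum_subtractf[symmetric]
    using insert.hyps by (intro sum.cong refl) (auto simp: \<chi>'_def algebra_simps)
  have on_\<Lambda>: "shifted_op h (insert s \<Lambda>) z (\<chi>' c d) j = d * g j" if "j \<in> \<Lambda>" for c d j
  proof -
    have "j \<noteq> s" using that insert.hyps by auto
    then show ?thesis
      using that insert.hyps \<psi>(2)[OF that] \<phi>(2)[OF that]
      by (simp add: shifted_op_def sum_\<Lambda>) (simp add: \<chi>'_def algebra_simps)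
  qed
  have at_s: "shifted_op h (insert s \<Lambda>) z (\<chi>' c d) s = d * (\<Sum>k\<in>\<Lambda>. of_real (h s k) * \<psi> k) + c * D" for c d
    using insert.hyps
    by (simp add: shifted_op_def sum_\<Lambda> D_def) (simp add: \<chi>'_def algebra_simps)
  have "D \<noteq> 0"
  proof
    assume "D = 0"
    then have "\<chi>' 1 0 s = 0"
      using on_\<Lambda>[of _ 1 0] at_s[of 1 0] insert.hyps(1)
      by (intro shifted_op_zero[OF sym _ z supp]) auto
    then show False by (simp add: \<chi>'_def)
  qed
  then have "shifted_op h (insert s \<Lambda>) z (\<chi>' ((g s - (\<Sum>k\<in>\<Lambda>. of_real (h s k) * \<psi> k)) / D) 1) j = g j"
    if "j \<in> insert s \<Lambda>" for j
    using that at_s on_\<Lambda> by auto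
  then show ?case using supp by blast
qed

lemma finite_green_eq:
  assumes sym: "\<forall>j k. h j k = h k j" and fin: "finite \<Lambda>" and z: "Im z > 0" and y: "y \<in> \<Lambda>"
  shows "shifted_op h \<Lambda> z (\<lambda>x. finite_green h \<Lambda> z x y) = delta y"
proof -
  obtain \<psi> where \<psi>: "\<psi> \<in> l2_on \<Lambda>" "\<And>j. j \<in> \<Lambda> \<Longrightarrow> shifted_op h \<Lambda> z \<psi> j = delta y j"
    using shifted_op_surj[OF sym fin z, of "delta y"] by blast
  have "shifted_op h \<Lambda> z \<psi> = delta y"
  proof
    fix j show "shifted_op h \<Lambda> z \<psi> j = delta y j"
      using \<psi> y by (cases "j \<in> \<Lambda>") (auto simp: shifted_op_def l2_on_def delta_def)
  qed
  then have "delta y \<in> shifted_op h \<Lambda> z ` l2_on \<Lambda>" using \<psi>(1) by (auto intro!: image_eqI[of _ _ \<psi>])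
  from f_inv_into_f[OF this] show ?thesis unfolding finite_green_def by (simp add: eta_contract_eq)
qed

lemma finite_green_pairing:
  assumes sym: "\<forall>j k. h j k = h k j" and fin: "finite \<Lambda>" and z: "Im z > 0" and q: "q \<in> \<Lambda>"
  shows "(\<Sum>j\<in>\<Lambda>. a j * shifted_op h \<Lambda> z (\<lambda>x. finite_green h \<Lambda> z x q) j) = a q"
    "(\<Sum>j\<in>\<Lambda>. shifted_op h \<Lambda> z (\<lambda>x. finite_green h \<Lambda> z x q) j * a j) = a q"
  unfolding finite_green_eq[OF sym fin z q]
  using fin q by (simp_all add: delta_def if_distrib[of "\<lambda>t. _ * t"] if_distrib[of "\<lambda>t. t * _"] cong: if_cong)

lemma finite_green_sym:
  assumes sym: "\<forall>j k. h j k = h k j" and fin: "finite \<Lambda>" and z: "Im z > 0" and "x \<in> \<Lambda>" "y \<in> \<Lambda>"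
  shows "finite_green h \<Lambda> z x y = finite_green h \<Lambda> z y x"
  using shifted_op_adjoint[OF sym fin, of "\<lambda>j. finite_green h \<Lambda> z j x" z "\<lambda>j. finite_green h \<Lambda> z j y"]
  unfolding finite_green_pairing[OF sym fin z \<open>x \<in> \<Lambda>\<close>] finite_green_pairing[OF sym fin z \<open>y \<in> \<Lambda>\<close>] by simp

text \<open>The Ward identity \<open>(G - G\<^sup>*) / 2i = Im z G\<^sup>* G\<close>: the imaginary part of the Green function is a Gram
  matrix.\<close>

lemma Im_finite_green:
  assumes sym: "\<forall>j k. h j k = h k j" and fin: "finite \<Lambda>" and z: "Im z > 0" and x: "x \<in> \<Lambda>" and y: "y \<in> \<Lambda>"
  shows "Im (finite_green h \<Lambda> z x y) = Im z * Re (\<Sum>k\<in>\<Lambda>. cnj (finite_green h \<Lambda> z k x) * finite_green h \<Lambda> z k y)"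
proof -
  let ?a = "\<lambda>k. finite_green h \<Lambda> z k x" and ?b = "\<lambda>k. finite_green h \<Lambda> z k y"
  let ?S = "\<Sum>k\<in>\<Lambda>. cnj (?a k) * ?b k"
  have "cnj (?a y) = (\<Sum>j\<in>\<Lambda>. cnj (?a j) * shifted_op h \<Lambda> z ?b j)"
    by (rule finite_green_pairing(1)[OF sym fin z y, symmetric])
  also have "\<dots> = (\<Sum>j\<in>\<Lambda>. shifted_op h \<Lambda> z (\<lambda>k. cnj (?a k)) j * ?b j)"
    by (rule shifted_op_adjoint[OF sym fin])
  also have "\<dots> = (\<Sum>j\<in>\<Lambda>. cnj (shifted_op h \<Lambda> z ?a j) * ?b j + (cnj z - z) * (cnj (?a j) * ?b j))"
    by (intro sum.cong refl) (simp add: shifted_op_def algebra_simps)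
  also have "\<dots> = cnj (\<Sum>j\<in>\<Lambda>. shifted_op h \<Lambda> z ?a j * cnj (?b j)) + (cnj z - z) * ?S"
    by (simp add: sum.distrib sum_distrib_left)
  also have "\<dots> = ?b x + (cnj z - z) * ?S"
    unfolding finite_green_pairing(2)[OF sym fin z x] by simp
  finally have "Im (cnj (?a y)) = Im (?b x + (cnj z - z) * ?S)" by simp
  then show ?thesis
    using finite_green_sym[OF sym fin z x y] by simp
qed

text \<open>The diagonal Ward identity bounds \<open>Im z \<Sum>\<^sub>k \<bar>G(k, y)\<bar>\<^sup>2\<close> by \<open>\<bar>G(y, y)\<bar>\<close>, and the term \<open>k = y\<close> in turn bounds
  \<open>G(y, y)\<close>.\<close>

lemma norm_finite_green_le:
  assumes sym: "\<forall>j k. h j k = h k j" and fin: "finite \<Lambda>" and z: "Im z > 0" and x: "x \<in> \<Lambda>" and y: "y \<in> \<Lambda>"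
  shows "norm (finite_green h \<Lambda> z x y) \<le> 1 / Im z"
proof -
  let ?b = "\<lambda>k. finite_green h \<Lambda> z k y"
  have "(\<Sum>k\<in>\<Lambda>. (norm (?b k))\<^sup>2) = Re (\<Sum>k\<in>\<Lambda>. cnj (?b k) * ?b k)"
    by (simp add: cmod_power2 flip: power2_eq_square)
  then have eq: "Im z * (\<Sum>k\<in>\<Lambda>. (norm (?b k))\<^sup>2) = Im (?b y)"
    using Im_finite_green[OF sym fin z y y] by simp
  have le: "Im z * (norm (?b k))\<^sup>2 \<le> norm (?b y)" if "k \<in> \<Lambda>" for k
  proof -
    have "Im z * (norm (?b k))\<^sup>2 \<le> Im z * (\<Sum>k\<in>\<Lambda>. (norm (?b k))\<^sup>2)"
      using fin that z by (intro mult_left_mono member_le_sum) auto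
    also have "\<dots> \<le> norm (?b y)" unfolding eq using abs_Im_le_cmod[of "?b y"] by linarith
    finally show ?thesis .
  qed
  have yy: "norm (?b y) \<le> 1 / Im z"
  proof (cases "?b y = 0")
    case False
    then show ?thesis using le[OF y] z by (simp add: power2_eq_square field_simps)
  qed (use z in simp)
  have "Im z * (norm (?b x))\<^sup>2 \<le> 1 / Im z" using le[OF x] yy by linarith
  then have "(norm (?b x))\<^sup>2 \<le> (1 / Im z)\<^sup>2" using z by (simp add: power2_eq_square field_simps)
  then show ?thesis using z by (simp add: power2_le_iff_abs_le)
qed

text \<open>The second resolvent identity: pair the column of \<open>(H - z)\<^sup>-\<^sup>1\<close> at \<open>p\<close> with \<open>H + w - z\<close> applied to the column of
  its inverse at \<open>q\<close>, and move \<open>H - z\<close> to the other side.\<close>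

lemma finite_green_diagonal_perturbation:
  assumes sym: "\<forall>j k. h j k = h k j" and fin: "finite \<Lambda>" and z: "Im z > 0" and p: "p \<in> \<Lambda>" and q: "q \<in> \<Lambda>"
    and h': "\<And>j k. h' j k = h j k + (if j = k then w j else 0)"
  shows "finite_green h' \<Lambda> z p q = finite_green h \<Lambda> z p q - (\<Sum>k\<in>\<Lambda>. of_real (w k) * finite_green h \<Lambda> z p k * finite_green h' \<Lambda> z k q)"
proof -
  have sym': "\<forall>j k. h' j k = h' k j" by (auto simp: h' sym)
  let ?a = "\<lambda>k. finite_green h \<Lambda> z k p" and ?b = "\<lambda>k. finite_green h' \<Lambda> z k q"
  have op: "shifted_op h' \<Lambda> z \<psi> j = shifted_op h \<Lambda> z \<psi> j + of_real (w j) * \<psi> j" if "j \<in> \<Lambda>" for \<psi> j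
  proof -
    have "(\<Sum>k\<in>\<Lambda>. of_real (if j = k then w j else 0) * \<psi> k) = of_real (w j) * \<psi> j"
      using fin that by (simp add: if_distrib[of of_real] if_distrib[of "\<lambda>t. t * _"] cong: if_cong)
    then show ?thesis using that by (simp add: shifted_op_def h' distrib_right sum.distrib)
  qed
  have "?a q = (\<Sum>j\<in>\<Lambda>. ?a j * shifted_op h' \<Lambda> z ?b j)"
    by (rule finite_green_pairing(1)[OF sym' fin z q, symmetric])
  also have "\<dots> = (\<Sum>j\<in>\<Lambda>. ?a j * shifted_op h \<Lambda> z ?b j) + (\<Sum>j\<in>\<Lambda>. of_real (w j) * ?a j * ?b j)"
    unfolding sum.distrib[symmetric] by (intro sum.cong refl) (simp add: op algebra_simps)
  also have "(\<Sum>j\<in>\<Lambda>. ?a j * shifted_op h \<Lambda> z ?b j) = (\<Sum>j\<in>\<Lambda>. shifted_op h \<Lambda> z ?a j * ?b j)"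
    by (rule shifted_op_adjoint[OF sym fin])
  also have "\<dots> = ?b p" by (rule finite_green_pairing(2)[OF sym fin z p])
  finally show ?thesis
    using finite_green_sym[OF sym fin z q p] finite_green_sym[OF sym fin z _ p] by (simp add: algebra_simps)
qed

section \<open>Averaging over the potential at two sites\<close>

definition potential_green ::
    "('a \<Rightarrow> 'a \<Rightarrow> real) \<Rightarrow> 'a set \<Rightarrow> complex \<Rightarrow> ('a \<Rightarrow> real) \<Rightarrow> 'a \<Rightarrow> 'a \<Rightarrow> complex" where
  "potential_green h \<Lambda> z v = finite_green (\<lambda>j k. h j k + (if j = k then v j else 0)) \<Lambda> z"

text \<open>The determinant of the imaginary part of the \<open>2 \<times> 2\<close> Green matrix of \<open>h + v\<close> at the sites \<open>x\<close> and \<open>y\<close>,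
  written with the symmetry of the Green function built in.\<close>

definition im_det :: "('a \<Rightarrow> 'a \<Rightarrow> real) \<Rightarrow> 'a set \<Rightarrow> complex \<Rightarrow> 'a \<Rightarrow> 'a \<Rightarrow> ('a \<Rightarrow> real) \<Rightarrow> real" where
  "im_det h \<Lambda> z x y v =
     Im (potential_green h \<Lambda> z v x x) * Im (potential_green h \<Lambda> z v y y)
     - (Im (potential_green h \<Lambda> z v x y))\<^sup>2"

text \<open>Here \<open>a, b, c\<close> are the entries of a symmetric \<open>2 \<times> 2\<close> Green matrix \<open>g\<close> and \<open>A, B, C\<close> those of the matrix \<open>g'\<close> after adding
  \<open>s\<close> to the first diagonal entry of the operator.  With \<open>N = 1 + g diag(s, 0)\<close> one has \<open>N g' = g\<close> and
  \<open>N (Im g') N\<^sup>* = Im g\<close>, so the determinants of the imaginary parts differ by the factor \<open>\<bar>det N\<bar>\<^sup>2\<close>.\<close>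

lemma rank_one_im_det:
  fixes a b c A B C :: complex and s :: real
  assumes A: "A = a - s * a * A" and B: "B = b - s * a * B" and C: "C = c - s * b * B"
  shows "1 + s * a \<noteq> 0"
    and "(Im A * Im C - (Im B)\<^sup>2) * (norm (1 + s * a))\<^sup>2 = Im a * Im c - (Im b)\<^sup>2"
proof -
  define d where "d = 1 + s * a"
  have Ad: "A * d = a" and Bd: "B * d = b" using A B by (simp_all add: d_def algebra_simps)
  show d: "1 + s * a \<noteq> 0"
  proof
    assume "1 + s * a = 0"
    moreover then have "a = 0" using Ad by (simp add: d_def)
    ultimately show False by simp
  qed
  define n where "n = (Re d)\<^sup>2 + (Im d)\<^sup>2"
  have n: "n > 0" "(norm d)\<^sup>2 = n"
    using d by (auto simp: n_def cmod_power2 complex_eq_iff d_def[symmetric] sum_power2_gt_zero_iff)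
  have d12: "Re d = 1 + s * Re a" "Im d = s * Im a" by (simp_all add: d_def)
  have "A = a / d" "B = b / d" using Ad Bd n by (auto simp: field_simps)
  then have "Im A = (Im a * Re d - Re a * Im d) / n" and Bn: "Im B * n = Im b * Re d - Re b * Im d"
      "Re B * n = Re b * Re d + Im b * Im d"
    using n(1) by (auto simp: Im_divide Re_divide n_def[symmetric])
  then have An: "Im A * n = Im a" using n(1) by (simp add: d12 algebra_simps)
  have CI: "Im C = Im c - s * (Re b * Im B + Im b * Re B)" using arg_cong[OF C, of Im] by (simp add: algebra_simps)
  have Cn: "Im C * n = Im c * n - s * (Re b * (Im B * n) + Im b * (Re B * n))"
    unfolding CI by (simp add: algebra_simps)
  have "((Im A * Im C - (Im B)\<^sup>2) * n) * n = (Im A * n) * (Im C * n) - (Im B * n)\<^sup>2"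
    by (simp add: power2_eq_square algebra_simps)
  also have "\<dots> = (Im a * Im c - (Im b)\<^sup>2) * n"
    unfolding An Cn Bn by (simp add: n_def d12 power2_eq_square algebra_simps)
  finally show "(Im A * Im C - (Im B)\<^sup>2) * (norm (1 + s * a))\<^sup>2 = Im a * Im c - (Im b)\<^sup>2"
    using n d_def by simp
qed

lemma nn_integral_inverse_1_plus_square: "(\<integral>\<^sup>+t. ennreal (inverse (1 + t\<^sup>2)) \<partial>lborel) = ennreal pi"
proof -
  have "integrable lborel (\<lambda>t. inverse (1 + t\<^sup>2) :: real)"
    using integrable_inverse_1_plus_square by (simp add: set_integrable_def einterval_def)
  then have "(\<integral>\<^sup>+t. ennreal (inverse (1 + t\<^sup>2)) \<partial>lborel) = ennreal (\<integral>t. inverse (1 + t\<^sup>2) \<partial>lborel)"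
    by (rule nn_integral_eq_integral) simp
  also have "(\<integral>t. inverse (1 + t\<^sup>2) \<partial>lborel) = pi"
    using LBINT_inverse_1_plus_square
    by (simp add: interval_lebesgue_integral_def set_lebesgue_integral_def einterval_def)
  finally show ?thesis .
qed

lemma nn_integral_inverse_quadratic:
  fixes a0 a1 a2 :: real
  assumes disc: "4 * a0 * a2 - a1\<^sup>2 > 0" and a2: "a2 > 0"
  shows "(\<integral>\<^sup>+t. ennreal (1 / (a2 * t\<^sup>2 + a1 * t + a0)) \<partial>lborel) = ennreal (2 * pi / sqrt (4 * a0 * a2 - a1\<^sup>2))"
proof -
  define r where "r = sqrt (4 * a0 * a2 - a1\<^sup>2)"
  have r: "r > 0" "r\<^sup>2 = 4 * a0 * a2 - a1\<^sup>2" using disc by (auto simp: r_def)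
  \<comment> \<open>Completing the square.\<close>
  let ?t = "\<lambda>x. - a1 / (2 * a2) + r / (2 * a2) * x"
  have sq: "1 / (a2 * (?t x)\<^sup>2 + a1 * ?t x + a0) = 4 * a2 / r\<^sup>2 * inverse (1 + x\<^sup>2)" for x
  proof -
    have "4 * a2 * (a2 * T\<^sup>2 + a1 * T + a0) = (2 * a2 * T + a1)\<^sup>2 + r\<^sup>2" for T
      unfolding r(2) by (simp add: power2_eq_square algebra_simps)
    moreover have "2 * a2 * ?t x + a1 = r * x" using a2 by (simp add: field_simps)
    ultimately have "4 * a2 * (a2 * (?t x)\<^sup>2 + a1 * ?t x + a0) = r\<^sup>2 * (1 + x\<^sup>2)"
      by (simp only:) (simp add: power_mult_distrib distrib_left)
    then have "1 / (a2 * (?t x)\<^sup>2 + a1 * ?t x + a0) = 4 * a2 / (r\<^sup>2 * (1 + x\<^sup>2))"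
      using a2 by (metis mult_divide_mult_cancel_left_if mult.right_neutral order_less_irrefl
          zero_less_mult_iff zero_less_numeral)
    then show ?thesis by (simp only: divide_inverse inverse_mult_distrib mult.assoc)
  qed
  have "(\<integral>\<^sup>+t. ennreal (1 / (a2 * t\<^sup>2 + a1 * t + a0)) \<partial>lborel)
      = \<bar>r / (2 * a2)\<bar> * (\<integral>\<^sup>+x. ennreal (1 / (a2 * (?t x)\<^sup>2 + a1 * ?t x + a0)) \<partial>lborel)"
    using r a2 by (intro nn_integral_real_affine) auto
  also have "\<dots> = ennreal (r / (2 * a2)) * (ennreal (4 * a2 / r\<^sup>2) * ennreal pi)"
    unfolding sq using r(1) a2
    by (subst ennreal_mult') (simp_all add: nn_integral_cmult nn_integral_inverse_1_plus_square)
  also have "\<dots> = ennreal (2 * pi / r)"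
    using r(1) a2 by (simp add: ennreal_mult[symmetric] power2_eq_square field_simps)
  finally show ?thesis by (simp add: r_def)
qed

text \<open>Both integrations are of the reciprocal of a positive quadratic polynomial, so only the negative
  discriminants matter.  For the integration over \<open>s\<close> it is \<open>4 e\<^sup>2\<close>, where \<open>e\<close> is a quadratic polynomial in \<open>t\<close>, and
  that of \<open>e\<close> is \<open>4 \<Delta> (\<Delta> + \<bar>b\<bar>\<^sup>2)\<close>, where \<open>\<Delta>\<close> is the determinant of the imaginary part of the symmetric matrix
  with entries \<open>a, b, c\<close>.\<close>

lemma nn_integral_rank_two_le:
  fixes a b c :: complex and K :: "real \<Rightarrow> real \<Rightarrow> real"
  assumes K: "\<And>s t. K s t * (norm (1 + of_real s * a + of_real t * c + of_real s * of_real t * (a * c - b\<^sup>2)))\<^sup>2 = Im a * Im c - (Im b)\<^sup>2"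
    and nz: "\<And>s t :: real. 1 + of_real s * a + of_real t * c + of_real s * of_real t * (a * c - b\<^sup>2) \<noteq> 0"
    and \<Delta>_nonneg: "0 \<le> Im a * Im c - (Im b)\<^sup>2" and a: "0 \<le> Im a"
  shows "(\<integral>\<^sup>+t. (\<integral>\<^sup>+s. ennreal (K s t) \<partial>lborel) \<partial>lborel) \<le> ennreal (pi\<^sup>2)"
proof -
  define \<Delta> where "\<Delta> = Im a * Im c - (Im b)\<^sup>2"
  define P where "P t = 1 + of_real t * c" for t
  define Q where "Q t = a + of_real t * (a * c - b\<^sup>2)" for t
  have PQ: "1 + of_real s * a + of_real t * c + of_real s * of_real t * (a * c - b\<^sup>2) = P t + of_real s * Q t" for s t
    by (simp add: P_def Q_def algebra_simps)
  have K_eq: "K s t = \<Delta> * (1 / (norm (P t + of_real s * Q t))\<^sup>2)" for s t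
    using K[of s t] nz[of s t] unfolding PQ \<Delta>_def[symmetric]
    by (simp add: eq_divide_eq)
  show ?thesis
  proof (cases "\<Delta> = 0")
    case True
    then show ?thesis by (simp add: K_eq)
  next
    case False
    then have \<Delta>: "\<Delta> > 0" using \<Delta>_nonneg by (simp add: \<Delta>_def)
    define a0 where "a0 = Im a"
    define a1 where "a1 = Im (a * c - b\<^sup>2) + Im (a * cnj c)"
    define a2 where "a2 = Im ((a * c - b\<^sup>2) * cnj c)"
    define e where "e t = a2 * t\<^sup>2 + a1 * t + a0" for t
    have e: "e t = Im (Q t * cnj (P t))" for t
      by (simp add: e_def a0_def a1_def a2_def P_def Q_def power2_eq_square algebra_simps)
    have disc: "4 * a0 * a2 - a1\<^sup>2 = 4 * \<Delta> * (\<Delta> + (norm b)\<^sup>2)"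
      unfolding a0_def a1_def a2_def \<Delta>_def cmod_power2 by (simp add: power2_eq_square algebra_simps)
    \<comment> \<open>Dropping \<open>\<bar>b\<bar>\<^sup>2\<close> from the discriminant turns the exact value of the integral into the bound \<open>\<pi>\<^sup>2\<close>.\<close>
    have disc_ge: "4 * a0 * a2 - a1\<^sup>2 \<ge> (2 * \<Delta>)\<^sup>2"
      unfolding disc using \<Delta> by (simp add: power2_eq_square algebra_simps)
    have "(2 * \<Delta>)\<^sup>2 > 0" using \<Delta> by simp
    then have disc_pos: "4 * a0 * a2 - a1\<^sup>2 > 0" using disc_ge by linarith
    have "a0 \<noteq> 0" using \<Delta> by (auto simp: a0_def \<Delta>_def)
    then have a0: "a0 > 0" using a by (simp add: a0_def)
    have "4 * a0 * a2 > 0" using disc_pos zero_le_power2[of a1] by linarith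
    then have a2: "a2 > 0" using a0 by (simp add: zero_less_mult_iff)
    have e_pos: "e t > 0" for t
    proof -
      have "4 * a2 * e t = (2 * a2 * t + a1)\<^sup>2 + (4 * a0 * a2 - a1\<^sup>2)"
        by (simp add: e_def power2_eq_square algebra_simps)
      then have "4 * a2 * e t > 0" using disc_pos zero_le_power2[of "2 * a2 * t + a1"] by linarith
      then show ?thesis using a2 by (simp add: zero_less_mult_iff)
    qed
    have inner: "(\<integral>\<^sup>+s. ennreal (K s t) \<partial>lborel) = ennreal (\<Delta> * pi) * ennreal (1 / e t)" for t
    proof -
      let ?A0 = "(norm (P t))\<^sup>2" and ?A1 = "2 * Re (Q t * cnj (P t))" and ?A2 = "(norm (Q t))\<^sup>2"
      have quad: "(norm (P t + of_real s * Q t))\<^sup>2 = ?A2 * s\<^sup>2 + ?A1 * s + ?A0" for s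
        unfolding cmod_power2 by (simp add: power2_eq_square algebra_simps)
      have d: "4 * ?A0 * ?A2 - ?A1\<^sup>2 = (2 * e t)\<^sup>2"
        unfolding e cmod_power2 by (simp add: power2_eq_square algebra_simps)
      have "Q t \<noteq> 0" using e_pos[of t] e[of t] by auto
      then have A2: "?A2 > 0" by simp
      have d_pos: "4 * ?A0 * ?A2 - ?A1\<^sup>2 > 0" unfolding d using e_pos[of t] by simp
      have "(\<integral>\<^sup>+s. ennreal (K s t) \<partial>lborel)
          = ennreal \<Delta> * (\<integral>\<^sup>+s. ennreal (1 / (?A2 * s\<^sup>2 + ?A1 * s + ?A0)) \<partial>lborel)"
        unfolding K_eq quad using \<Delta> by (subst ennreal_mult') (auto intro!: nn_integral_cmult)
      also have "\<dots> = ennreal \<Delta> * ennreal (2 * pi / (2 * e t))"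
        unfolding nn_integral_inverse_quadratic[OF d_pos A2] d
        using real_sqrt_unique[of "2 * e t" "(2 * e t)\<^sup>2"] e_pos[of t] by (simp del: power_mult_distrib)
      finally show ?thesis using \<Delta> e_pos[of t] by (simp add: ennreal_mult[symmetric])
    qed
    have "(\<integral>\<^sup>+t. (\<integral>\<^sup>+s. ennreal (K s t) \<partial>lborel) \<partial>lborel)
        = ennreal (\<Delta> * pi) * (\<integral>\<^sup>+t. ennreal (1 / e t) \<partial>lborel)"
      unfolding inner by (rule nn_integral_cmult) (auto simp: e_def)
    also have "\<dots> = ennreal (\<Delta> * pi) * ennreal (2 * pi / sqrt (4 * a0 * a2 - a1\<^sup>2))"
      unfolding e_def nn_integral_inverse_quadratic[OF disc_pos a2] ..
    also have "\<dots> \<le> ennreal (\<Delta> * pi) * ennreal (2 * pi / (2 * \<Delta>))"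
    proof (intro mult_left_mono ennreal_leI divide_left_mono)
      show "2 * \<Delta> \<le> sqrt (4 * a0 * a2 - a1\<^sup>2)" using disc_ge \<Delta> by (intro real_le_rsqrt) simp
      then show "0 < sqrt (4 * a0 * a2 - a1\<^sup>2) * (2 * \<Delta>)" using \<Delta> disc_pos by simp
    qed auto
    also have "\<dots> = ennreal (pi\<^sup>2)"
      using \<Delta> by (simp add: ennreal_mult[symmetric] power2_eq_square)
    finally show ?thesis .
  qed
qed

lemma potential_green_sym:
  assumes "\<forall>j k. h j k = h k j" "finite \<Lambda>" "Im z > 0" "p \<in> \<Lambda>" "q \<in> \<Lambda>"
  shows "potential_green h \<Lambda> z v p q = potential_green h \<Lambda> z v q p"
  unfolding potential_green_def using assms by (intro finite_green_sym) auto

lemma norm_potential_green_le: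
  assumes "\<forall>j k. h j k = h k j" "finite \<Lambda>" "Im z > 0" "p \<in> \<Lambda>" "q \<in> \<Lambda>"
  shows "norm (potential_green h \<Lambda> z v p q) \<le> 1 / Im z"
  unfolding potential_green_def using assms by (intro norm_finite_green_le) auto

lemma potential_green_diff:
  assumes "\<forall>j k. h j k = h k j" "finite \<Lambda>" "Im z > 0" "p \<in> \<Lambda>" "q \<in> \<Lambda>"
  shows "potential_green h \<Lambda> z v' p q = potential_green h \<Lambda> z v p q
    - (\<Sum>k\<in>\<Lambda>. of_real (v' k - v k) * potential_green h \<Lambda> z v p k * potential_green h \<Lambda> z v' k q)"
  unfolding potential_green_def using assms
  by (intro finite_green_diagonal_perturbation) auto

text \<open>For a perturbation at a single site only one term of the resolvent identity survives, so that the entries of the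
  perturbed Green function at two given sites solve a closed linear system.\<close>

lemma potential_green_add_site:
  assumes "\<forall>j k. h j k = h k j" "finite \<Lambda>" "Im z > 0" "p \<in> \<Lambda>" "q \<in> \<Lambda>" "x \<in> \<Lambda>"
  shows "potential_green h \<Lambda> z (\<lambda>k. v k + (if k = x then s else 0)) p q = potential_green h \<Lambda> z v p q
    - s * potential_green h \<Lambda> z v p x * potential_green h \<Lambda> z (\<lambda>k. v k + (if k = x then s else 0)) x q"
proof -
  have "(\<Sum>k\<in>\<Lambda>. of_real (if k = x then s else 0) * a k * b k) = of_real s * a x * b x" for a b :: "'a \<Rightarrow> complex"
    using assms by (simp add: if_distrib[of of_real] if_distrib[of "\<lambda>t. t * _"] cong: if_cong)
  then show ?thesis
    by (subst potential_green_diff[OF assms(1-5), of _ v]) simp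
qed

text \<open>Cauchy-Schwarz for the Gram matrix in the Ward identity.\<close>

lemma im_det_nonneg:
  assumes sym: "\<forall>j k. h j k = h k j" and fin: "finite \<Lambda>" and z: "Im z > 0" and x: "x \<in> \<Lambda>" and y: "y \<in> \<Lambda>"
  shows "0 \<le> im_det h \<Lambda> z x y v" "0 \<le> Im (potential_green h \<Lambda> z v x x)"
proof -
  define f where "f p k = potential_green h \<Lambda> z v k p" for p k
  have Im: "Im (potential_green h \<Lambda> z v p q) = Im z * Re (\<Sum>k\<in>\<Lambda>. cnj (f p k) * f q k)"
    if "p \<in> \<Lambda>" "q \<in> \<Lambda>" for p q
    unfolding potential_green_def f_def using sym fin z that by (intro Im_finite_green) auto
  define N where "N p = (\<Sum>k\<in>\<Lambda>. (norm (f p k))\<^sup>2)" for p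
  have diag: "Im (potential_green h \<Lambda> z v p p) = Im z * N p" if "p \<in> \<Lambda>" for p
    unfolding Im[OF that that] N_def by (simp add: cmod_power2 flip: power2_eq_square)
  show "0 \<le> Im (potential_green h \<Lambda> z v x x)"
    unfolding diag[OF x] N_def using z by (simp add: sum_nonneg)
  have "\<bar>Re (\<Sum>k\<in>\<Lambda>. cnj (f x k) * f y k)\<bar> \<le> (\<Sum>k\<in>\<Lambda>. norm (f x k) * norm (f y k))"
    by (intro order.trans[OF abs_Re_le_cmod] order.trans[OF norm_sum] sum_mono) (simp add: norm_mult)
  then have "(Re (\<Sum>k\<in>\<Lambda>. cnj (f x k) * f y k))\<^sup>2 \<le> (\<Sum>k\<in>\<Lambda>. norm (f x k) * norm (f y k))\<^sup>2"
    by (rule abs_le_square_iff[THEN iffD1, OF order.trans]) simp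
  also have "\<dots> \<le> N x * N y" unfolding N_def by (rule Cauchy_Schwarz_ineq_sum)
  finally have "(Im z)\<^sup>2 * (Re (\<Sum>k\<in>\<Lambda>. cnj (f x k) * f y k))\<^sup>2 \<le> (Im z)\<^sup>2 * (N x * N y)"
    by (rule mult_left_mono) simp
  then show "0 \<le> im_det h \<Lambda> z x y v"
    unfolding im_det_def diag[OF x] diag[OF y] Im[OF x y] by (simp add: power2_eq_square algebra_simps)
qed

lemma im_det_le:
  assumes sym: "\<forall>j k. h j k = h k j" and fin: "finite \<Lambda>" and z: "Im z > 0" and x: "x \<in> \<Lambda>" and y: "y \<in> \<Lambda>"
  shows "im_det h \<Lambda> z x y v \<le> (1 / Im z)\<^sup>2"
proof -
  have le: "\<bar>Im (potential_green h \<Lambda> z v p p)\<bar> \<le> 1 / Im z" if "p \<in> \<Lambda>" for p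
    using norm_potential_green_le[OF sym fin z that that] by (rule order.trans[OF abs_Im_le_cmod])
  have "im_det h \<Lambda> z x y v \<le> \<bar>Im (potential_green h \<Lambda> z v x x)\<bar> * \<bar>Im (potential_green h \<Lambda> z v y y)\<bar>"
    unfolding im_det_def abs_mult[symmetric]
    using abs_ge_self[of "Im (potential_green h \<Lambda> z v x x) * Im (potential_green h \<Lambda> z v y y)"]
      zero_le_power2[of "Im (potential_green h \<Lambda> z v x y)"] by linarith
  also have "\<dots> \<le> (1 / Im z) * (1 / Im z)" using le[OF x] le[OF y] z by (intro mult_mono) auto
  finally show ?thesis by (simp add: power2_eq_square)
qed

text \<open>The resolvent identity bounds the increment of each Green matrix entry by \<open>(Im z)\<^sup>-\<^sup>2\<close> times the \<open>\<ell>\<^sup>1\<close> distance of the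
  potentials; each of the two products in the determinant contributes \<open>2 (Im z)\<^sup>-\<^sup>3\<close>.\<close>

lemma im_det_lipschitz:
  assumes sym: "\<forall>j k. h j k = h k j" and fin: "finite \<Lambda>" and z: "Im z > 0" and x: "x \<in> \<Lambda>" and y: "y \<in> \<Lambda>"
  shows "\<bar>im_det h \<Lambda> z x y v' - im_det h \<Lambda> z x y v\<bar> \<le> 4 / (Im z) ^ 3 * (\<Sum>k\<in>\<Lambda>. \<bar>v' k - v k\<bar>)"
proof -
  define r where "r = 1 / Im z"
  define D where "D = (\<Sum>k\<in>\<Lambda>. \<bar>v' k - v k\<bar>)"
  let ?G = "\<lambda>v p q. Im (potential_green h \<Lambda> z v p q)"
  have r: "r > 0" using z by (simp add: r_def)
  have le: "\<bar>?G v p q\<bar> \<le> r" if "p \<in> \<Lambda>" "q \<in> \<Lambda>" for v p q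
    unfolding r_def using norm_potential_green_le[OF sym fin z that] by (rule order.trans[OF abs_Im_le_cmod])
  have diff: "\<bar>?G v' p q - ?G v p q\<bar> \<le> r\<^sup>2 * D" if "p \<in> \<Lambda>" "q \<in> \<Lambda>" for p q
  proof -
    let ?d = "potential_green h \<Lambda> z v' p q - potential_green h \<Lambda> z v p q"
    have "norm ?d \<le> (\<Sum>k\<in>\<Lambda>. r\<^sup>2 * \<bar>v' k - v k\<bar>)"
    proof -
      have "norm ?d = norm (\<Sum>k\<in>\<Lambda>. of_real (v' k - v k) * potential_green h \<Lambda> z v p k * potential_green h \<Lambda> z v' k q)"
        by (subst potential_green_diff[OF sym fin z that, of v' v]) simp
      also have "\<dots> \<le> (\<Sum>k\<in>\<Lambda>. \<bar>v' k - v k\<bar> * (r * r))"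
      proof (intro order.trans[OF norm_sum] sum_mono)
        fix k assume k: "k \<in> \<Lambda>"
        have "norm (potential_green h \<Lambda> z v p k) * norm (potential_green h \<Lambda> z v' k q) \<le> r * r"
          unfolding r_def using norm_potential_green_le[OF sym fin z] that k z by (intro mult_mono) auto
        then show "norm (of_real (v' k - v k) * potential_green h \<Lambda> z v p k * potential_green h \<Lambda> z v' k q) \<le> \<bar>v' k - v k\<bar> * (r * r)"
          unfolding norm_mult norm_of_real mult.assoc by (rule mult_left_mono) simp
      qed
      finally show ?thesis by (simp add: power2_eq_square mult.commute)
    qed
    also have "\<dots> = r\<^sup>2 * D" by (simp add: D_def sum_distrib_left)
    finally show ?thesis using abs_Im_le_cmod[of ?d] by simp
  qed
  have prod: "\<bar>?G v' p q * ?G v' p' q' - ?G v p q * ?G v p' q'\<bar> \<le> 2 * r ^ 3 * D"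
    if "p \<in> \<Lambda>" "q \<in> \<Lambda>" "p' \<in> \<Lambda>" "q' \<in> \<Lambda>" for p q p' q'
  proof -
    have "?G v' p q * ?G v' p' q' - ?G v p q * ?G v p' q'
        = ?G v' p q * (?G v' p' q' - ?G v p' q') + (?G v' p q - ?G v p q) * ?G v p' q'"
      by (simp add: algebra_simps)
    then have "\<bar>?G v' p q * ?G v' p' q' - ?G v p q * ?G v p' q'\<bar>
        \<le> \<bar>?G v' p q\<bar> * \<bar>?G v' p' q' - ?G v p' q'\<bar> + \<bar>?G v' p q - ?G v p q\<bar> * \<bar>?G v p' q'\<bar>"
      by (simp only: abs_mult[symmetric] abs_triangle_ineq)
    also have "\<dots> \<le> r * (r\<^sup>2 * D) + (r\<^sup>2 * D) * r"
      using le diff that r by (intro add_mono mult_mono) (auto simp: D_def sum_nonneg)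
    finally show ?thesis by (simp add: power2_eq_square power3_eq_cube mult_ac)
  qed
  have "\<bar>im_det h \<Lambda> z x y v' - im_det h \<Lambda> z x y v\<bar> \<le> 2 * r ^ 3 * D + 2 * r ^ 3 * D"
    unfolding im_det_def power2_eq_square
    using prod[OF x x y y] prod[OF x y x y] by linarith
  then show ?thesis by (simp add: r_def D_def power_divide)
qed

text \<open>The two sites are perturbed one after the other; \<open>(1 + s a) (1 + t C)\<close> is the determinant of
  \<open>1 + g diag(s, t)\<close>.\<close>

lemma im_det_two_sites:
  fixes v :: "'a \<Rightarrow> real" and s t :: real and a b c :: complex
  assumes sym: "\<forall>j k. h j k = h k j" and fin: "finite \<Lambda>" and z: "Im z > 0" and x: "x \<in> \<Lambda>" and y: "y \<in> \<Lambda>"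
    and "x \<noteq> y"
  defines "a \<equiv> potential_green h \<Lambda> z v x x" and "b \<equiv> potential_green h \<Lambda> z v x y"
    and "c \<equiv> potential_green h \<Lambda> z v y y"
    and "v' \<equiv> \<lambda>k. v k + (if k = x then s else 0) + (if k = y then t else 0)"
  shows "1 + of_real s * a + of_real t * c + of_real s * of_real t * (a * c - b\<^sup>2) \<noteq> 0"
    and "im_det h \<Lambda> z x y v' * (norm (1 + of_real s * a + of_real t * c + of_real s * of_real t * (a * c - b\<^sup>2)))\<^sup>2 = im_det h \<Lambda> z x y v"
proof -
  define w where "w = (\<lambda>k. v k + (if k = x then s else 0))"
  define A where "A = potential_green h \<Lambda> z w x x"
  define B where "B = potential_green h \<Lambda> z w x y"
  define C where "C = potential_green h \<Lambda> z w y y"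
  have v': "v' = (\<lambda>k. w k + (if k = y then t else 0))" by (simp add: v'_def w_def)
  note site = potential_green_add_site[OF sym fin z]
  note comm = potential_green_sym[OF sym fin z]
  have 1: "A = a - s * a * A" "B = b - s * a * B" "C = c - s * b * B"
    using site[OF x x x, of v s] site[OF x y x, of v s] site[OF y y x, of v s] comm[OF y x, of v]
    by (simp_all add: A_def B_def C_def a_def b_def c_def w_def)
  have 2: "potential_green h \<Lambda> z v' y y = C - t * C * potential_green h \<Lambda> z v' y y"
    "potential_green h \<Lambda> z v' x y = B - t * C * potential_green h \<Lambda> z v' x y"
    "potential_green h \<Lambda> z v' x x = A - t * B * potential_green h \<Lambda> z v' x y"
    using site[OF y y y, of w t] site[OF y x y, of w t] site[OF x x y, of w t]
      comm[OF y x, of w] comm[OF y x, of v']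
    by (simp_all add: A_def B_def C_def v')
  have d1: "1 + s * a \<noteq> 0" and
    e1: "(Im A * Im C - (Im B)\<^sup>2) * (norm (1 + s * a))\<^sup>2 = Im a * Im c - (Im b)\<^sup>2"
    by (rule rank_one_im_det[OF 1])+
  have d2: "1 + t * C \<noteq> 0" and
    e2: "im_det h \<Lambda> z x y v' * (norm (1 + t * C))\<^sup>2 = Im C * Im A - (Im B)\<^sup>2"
    using rank_one_im_det[OF 2] unfolding im_det_def by (simp_all add: mult.commute)
  have B: "B * (1 + s * a) = b" using 1(2) by (simp add: algebra_simps)
  have "(1 + s * a) * (1 + t * C) = (1 + s * a) * (1 + t * c) - t * s * b * (B * (1 + s * a))"
    by (subst 1(3)) (simp add: algebra_simps)
  then have fac: "1 + of_real s * a + of_real t * c + of_real s * of_real t * (a * c - b\<^sup>2) = (1 + s * a) * (1 + t * C)"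
    unfolding B by (simp add: power2_eq_square algebra_simps)
  show "1 + of_real s * a + of_real t * c + of_real s * of_real t * (a * c - b\<^sup>2) \<noteq> 0"
    unfolding fac using d1 d2 by simp
  have "im_det h \<Lambda> z x y v' * (norm (1 + of_real s * a + of_real t * c + of_real s * of_real t * (a * c - b\<^sup>2)))\<^sup>2
      = (im_det h \<Lambda> z x y v' * (norm (1 + t * C))\<^sup>2) * (norm (1 + s * a))\<^sup>2"
    unfolding fac by (simp add: norm_mult power_mult_distrib)
  also have "\<dots> = im_det h \<Lambda> z x y v"
    unfolding e2 using e1 by (simp add: im_det_def a_def b_def c_def mult.commute)
  finally show "im_det h \<Lambda> z x y v' * (norm (1 + of_real s * a + of_real t * c + of_real s * of_real t * (a * c - b\<^sup>2)))\<^sup>2 = im_det h \<Lambda> z x y v" .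
qed

lemma nn_integral_im_det_two_sites_le:
  assumes sym: "\<forall>j k. h j k = h k j" and fin: "finite \<Lambda>" and z: "Im z > 0" and x: "x \<in> \<Lambda>" and y: "y \<in> \<Lambda>"
    and "x \<noteq> y"
  shows "(\<integral>\<^sup>+t. (\<integral>\<^sup>+s. ennreal (im_det h \<Lambda> z x y
      (\<lambda>k. v k + (if k = x then s else 0) + (if k = y then t else 0))) \<partial>lborel) \<partial>lborel) \<le> ennreal (pi\<^sup>2)"
  using im_det_nonneg[OF sym fin z x y, of v] im_det_two_sites[OF sym fin z x y \<open>x \<noteq> y\<close>, where v = v]
  by (intro nn_integral_rank_two_le[of _ "potential_green h \<Lambda> z v x x" "potential_green h \<Lambda> z v y y"
        "potential_green h \<Lambda> z v x y"]) (auto simp: im_det_def)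

section \<open>Products of Lebesgue measures and directional derivatives\<close>

lemma product_sigma_finite_lborel: "product_sigma_finite (\<lambda>_ :: 'i. lborel :: real measure)"
  by (simp add: product_sigma_finite_def lborel.sigma_finite_measure_axioms)

abbreviation lborel_on :: "'i set \<Rightarrow> ('i \<Rightarrow> real) measure" where
  "lborel_on I \<equiv> Pi\<^sub>M I (\<lambda>_. lborel)"

lemma PiM_density_lborel:
  fixes f :: "real \<Rightarrow> ennreal"
  assumes I: "finite I" and f[measurable]: "f \<in> borel_measurable borel"
    and sf: "sigma_finite_measure (density lborel f)"
  shows "Pi\<^sub>M I (\<lambda>_. density lborel f) = density (lborel_on I) (\<lambda>\<omega>. \<Prod>i\<in>I. f (\<omega> i))"
proof -
  interpret L: product_sigma_finite "\<lambda>_. lborel :: real measure" by (rule product_sigma_finite_lborel)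
  interpret D: product_sigma_finite "\<lambda>_. density lborel f" using sf by (simp add: product_sigma_finite_def)
  have sets_eq: "sets (density (lborel_on I) (\<lambda>\<omega>. \<Prod>i\<in>I. f (\<omega> i))) = sets (Pi\<^sub>M I (\<lambda>_. density lborel f))"
    by (simp, rule sets_PiM_cong) auto
  show ?thesis
  proof (rule D.PiM_eqI[OF I sets_eq, symmetric])
    fix A assume A: "\<And>i. i \<in> I \<Longrightarrow> A i \<in> sets (density lborel f)"
    then have [measurable]: "A i \<in> sets borel" if "i \<in> I" for i using that by simp
    have "emeasure (density (lborel_on I) (\<lambda>\<omega>. \<Prod>i\<in>I. f (\<omega> i))) (Pi\<^sub>E I A)
        = (\<integral>\<^sup>+\<omega>. (\<Prod>i\<in>I. f (\<omega> i)) * indicator (Pi\<^sub>E I A) \<omega> \<partial>lborel_on I)"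
      using A I by (intro emeasure_density) (auto intro!: sets_PiM_I_finite)
    also have "\<dots> = (\<integral>\<^sup>+\<omega>. (\<Prod>i\<in>I. f (\<omega> i) * indicator (A i) (\<omega> i)) \<partial>lborel_on I)"
    proof (intro nn_integral_cong)
      fix \<omega> assume "\<omega> \<in> space (lborel_on I)"
      then have "\<omega> \<in> Pi\<^sub>E I A \<longleftrightarrow> (\<forall>i\<in>I. \<omega> i \<in> A i)" by (auto simp: space_PiM PiE_iff)
      moreover have "(\<Prod>i\<in>I. indicator (A i) (\<omega> i) :: ennreal) = 0" if "\<not> (\<forall>i\<in>I. \<omega> i \<in> A i)"
        using that by (intro prod_zero[OF I]) (auto simp: indicator_def)
      ultimately have "indicator (Pi\<^sub>E I A) \<omega> = (\<Prod>i\<in>I. indicator (A i) (\<omega> i) :: ennreal)"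
        by (cases "\<forall>i\<in>I. \<omega> i \<in> A i") auto
      then show "(\<Prod>i\<in>I. f (\<omega> i)) * indicator (Pi\<^sub>E I A) \<omega> = (\<Prod>i\<in>I. f (\<omega> i) * indicator (A i) (\<omega> i))"
        by (simp add: prod.distrib)
    qed
    also have "\<dots> = (\<Prod>i\<in>I. \<integral>\<^sup>+t. f t * indicator (A i) t \<partial>lborel)"
      by (rule L.product_nn_integral_prod[OF I]) measurable
    also have "\<dots> = (\<Prod>i\<in>I. emeasure (density lborel f) (A i))"
      using A by (intro prod.cong refl) (simp add: emeasure_density)
    finally show "emeasure (density (lborel_on I) (\<lambda>\<omega>. \<Prod>i\<in>I. f (\<omega> i))) (Pi\<^sub>E I A)
        = (\<Prod>i\<in>I. emeasure (density lborel f) (A i))" .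
  qed
qed

lemma measurable_shift[measurable]:
  "(\<lambda>\<omega>. \<lambda>i\<in>I. \<omega> i + c i) \<in> lborel_on I \<rightarrow>\<^sub>M lborel_on I"
  by measurable

lemma nn_integral_shift:
  assumes I: "finite I" and f: "f \<in> borel_measurable (lborel_on I)"
  shows "(\<integral>\<^sup>+\<omega>. f (\<lambda>i\<in>I. \<omega> i + c i) \<partial>lborel_on I) = (\<integral>\<^sup>+\<omega>. f \<omega> \<partial>lborel_on I)"
proof -
  interpret L: product_sigma_finite "\<lambda>_. lborel :: real measure" by (rule product_sigma_finite_lborel)
  have "distr (lborel_on I) (lborel_on I) (\<lambda>\<omega>. \<lambda>i\<in>I. \<omega> i + c i) = lborel_on I"
  proof (rule L.PiM_eqI[OF I])
    fix A :: "'a \<Rightarrow> real set" assume A: "\<And>i. i \<in> I \<Longrightarrow> A i \<in> sets lborel"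
    have PA: "Pi\<^sub>E I A \<in> sets (lborel_on I)" using A I by (auto intro!: sets_PiM_I_finite)
    let ?B = "\<lambda>i. (\<lambda>t. c i + t) -` A i"
    have B: "?B i \<in> sets lborel" if "i \<in> I" for i
      using measurable_sets_borel[of "\<lambda>t. c i + t" borel "A i"] A[OF that] by simp
    have "emeasure (distr (lborel_on I) (lborel_on I) (\<lambda>\<omega>. \<lambda>i\<in>I. \<omega> i + c i)) (Pi\<^sub>E I A)
        = emeasure (lborel_on I) (Pi\<^sub>E I ?B)"
      by (subst emeasure_distr[OF measurable_shift PA], intro arg_cong[where f = "emeasure _"])
        (auto simp: space_PiM PiE_iff add.commute extensional_def)
    also have "\<dots> = (\<Prod>i\<in>I. emeasure lborel (?B i))" by (rule L.emeasure_PiM[OF I B])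
    also have "\<dots> = (\<Prod>i\<in>I. emeasure lborel (A i))"
    proof (intro prod.cong refl)
      fix i assume i: "i \<in> I"
      have "emeasure lborel (A i) = emeasure (distr lborel borel (\<lambda>t. c i + t)) (A i)"
        by (simp add: lborel_distr_plus)
      also have "\<dots> = emeasure lborel (?B i)" using A[OF i] by (subst emeasure_distr) auto
      finally show "emeasure lborel (?B i) = emeasure lborel (A i)" by simp
    qed
    finally show "emeasure (distr (lborel_on I) (lborel_on I) (\<lambda>\<omega>. \<lambda>i\<in>I. \<omega> i + c i)) (Pi\<^sub>E I A)
        = (\<Prod>i\<in>I. emeasure lborel (A i))" .
  qed simp
  moreover have "(\<integral>\<^sup>+\<omega>. f \<omega> \<partial>distr (lborel_on I) (lborel_on I) (\<lambda>\<omega>. \<lambda>i\<in>I. \<omega> i + c i))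
      = (\<integral>\<^sup>+\<omega>. f (\<lambda>i\<in>I. \<omega> i + c i) \<partial>lborel_on I)"
    by (rule nn_integral_distr) (use f in \<open>auto intro: measurable_shift\<close>)
  ultimately show ?thesis by simp
qed

text \<open>The fundamental theorem of calculus on the left and on the right half-line bounds \<open>\<bar>g 0\<bar>\<close> by the variation
  on each of them.\<close>

lemma half_total_variation:
  fixes g g' :: "real \<Rightarrow> real"
  assumes deriv: "\<And>s. (g has_real_derivative g' s) (at s)" and cont: "\<And>s. isCont g' s"
    and supp: "\<And>s. T < \<bar>s\<bar> \<Longrightarrow> g s = 0"
  shows "2 * ennreal \<bar>g 0\<bar> \<le> (\<integral>\<^sup>+s. ennreal \<bar>g' s\<bar> \<partial>lborel)"
proof -
  have meas[measurable]: "g' \<in> borel_measurable borel"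
    using cont by (intro borel_measurable_continuous_onI continuous_at_imp_continuous_on) auto
  have le: "ennreal \<bar>g b - g a\<bar> \<le> (\<integral>\<^sup>+s. ennreal \<bar>g' s\<bar> * indicator {a..b} s \<partial>lborel)" if "a \<le> b" for a b
  proof -
    have "(\<integral>s. g' s * indicator {a..b} s \<partial>lborel) = g b - g a"
      using that deriv cont by (intro integral_FTC_Icc_real) auto
    then have "ennreal \<bar>g b - g a\<bar> = ennreal (norm (\<integral>s. g' s * indicator {a..b} s \<partial>lborel))" by simp
    also have "\<dots> \<le> (\<integral>\<^sup>+s. ennreal (norm (g' s * indicator {a..b} s)) \<partial>lborel)"
      by (rule integral_norm_bound_ennreal)
        (use borel_integrable_atLeastAtMost[of a b g'] cont in \<open>simp add: mult.commute\<close>)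
    also have "\<dots> = (\<integral>\<^sup>+s. ennreal \<bar>g' s\<bar> * indicator {a..b} s \<partial>lborel)"
      by (intro nn_integral_cong) (auto simp: indicator_def)
    finally show ?thesis .
  qed
  define R where "R = \<bar>T\<bar> + 1"
  have R: "g R = 0" "g (- R) = 0" "R > 0" using supp[of R] supp[of "- R"] by (auto simp: R_def)
  have "2 * ennreal \<bar>g 0\<bar> = ennreal \<bar>g 0 - g (- R)\<bar> + ennreal \<bar>g R - g 0\<bar>"
    using R by (simp add: mult_2)
  also have "\<dots> \<le> (\<integral>\<^sup>+s. ennreal \<bar>g' s\<bar> * indicator {- R..0} s \<partial>lborel) + (\<integral>\<^sup>+s. ennreal \<bar>g' s\<bar> * indicator {0..R} s \<partial>lborel)"
    using R by (intro add_mono le) auto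
  also have "\<dots> = (\<integral>\<^sup>+s. ennreal \<bar>g' s\<bar> * indicator {- R..0} s + ennreal \<bar>g' s\<bar> * indicator {0..R} s \<partial>lborel)"
    by (rule nn_integral_add[symmetric]) measurable
  also have "\<dots> \<le> (\<integral>\<^sup>+s. ennreal \<bar>g' s\<bar> \<partial>lborel)"
    by (intro nn_integral_mono_AE eventually_mono[OF AE_lborel_singleton[of 0]])
      (auto simp: indicator_def)
  finally show ?thesis .
qed

text \<open>For a family \<open>\<psi>\<close> with \<open>\<psi> (n + 1) = (\<psi> n)'\<close>, the mixed partial derivative with multi-index \<open>n\<close> of the
  tensor power of \<open>\<psi> 0\<close>.\<close>

definition tensor_deriv :: "'i set \<Rightarrow> (nat \<Rightarrow> real \<Rightarrow> real) \<Rightarrow> ('i \<Rightarrow> nat) \<Rightarrow> ('i \<Rightarrow> real) \<Rightarrow> real" where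
  "tensor_deriv I \<psi> n \<omega> = (\<Prod>k\<in>I. \<psi> (n k) (\<omega> k))"

definition deriv_family :: "(nat \<Rightarrow> real \<Rightarrow> real) \<Rightarrow> bool" where
  "deriv_family \<psi> \<longleftrightarrow> (\<forall>n s. (\<psi> n has_real_derivative \<psi> (Suc n) s) (at s))"

lemma deriv_familyD: "deriv_family \<psi> \<Longrightarrow> (\<psi> n has_real_derivative \<psi> (Suc n) s) (at s)"
  by (simp add: deriv_family_def)

lemma tensor_deriv_along_line:
  assumes I: "finite I" and deriv: "deriv_family \<psi>"
  shows "((\<lambda>s. tensor_deriv I \<psi> n (\<lambda>k. \<omega> k - s * a k)) has_real_derivative
    (\<Sum>i\<in>I. - a i * tensor_deriv I \<psi> (n(i := Suc (n i))) (\<lambda>k. \<omega> k - s * a k))) (at s)"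
proof -
  have "((\<lambda>s. tensor_deriv I \<psi> n (\<lambda>k. \<omega> k - s * a k)) has_real_derivative
    (\<Sum>i\<in>I. (\<psi> (Suc (n i)) (\<omega> i - s * a i) * - a i) * (\<Prod>k\<in>I - {i}. \<psi> (n k) (\<omega> k - s * a k)))) (at s)"
    unfolding tensor_deriv_def
    by (intro has_field_derivative_prod DERIV_chain2[OF deriv_familyD[OF deriv]]) (auto intro!: derivative_eq_intros)
  moreover have "(\<Sum>i\<in>I. (\<psi> (Suc (n i)) (\<omega> i - s * a i) * - a i) * (\<Prod>k\<in>I - {i}. \<psi> (n k) (\<omega> k - s * a k)))
      = (\<Sum>i\<in>I. - a i * tensor_deriv I \<psi> (n(i := Suc (n i))) (\<lambda>k. \<omega> k - s * a k))"
  proof (rule sum.cong[OF refl])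
    fix i assume "i \<in> I"
    have "(\<Prod>k\<in>I - {i}. \<psi> ((n(i := Suc (n i))) k) (\<omega> k - s * a k)) = (\<Prod>k\<in>I - {i}. \<psi> (n k) (\<omega> k - s * a k))"
      by (intro prod.cong) auto
    then show "(\<psi> (Suc (n i)) (\<omega> i - s * a i) * - a i) * (\<Prod>k\<in>I - {i}. \<psi> (n k) (\<omega> k - s * a k))
      = - a i * tensor_deriv I \<psi> (n(i := Suc (n i))) (\<lambda>k. \<omega> k - s * a k)"
      unfolding tensor_deriv_def prod.remove[OF I \<open>i \<in> I\<close>] by simp
  qed
  ultimately show ?thesis by (simp only:)
qed

text \<open>A compactly supported function is bounded, along every line, by half of its total variation on
  that line.  Integrated against a nonnegative weight \<open>F\<close>, the line integral may be moved onto \<open>F\<close> by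
  translation invariance: a derivative in direction \<open>a\<close> is traded for an average of \<open>F\<close> in
  direction \<open>a\<close>.\<close>

lemma nn_integral_tensor_deriv_le:
  fixes F :: "('i \<Rightarrow> real) \<Rightarrow> ennreal"
  assumes I: "finite I" and deriv: "deriv_family \<psi>"
    and supp: "\<forall>n s. K < \<bar>s\<bar> \<longrightarrow> \<psi> n s = 0"
    and F[measurable]: "F \<in> borel_measurable (lborel_on I)" and a: "\<exists>k\<in>I. a k \<noteq> 0"
  shows "2 * (\<integral>\<^sup>+\<omega>. F \<omega> * ennreal \<bar>tensor_deriv I \<psi> n \<omega>\<bar> \<partial>lborel_on I)
    \<le> (\<Sum>i\<in>I. ennreal \<bar>a i\<bar> * (\<integral>\<^sup>+\<omega>. (\<integral>\<^sup>+s. F (\<lambda>k\<in>I. \<omega> k + s * a k) \<partial>lborel)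
          * ennreal \<bar>tensor_deriv I \<psi> (n(i := Suc (n i))) \<omega>\<bar> \<partial>lborel_on I))"
proof -
  interpret L: product_sigma_finite "\<lambda>_. lborel :: real measure" by (rule product_sigma_finite_lborel)
  interpret PL: sigma_finite_measure "lborel_on I" by (rule L.sigma_finite[OF I])
  interpret P: pair_sigma_finite "lborel_on I" "lborel :: real measure" by unfold_locales
  obtain k0 where k0: "k0 \<in> I" "a k0 \<noteq> 0" using a by blast
  have cont: "isCont (\<psi> n) s" for n s using deriv_familyD[OF deriv] by (rule DERIV_isCont)
  then have \<psi>[measurable]: "\<psi> n \<in> borel_measurable borel" for n
    by (intro borel_measurable_continuous_onI continuous_at_imp_continuous_on) auto
  have T[measurable]: "tensor_deriv I \<psi> m \<in> borel_measurable (lborel_on I)" for m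
    unfolding tensor_deriv_def by measurable
  have line[measurable]: "(\<lambda>(\<omega>, s). \<lambda>k\<in>I. \<omega> k + s * c k) \<in> lborel_on I \<Otimes>\<^sub>M lborel \<rightarrow>\<^sub>M lborel_on I" for c
    by measurable
  let ?D = "\<lambda>i. tensor_deriv I \<psi> (n(i := Suc (n i)))"
  let ?sh = "\<lambda>\<omega> s. \<lambda>k\<in>I. \<omega> k + s * - a k"
  have restrict: "tensor_deriv I \<psi> m (\<lambda>k. \<omega> k - s * a k) = tensor_deriv I \<psi> m (?sh \<omega> s)" for m \<omega> s
    by (auto simp: tensor_deriv_def intro!: prod.cong)
  have pointwise: "2 * ennreal \<bar>tensor_deriv I \<psi> n \<omega>\<bar> \<le> (\<Sum>i\<in>I. ennreal \<bar>a i\<bar> * (\<integral>\<^sup>+s. ennreal \<bar>?D i (?sh \<omega> s)\<bar> \<partial>lborel))"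
    if \<omega>: "\<omega> \<in> space (lborel_on I)" for \<omega>
  proof -
    let ?g' = "\<lambda>s. \<Sum>i\<in>I. - a i * ?D i (\<lambda>k. \<omega> k - s * a k)"
    have "2 * ennreal \<bar>tensor_deriv I \<psi> n (\<lambda>k. \<omega> k - 0 * a k)\<bar> \<le> (\<integral>\<^sup>+s. ennreal \<bar>?g' s\<bar> \<partial>lborel)"
    proof (rule half_total_variation)
      show "((\<lambda>s. tensor_deriv I \<psi> n (\<lambda>k. \<omega> k - s * a k)) has_real_derivative ?g' s) (at s)" for s
        by (rule tensor_deriv_along_line[OF I deriv])
      show "isCont ?g' s" for s
        by (intro continuous_intros DERIV_isCont[OF tensor_deriv_along_line[OF I deriv]])
      show "tensor_deriv I \<psi> n (\<lambda>k. \<omega> k - s * a k) = 0" if "(\<bar>K\<bar> + \<bar>\<omega> k0\<bar>) / \<bar>a k0\<bar> < \<bar>s\<bar>" for s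
      proof -
        have "\<bar>K\<bar> + \<bar>\<omega> k0\<bar> < \<bar>s * a k0\<bar>" using that k0 by (simp add: abs_mult field_simps)
        then have "K < \<bar>\<omega> k0 - s * a k0\<bar>" by linarith
        then show ?thesis
          unfolding tensor_deriv_def using supp k0(1) by (intro prod_zero[OF I]) auto
      qed
    qed
    also have "\<dots> \<le> (\<integral>\<^sup>+s. (\<Sum>i\<in>I. ennreal \<bar>a i\<bar> * ennreal \<bar>?D i (?sh \<omega> s)\<bar>) \<partial>lborel)"
    proof (intro nn_integral_mono)
      fix s
      have "\<bar>?g' s\<bar> \<le> (\<Sum>i\<in>I. \<bar>a i\<bar> * \<bar>?D i (?sh \<omega> s)\<bar>)"
        unfolding restrict by (intro order.trans[OF sum_abs] sum_mono) (simp add: abs_mult)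
      then have "ennreal \<bar>?g' s\<bar> \<le> ennreal (\<Sum>i\<in>I. \<bar>a i\<bar> * \<bar>?D i (?sh \<omega> s)\<bar>)" by (rule ennreal_leI)
      also have "\<dots> = (\<Sum>i\<in>I. ennreal \<bar>a i\<bar> * ennreal \<bar>?D i (?sh \<omega> s)\<bar>)"
        by (subst sum_ennreal[symmetric]) (auto simp: ennreal_mult')
      finally show "ennreal \<bar>?g' s\<bar> \<le> (\<Sum>i\<in>I. ennreal \<bar>a i\<bar> * ennreal \<bar>?D i (?sh \<omega> s)\<bar>)" .
    qed
    also have "\<dots> = (\<Sum>i\<in>I. ennreal \<bar>a i\<bar> * (\<integral>\<^sup>+s. ennreal \<bar>?D i (?sh \<omega> s)\<bar> \<partial>lborel))"
    proof -
      have [measurable]: "(\<lambda>s. ?sh \<omega> s) \<in> lborel \<rightarrow>\<^sub>M lborel_on I"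
        by measurable
      show ?thesis by (simp add: nn_integral_sum nn_integral_cmult)
    qed
    finally show ?thesis by simp
  qed
  have "2 * (\<integral>\<^sup>+\<omega>. F \<omega> * ennreal \<bar>tensor_deriv I \<psi> n \<omega>\<bar> \<partial>lborel_on I)
      = (\<integral>\<^sup>+\<omega>. F \<omega> * (2 * ennreal \<bar>tensor_deriv I \<psi> n \<omega>\<bar>) \<partial>lborel_on I)"
    by (subst nn_integral_cmult[symmetric]) (simp_all add: mult_ac)
  also have "\<dots> \<le> (\<integral>\<^sup>+\<omega>. F \<omega> * (\<Sum>i\<in>I. ennreal \<bar>a i\<bar> * (\<integral>\<^sup>+s. ennreal \<bar>?D i (?sh \<omega> s)\<bar> \<partial>lborel)) \<partial>lborel_on I)"
    by (intro nn_integral_mono mult_left_mono pointwise) auto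
  also have "\<dots> = (\<integral>\<^sup>+\<omega>. (\<Sum>i\<in>I. ennreal \<bar>a i\<bar> * (\<integral>\<^sup>+s. F \<omega> * ennreal \<bar>?D i (?sh \<omega> s)\<bar> \<partial>lborel)) \<partial>lborel_on I)"
  proof (intro nn_integral_cong)
    fix \<omega> assume "\<omega> \<in> space (lborel_on I)"
    have [measurable]: "(\<lambda>s. ?sh \<omega> s) \<in> lborel \<rightarrow>\<^sub>M lborel_on I"
      by measurable
    show "F \<omega> * (\<Sum>i\<in>I. ennreal \<bar>a i\<bar> * (\<integral>\<^sup>+s. ennreal \<bar>?D i (?sh \<omega> s)\<bar> \<partial>lborel))
        = (\<Sum>i\<in>I. ennreal \<bar>a i\<bar> * (\<integral>\<^sup>+s. F \<omega> * ennreal \<bar>?D i (?sh \<omega> s)\<bar> \<partial>lborel))"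
      by (simp add: sum_distrib_left nn_integral_cmult mult_ac)
  qed
  also have "\<dots> = (\<Sum>i\<in>I. ennreal \<bar>a i\<bar> * (\<integral>\<^sup>+\<omega>. (\<integral>\<^sup>+s. F \<omega> * ennreal \<bar>?D i (?sh \<omega> s)\<bar> \<partial>lborel) \<partial>lborel_on I))"
    by (simp add: nn_integral_sum nn_integral_cmult)
  also have "\<dots> = (\<Sum>i\<in>I. ennreal \<bar>a i\<bar> * (\<integral>\<^sup>+\<omega>. (\<integral>\<^sup>+s. F (\<lambda>k\<in>I. \<omega> k + s * a k) \<partial>lborel)
          * ennreal \<bar>?D i \<omega>\<bar> \<partial>lborel_on I))"
  proof (rule sum.cong[OF refl])
    fix i
    have "(\<integral>\<^sup>+\<omega>. (\<integral>\<^sup>+s. F \<omega> * ennreal \<bar>?D i (?sh \<omega> s)\<bar> \<partial>lborel) \<partial>lborel_on I)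
        = (\<integral>\<^sup>+s. (\<integral>\<^sup>+\<omega>. F \<omega> * ennreal \<bar>?D i (?sh \<omega> s)\<bar> \<partial>lborel_on I) \<partial>lborel)"
      by (rule P.Fubini'[symmetric]) measurable
    also have "\<dots> = (\<integral>\<^sup>+s. (\<integral>\<^sup>+\<omega>. F (\<lambda>k\<in>I. \<omega> k + s * a k) * ennreal \<bar>?D i \<omega>\<bar> \<partial>lborel_on I) \<partial>lborel)"
    proof (rule nn_integral_cong)
      fix s :: real
      have "(\<integral>\<^sup>+\<omega>. F \<omega> * ennreal \<bar>?D i (?sh \<omega> s)\<bar> \<partial>lborel_on I)
          = (\<integral>\<^sup>+\<omega>. F (\<lambda>k\<in>I. \<omega> k + s * a k) * ennreal \<bar>?D i (?sh (\<lambda>k\<in>I. \<omega> k + s * a k) s)\<bar> \<partial>lborel_on I)"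
        by (rule nn_integral_shift[OF I, symmetric]) measurable
      also have "\<dots> = (\<integral>\<^sup>+\<omega>. F (\<lambda>k\<in>I. \<omega> k + s * a k) * ennreal \<bar>?D i \<omega>\<bar> \<partial>lborel_on I)"
        by (intro nn_integral_cong arg_cong2[where f = "(*)"] refl)
          (auto simp: tensor_deriv_def intro!: arg_cong[where f = "\<lambda>t. ennreal \<bar>t\<bar>"] prod.cong)
      finally show "(\<integral>\<^sup>+\<omega>. F \<omega> * ennreal \<bar>?D i (?sh \<omega> s)\<bar> \<partial>lborel_on I)
          = (\<integral>\<^sup>+\<omega>. F (\<lambda>k\<in>I. \<omega> k + s * a k) * ennreal \<bar>?D i \<omega>\<bar> \<partial>lborel_on I)" .
    qed
    also have "\<dots> = (\<integral>\<^sup>+\<omega>. (\<integral>\<^sup>+s. F (\<lambda>k\<in>I. \<omega> k + s * a k) * ennreal \<bar>?D i \<omega>\<bar> \<partial>lborel) \<partial>lborel_on I)"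
      by (rule P.Fubini') measurable
    also have "\<dots> = (\<integral>\<^sup>+\<omega>. (\<integral>\<^sup>+s. F (\<lambda>k\<in>I. \<omega> k + s * a k) \<partial>lborel) * ennreal \<bar>?D i \<omega>\<bar> \<partial>lborel_on I)"
    proof (intro nn_integral_cong nn_integral_multc)
      fix \<omega> :: "'i \<Rightarrow> real" assume "\<omega> \<in> space (lborel_on I)"
      have [measurable]: "(\<lambda>s. \<lambda>k\<in>I. \<omega> k + s * a k) \<in> lborel \<rightarrow>\<^sub>M lborel_on I"
        by measurable
      show "(\<lambda>s. F (\<lambda>k\<in>I. \<omega> k + s * a k)) \<in> borel_measurable lborel" by measurable
    qed
    finally show "ennreal \<bar>a i\<bar> * (\<integral>\<^sup>+\<omega>. (\<integral>\<^sup>+s. F \<omega> * ennreal \<bar>?D i (?sh \<omega> s)\<bar> \<partial>lborel) \<partial>lborel_on I)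
        = ennreal \<bar>a i\<bar> * (\<integral>\<^sup>+\<omega>. (\<integral>\<^sup>+s. F (\<lambda>k\<in>I. \<omega> k + s * a k) \<partial>lborel) * ennreal \<bar>?D i \<omega>\<bar> \<partial>lborel_on I)"
      by (rule arg_cong)
  qed
  finally show ?thesis .
qed

text \<open>Trading one derivative in direction \<open>a\<close> and then one in direction \<open>b\<close> leaves the plane average of \<open>F\<close>, which is
  at most \<open>C\<close>, and second partial derivatives of a product density.  The integral of such a derivative factorizes:
  two derivatives on the same factor give \<open>n2\<close>, on different factors \<open>n1\<^sup>2\<close>, and the remaining factors have mass at
  most one.\<close>

lemma nn_integral_tensor_density_le:
  fixes F :: "('i \<Rightarrow> real) \<Rightarrow> ennreal" and a b :: "'i \<Rightarrow> real" and \<psi> :: "nat \<Rightarrow> real \<Rightarrow> real"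
  assumes I: "finite I" and deriv: "deriv_family \<psi>"
    and supp: "\<forall>n s. K < \<bar>s\<bar> \<longrightarrow> \<psi> n s = 0"
    and F[measurable]: "F \<in> borel_measurable (lborel_on I)"
    and a: "\<exists>k\<in>I. a k \<noteq> 0" and b: "\<exists>k\<in>I. b k \<noteq> 0"
    and N0: "(\<integral>\<^sup>+s. ennreal \<bar>\<psi> 0 s\<bar> \<partial>lborel) \<le> 1"
    and N1: "(\<integral>\<^sup>+s. ennreal \<bar>\<psi> 1 s\<bar> \<partial>lborel) \<le> ennreal n1" "0 \<le> n1"
    and N2: "(\<integral>\<^sup>+s. ennreal \<bar>\<psi> 2 s\<bar> \<partial>lborel) \<le> ennreal n2" "0 \<le> n2"
    and average: "\<And>\<omega>. (\<integral>\<^sup>+t. (\<integral>\<^sup>+s. F (\<lambda>k\<in>I. \<omega> k + t * b k + s * a k) \<partial>lborel) \<partial>lborel) \<le> ennreal C" "0 \<le> C"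
  shows "(\<integral>\<^sup>+\<omega>. F \<omega> * ennreal \<bar>\<Prod>k\<in>I. \<psi> 0 (\<omega> k)\<bar> \<partial>lborel_on I)
    \<le> ennreal (C / 4 * (\<Sum>i\<in>I. \<bar>a i\<bar>) * (\<Sum>j\<in>I. \<bar>b j\<bar>) * max (n1\<^sup>2) n2)"
proof -
  interpret L: product_sigma_finite "\<lambda>_. lborel :: real measure" by (rule product_sigma_finite_lborel)
  interpret PL: sigma_finite_measure "lborel_on I" by (rule L.sigma_finite[OF I])
  have cont: "isCont (\<psi> n) s" for n s using deriv_familyD[OF deriv] by (rule DERIV_isCont)
  then have \<psi>[measurable]: "\<psi> n \<in> borel_measurable borel" for n
    by (intro borel_measurable_continuous_onI continuous_at_imp_continuous_on) auto
  have T[measurable]: "tensor_deriv I \<psi> m \<in> borel_measurable (lborel_on I)" for m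
    unfolding tensor_deriv_def by measurable
  have line[measurable]: "(\<lambda>(\<omega>, s). \<lambda>k\<in>I. \<omega> k + s * c k) \<in> lborel_on I \<Otimes>\<^sub>M lborel \<rightarrow>\<^sub>M lborel_on I" for c
    by measurable
  define F1 where "F1 \<omega> = (\<integral>\<^sup>+s. F (\<lambda>k\<in>I. \<omega> k + s * a k) \<partial>lborel)" for \<omega>
  have F1[measurable]: "F1 \<in> borel_measurable (lborel_on I)" unfolding F1_def by measurable
  define M where "M = max (n1\<^sup>2) n2"
  have M: "0 \<le> M" "n1\<^sup>2 \<le> M" "n2 \<le> M" by (auto simp: M_def le_max_iff_disj)
  \<comment> \<open>The multi-index \<open>e\<^sub>i + e\<^sub>j\<close>, in the form in which two differentiations produce it.\<close>
  define e where "e i j = (\<lambda>_ :: 'i. 0 :: nat)(i := Suc 0, j := Suc (((\<lambda>_. 0)(i := Suc 0)) j))" for i j :: 'i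
  have norm_e: "(\<integral>\<^sup>+\<omega>. ennreal \<bar>tensor_deriv I \<psi> (e i j) \<omega>\<bar> \<partial>lborel_on I) \<le> ennreal M"
    if ij: "i \<in> I" "j \<in> I" for i j
  proof -
    let ?N = "\<lambda>k. \<integral>\<^sup>+s. ennreal \<bar>\<psi> (e i j k) s\<bar> \<partial>lborel"
    have "(\<integral>\<^sup>+\<omega>. ennreal \<bar>tensor_deriv I \<psi> (e i j) \<omega>\<bar> \<partial>lborel_on I)
        = (\<integral>\<^sup>+\<omega>. (\<Prod>k\<in>I. ennreal \<bar>\<psi> (e i j k) (\<omega> k)\<bar>) \<partial>lborel_on I)"
      by (intro nn_integral_cong) (simp add: tensor_deriv_def abs_prod prod_ennreal)
    also have "\<dots> = (\<Prod>k\<in>I. ?N k)" by (rule L.product_nn_integral_prod[OF I]) measurable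
    also have "\<dots> = (\<Prod>k\<in>{i, j}. ?N k) * (\<Prod>k\<in>I - {i, j}. ?N k)"
      using ij I by (subst prod.subset_diff[of "{i, j}" I]) (auto simp: mult.commute)
    also have "\<dots> \<le> (\<Prod>k\<in>{i, j}. ?N k) * 1"
      using N0 by (intro mult_left_mono prod_le_1) (auto simp: e_def)
    also have "(\<Prod>k\<in>{i, j}. ?N k) * 1 \<le> ennreal M"
    proof (cases "i = j")
      case True
      then have "(\<Prod>k\<in>{i, j}. ?N k) = (\<integral>\<^sup>+s. ennreal \<bar>\<psi> 2 s\<bar> \<partial>lborel)"
        by (simp add: e_def numeral_2_eq_2)
      also have "\<dots> \<le> ennreal M" using N2(1) M(3) by (meson ennreal_leI order.trans)
      finally show ?thesis by simp
    next
      case False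
      then have "(\<Prod>k\<in>{i, j}. ?N k) = (\<integral>\<^sup>+s. ennreal \<bar>\<psi> 1 s\<bar> \<partial>lborel) * (\<integral>\<^sup>+s. ennreal \<bar>\<psi> 1 s\<bar> \<partial>lborel)"
        by (auto simp: e_def)
      also have "\<dots> \<le> ennreal n1 * ennreal n1" by (intro mult_mono N1) auto
      also have "\<dots> = ennreal (n1\<^sup>2)" using N1(2) by (simp add: ennreal_mult[symmetric] power2_eq_square)
      also have "\<dots> \<le> ennreal M" by (intro ennreal_leI M)
      finally show ?thesis by simp
    qed
    finally show ?thesis by simp
  qed
  have average': "(\<integral>\<^sup>+t. F1 (\<lambda>k\<in>I. \<omega> k + t * b k) \<partial>lborel) \<le> ennreal C" for \<omega>
  proof -
    have "F (\<lambda>k\<in>I. (\<lambda>k\<in>I. \<omega> k + t * b k) k + s * a k) = F (\<lambda>k\<in>I. \<omega> k + t * b k + s * a k)" for s t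
      by (intro arg_cong[where f = F]) auto
    then show ?thesis unfolding F1_def using average(1)[of \<omega>] by simp
  qed
  have inner: "2 * (\<integral>\<^sup>+\<omega>. F1 \<omega> * ennreal \<bar>tensor_deriv I \<psi> ((\<lambda>_. 0)(i := Suc 0)) \<omega>\<bar> \<partial>lborel_on I)
      \<le> ennreal (C * M * (\<Sum>j\<in>I. \<bar>b j\<bar>))" if i: "i \<in> I" for i
  proof -
    have "2 * (\<integral>\<^sup>+\<omega>. F1 \<omega> * ennreal \<bar>tensor_deriv I \<psi> ((\<lambda>_. 0)(i := Suc 0)) \<omega>\<bar> \<partial>lborel_on I)
      \<le> (\<Sum>j\<in>I. ennreal \<bar>b j\<bar> * (\<integral>\<^sup>+\<omega>. (\<integral>\<^sup>+t. F1 (\<lambda>k\<in>I. \<omega> k + t * b k) \<partial>lborel)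
          * ennreal \<bar>tensor_deriv I \<psi> (e i j) \<omega>\<bar> \<partial>lborel_on I))"
      unfolding e_def by (rule nn_integral_tensor_deriv_le[OF I deriv supp F1 b])
    also have "\<dots> \<le> (\<Sum>j\<in>I. ennreal \<bar>b j\<bar> * (ennreal C * ennreal M))"
    proof (intro sum_mono mult_left_mono)
      fix j assume j: "j \<in> I"
      have "(\<integral>\<^sup>+\<omega>. (\<integral>\<^sup>+t. F1 (\<lambda>k\<in>I. \<omega> k + t * b k) \<partial>lborel) * ennreal \<bar>tensor_deriv I \<psi> (e i j) \<omega>\<bar> \<partial>lborel_on I)
          \<le> (\<integral>\<^sup>+\<omega>. ennreal C * ennreal \<bar>tensor_deriv I \<psi> (e i j) \<omega>\<bar> \<partial>lborel_on I)"
        by (intro nn_integral_mono mult_right_mono average') auto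
      also have "\<dots> = ennreal C * (\<integral>\<^sup>+\<omega>. ennreal \<bar>tensor_deriv I \<psi> (e i j) \<omega>\<bar> \<partial>lborel_on I)"
        by (rule nn_integral_cmult) measurable
      also have "\<dots> \<le> ennreal C * ennreal M" by (intro mult_left_mono norm_e i j) auto
      finally show "(\<integral>\<^sup>+\<omega>. (\<integral>\<^sup>+t. F1 (\<lambda>k\<in>I. \<omega> k + t * b k) \<partial>lborel) * ennreal \<bar>tensor_deriv I \<psi> (e i j) \<omega>\<bar> \<partial>lborel_on I)
          \<le> ennreal C * ennreal M" .
    qed auto
    also have "\<dots> = (\<Sum>j\<in>I. ennreal (\<bar>b j\<bar> * (C * M)))"
      using average(2) M(1) by (intro sum.cong refl) (simp add: ennreal_mult)
    also have "\<dots> = ennreal (C * M * (\<Sum>j\<in>I. \<bar>b j\<bar>))"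
      using average(2) M(1) by (subst sum_ennreal) (auto simp: sum_distrib_left mult_ac)
    finally show ?thesis .
  qed
  let ?X = "\<integral>\<^sup>+\<omega>. F \<omega> * ennreal \<bar>tensor_deriv I \<psi> (\<lambda>_. 0) \<omega>\<bar> \<partial>lborel_on I"
  have "2 * (2 * ?X) \<le> 2 * (\<Sum>i\<in>I. ennreal \<bar>a i\<bar> * (\<integral>\<^sup>+\<omega>. F1 \<omega>
          * ennreal \<bar>tensor_deriv I \<psi> ((\<lambda>_. 0)(i := Suc 0)) \<omega>\<bar> \<partial>lborel_on I))"
    unfolding F1_def by (intro mult_left_mono nn_integral_tensor_deriv_le[OF I deriv supp F a]) auto
  also have "\<dots> = (\<Sum>i\<in>I. ennreal \<bar>a i\<bar> * (2 * (\<integral>\<^sup>+\<omega>. F1 \<omega>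
          * ennreal \<bar>tensor_deriv I \<psi> ((\<lambda>_. 0)(i := Suc 0)) \<omega>\<bar> \<partial>lborel_on I)))"
    by (simp add: sum_distrib_left mult.left_commute)
  also have "\<dots> \<le> (\<Sum>i\<in>I. ennreal \<bar>a i\<bar> * ennreal (C * M * (\<Sum>j\<in>I. \<bar>b j\<bar>)))"
    by (intro sum_mono mult_left_mono inner) auto
  also have "\<dots> = (\<Sum>i\<in>I. ennreal (\<bar>a i\<bar> * (C * M * (\<Sum>j\<in>I. \<bar>b j\<bar>))))"
    by (intro sum.cong refl) (simp add: ennreal_mult')
  also have "\<dots> = ennreal (C * M * (\<Sum>j\<in>I. \<bar>b j\<bar>) * (\<Sum>i\<in>I. \<bar>a i\<bar>))"
    using average(2) M(1) by (subst sum_ennreal)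
      (auto simp: sum_distrib_right[symmetric] mult.commute sum_nonneg)
  finally have four: "2 * (2 * ?X) \<le> ennreal (C * M * (\<Sum>j\<in>I. \<bar>b j\<bar>) * (\<Sum>i\<in>I. \<bar>a i\<bar>))" .
  have "?X = ennreal (1 / 4) * (2 * (2 * ?X))"
  proof -
    have "ennreal (1 / 4) * (2 * 2) = ennreal (1 / 4) * ennreal 4" by simp
    also have "\<dots> = 1" by (simp add: ennreal_mult[symmetric] del: ennreal_numeral)
    finally show ?thesis by (simp add: mult.assoc[symmetric])
  qed
  also have "\<dots> \<le> ennreal (1 / 4) * ennreal (C * M * (\<Sum>j\<in>I. \<bar>b j\<bar>) * (\<Sum>i\<in>I. \<bar>a i\<bar>))"
    by (intro mult_left_mono four) auto
  also have "\<dots> = ennreal (C / 4 * (\<Sum>i\<in>I. \<bar>a i\<bar>) * (\<Sum>j\<in>I. \<bar>b j\<bar>) * max (n1\<^sup>2) n2)"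
    using average(2) M(1) by (simp add: ennreal_mult[symmetric] sum_nonneg M_def[symmetric] mult_ac)
  finally show ?thesis by (simp add: tensor_deriv_def)
qed

section \<open>Smooth approximation of weakly differentiable densities\<close>

lemma has_real_derivative_zero_of_quadratic_bound:
  fixes f :: "real \<Rightarrow> real"
  assumes "f x = 0" and le: "\<And>y. \<bar>f y\<bar> \<le> C * (y - x)\<^sup>2"
  shows "(f has_real_derivative 0) (at x)"
  unfolding has_field_derivative_iff
proof (rule Lim_null_comparison)
  show "\<forall>\<^sub>F y in at x. norm ((f y - f x) / (y - x)) \<le> C * \<bar>y - x\<bar>"
  proof (intro always_eventually allI)
    fix y
    show "norm ((f y - f x) / (y - x)) \<le> C * \<bar>y - x\<bar>"
    proof (cases "y = x")
      case False
      have "\<bar>f y\<bar> \<le> (C * \<bar>y - x\<bar>) * \<bar>y - x\<bar>"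
        using le[of y] by (simp add: power2_eq_square abs_mult_self_eq mult.assoc)
      then show ?thesis using False assms(1) by (simp add: divide_le_eq abs_divide)
    qed simp
  qed
  show "((\<lambda>y. C * \<bar>y - x\<bar>) \<longlongrightarrow> 0) (at x)"
    by (auto intro!: tendsto_eq_intros)
qed

lemma power_mult_exp_minus_le:
  fixes y :: real
  assumes "y \<ge> 0"
  shows "y ^ k * exp (- y) \<le> real k ^ k"
proof (cases "k = 0")
  case False
  have "(y / k) ^ k \<le> exp (y / k) ^ k"
    using assms exp_ge_add_one_self[of "y / k"] by (intro power_mono) (linarith, simp)
  also have "\<dots> = exp y" using False by (simp add: exp_of_nat_mult[symmetric])
  finally show ?thesis using False by (simp add: power_divide exp_minus field_simps)
qed (use assms in simp)

text \<open>A class of smooth functions supported in \<open>[-1, 1]\<close> that is closed under differentiation: differentiation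
  only changes the polynomial and raises the power of \<open>1 - x\<^sup>2\<close> in the denominator by two.\<close>

definition bump_term :: "real poly \<Rightarrow> nat \<Rightarrow> real \<Rightarrow> real" where
  "bump_term p n x = (if \<bar>x\<bar> < 1 then poly p x / (1 - x\<^sup>2) ^ n * exp (- (1 / (1 - x\<^sup>2))) else 0)"

definition bump_deriv_poly :: "real poly \<Rightarrow> nat \<Rightarrow> real poly" where
  "bump_deriv_poly p n = pderiv p * [:1, 0, -1:] ^ 2 + smult (2 * real n) (p * [:0, 1:] * [:1, 0, -1:]) - p * [:0, 2:]"

text \<open>Near the endpoints the exponential beats every power of \<open>1 / (1 - y\<^sup>2)\<close>; two powers are kept to make the function
  differentiable there, with derivative zero.\<close>

lemma bump_term_quadratic_bound:
  assumes x: "\<bar>x\<bar> = 1"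
  shows "\<exists>C. \<forall>y. \<bar>bump_term p n y\<bar> \<le> C * (y - x)\<^sup>2"
proof -
  have "compact (poly p ` {-1..1})"
    by (intro compact_continuous_image continuous_intros) auto
  then obtain B where B: "\<And>y. y \<in> {-1..1} \<Longrightarrow> \<bar>poly p y\<bar> \<le> B"
    using compact_imp_bounded[of "poly p ` {-1..1}"] unfolding bounded_iff by fastforce
  define C where "C = B * real (n + 2) ^ (n + 2) * 4"
  have B0: "0 \<le> B" using B[of 0] by auto
  have "\<bar>bump_term p n y\<bar> \<le> C * (y - x)\<^sup>2" for y
  proof (cases "\<bar>y\<bar> < 1")
    case True
    define w where "w = 1 - y\<^sup>2"
    have w: "w > 0" using True by (simp add: w_def abs_square_less_1)
    have "w = (1 - \<bar>y\<bar>) * (1 + \<bar>y\<bar>)" by (simp add: w_def power2_eq_square algebra_simps)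
    also have "\<dots> \<le> \<bar>y - x\<bar> * 2" using True x by (intro mult_mono) auto
    finally have "w\<^sup>2 \<le> (\<bar>y - x\<bar> * 2)\<^sup>2" using w by (intro power_mono) auto
    then have w2: "w\<^sup>2 \<le> 4 * (y - x)\<^sup>2" by (simp add: power_mult_distrib)
    have "1 / w ^ n * exp (- (1 / w)) = w\<^sup>2 * ((1 / w) ^ (n + 2) * exp (- (1 / w)))"
      using w by (simp add: power_add power_divide power2_eq_square)
    also have "\<dots> \<le> w\<^sup>2 * real (n + 2) ^ (n + 2)"
      using w by (intro mult_left_mono power_mult_exp_minus_le) auto
    also have "\<dots> \<le> (4 * (y - x)\<^sup>2) * real (n + 2) ^ (n + 2)"
      using w2 by (intro mult_right_mono) auto
    finally have e: "1 / w ^ n * exp (- (1 / w)) \<le> (4 * (y - x)\<^sup>2) * real (n + 2) ^ (n + 2)" .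
    have "\<bar>bump_term p n y\<bar> = \<bar>poly p y\<bar> * (1 / w ^ n * exp (- (1 / w)))"
      using True w by (simp add: bump_term_def w_def[symmetric] abs_mult)
    also have "\<dots> \<le> B * ((4 * (y - x)\<^sup>2) * real (n + 2) ^ (n + 2))"
      using True B[of y] B0 w by (intro mult_mono[OF _ e]) (auto simp: abs_less_iff)
    finally show ?thesis by (simp add: C_def mult_ac)
  qed (use B0 in \<open>simp add: bump_term_def C_def\<close>)
  then show ?thesis by blast
qed

lemma has_real_derivative_bump_term:
  "(bump_term p n has_real_derivative bump_term (bump_deriv_poly p n) (n + 2) x) (at x)"
proof -
  consider "\<bar>x\<bar> < 1" | "\<bar>x\<bar> > 1" | "\<bar>x\<bar> = 1" by linarith
  then show ?thesis
  proof cases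
    case 1
    let ?f = "\<lambda>x. poly p x / (1 - x\<^sup>2) ^ n * exp (- (1 / (1 - x\<^sup>2)))"
    define w where "w = 1 - x\<^sup>2"
    have w: "w > 0" using 1 by (simp add: w_def abs_square_less_1)
    have "((\<lambda>x. 1 - x\<^sup>2) has_real_derivative - (2 * x)) (at x)"
      by (auto intro!: derivative_eq_intros)
    then have "((\<lambda>x. inverse (1 - x\<^sup>2)) has_real_derivative - (- (2 * x) * inverse ((1 - x\<^sup>2) ^ Suc (Suc 0)))) (at x)"
      using w by (intro DERIV_inverse_fun) (simp_all add: w_def)
    then have inv: "((\<lambda>x. 1 / (1 - x\<^sup>2)) has_real_derivative 2 * x / w\<^sup>2) (at x)"
      by (simp add: w_def divide_inverse numeral_2_eq_2)
    have eq: "?f = (\<lambda>x. poly p x * (1 / (1 - x\<^sup>2)) ^ n * exp (- (1 / (1 - x\<^sup>2))))"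
      by (simp add: fun_eq_iff power_divide)
    have "(?f has_real_derivative
        (poly (pderiv p) x * (1 / w) ^ n + poly p x * (real n * (1 / w) ^ (n - 1) * (2 * x / w\<^sup>2))) * exp (- (1 / w))
          + poly p x * (1 / w) ^ n * (exp (- (1 / w)) * - (2 * x / w\<^sup>2))) (at x)"
      unfolding eq
      by (rule derivative_eq_intros inv poly_DERIV refl)+ (simp add: w_def[symmetric] algebra_simps)
    also have "real n * (1 / w) ^ (n - 1) = real n * w * (1 / w) ^ n"
      using w by (cases n) auto
    also have "(poly (pderiv p) x * (1 / w) ^ n + poly p x * (real n * w * (1 / w) ^ n * (2 * x / w\<^sup>2))) * exp (- (1 / w))
          + poly p x * (1 / w) ^ n * (exp (- (1 / w)) * - (2 * x / w\<^sup>2))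
        = (poly (pderiv p) x * w\<^sup>2 + 2 * real n * (poly p x * x * w) - poly p x * (2 * x)) / w ^ (n + 2) * exp (- (1 / w))"
      using w by (simp add: power_add power_divide field_simps power2_eq_square)
    also have "\<dots> = bump_term (bump_deriv_poly p n) (n + 2) x"
    proof -
      have "poly [:1, 0, -1:] x = w" by (simp add: w_def power2_eq_square)
      moreover have "poly [:0, 1:] x = x" "poly [:0, 2:] x = 2 * x" by simp_all
      ultimately have "poly (bump_deriv_poly p n) x = poly (pderiv p) x * w\<^sup>2 + 2 * real n * (poly p x * x * w) - poly p x * (2 * x)"
        unfolding bump_deriv_poly_def poly_add poly_diff poly_mult poly_smult poly_power by simp
      then show ?thesis using 1 by (simp add: bump_term_def w_def)
    qed
    finally have "(?f has_real_derivative bump_term (bump_deriv_poly p n) (n + 2) x) (at x)" .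
    then show ?thesis
      by (rule has_field_derivative_transform_within_open[where S = "{-1<..<1}"])
        (use 1 in \<open>auto simp: bump_term_def abs_less_iff\<close>)
  next
    case 2
    have "((\<lambda>_. 0) has_real_derivative 0) (at x)" by simp
    then have "(bump_term p n has_real_derivative 0) (at x)"
      by (rule has_field_derivative_transform_within_open[where S = "- {-1..1}"])
        (use 2 in \<open>auto simp: bump_term_def abs_less_iff\<close>)
    then show ?thesis using 2 by (simp add: bump_term_def)
  next
    case 3
    obtain C where C: "\<And>y. \<bar>bump_term p n y\<bar> \<le> C * (y - x)\<^sup>2"
      using bump_term_quadratic_bound[OF 3] by blast
    have "(bump_term p n has_real_derivative 0) (at x)"
      by (rule has_real_derivative_zero_of_quadratic_bound[OF _ C]) (use 3 in \<open>simp add: bump_term_def\<close>)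
    then show ?thesis using 3 by (simp add: bump_term_def)
  qed
qed

text \<open>Numerators of the successive derivatives of \<open>exp (- 1 / (1 - x\<^sup>2))\<close>.\<close>

primrec bump_poly :: "nat \<Rightarrow> real poly" where
  "bump_poly 0 = 1"
| "bump_poly (Suc k) = bump_deriv_poly (bump_poly k) (2 * k)"

lemma deriv_family_bump: "deriv_family (\<lambda>k. bump_term (bump_poly k) (2 * k))"
  using has_real_derivative_bump_term[of "bump_poly _" "2 * _"] by (simp add: deriv_family_def)

lemma deriv_family_continuous: "deriv_family \<psi> \<Longrightarrow> continuous_on UNIV (\<psi> n)"
  by (intro continuous_at_imp_continuous_on ballI DERIV_isCont) (rule deriv_familyD)

lemma deriv_family_measurable: "deriv_family \<psi> \<Longrightarrow> \<psi> n \<in> borel_measurable borel"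
  by (intro borel_measurable_continuous_onI deriv_family_continuous)

lemma mollifier_exists:
  fixes \<epsilon> :: real
  assumes \<epsilon>: "\<epsilon> > 0"
  shows "\<exists>\<eta>. deriv_family \<eta> \<and> (\<forall>n s. \<epsilon> < \<bar>s\<bar> \<longrightarrow> \<eta> n s = 0) \<and> (\<forall>s. 0 \<le> \<eta> 0 s)
    \<and> (\<integral>\<^sup>+s. ennreal (\<eta> 0 s) \<partial>lborel) = 1"
proof -
  define \<beta> where "\<beta> k = bump_term (bump_poly k) (2 * k)" for k
  have \<beta>: "deriv_family \<beta>" unfolding \<beta>_def using deriv_family_bump by simp
  note [measurable] = deriv_family_measurable[OF \<beta>]
  have \<beta>0: "\<beta> 0 x = (if \<bar>x\<bar> < 1 then exp (- (1 / (1 - x\<^sup>2))) else 0)" for x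
    by (simp add: \<beta>_def bump_term_def)
  define c where "c = (\<integral>\<^sup>+s. ennreal (\<beta> 0 s) \<partial>lborel)"
  have "c \<le> (\<integral>\<^sup>+s. indicator {-1..1} s \<partial>(lborel :: real measure))"
    unfolding c_def by (intro nn_integral_mono)
      (auto simp: \<beta>0 indicator_def abs_less_iff abs_square_less_1 less_imp_le)
  also have "\<dots> = ennreal 2" by simp
  finally have c_fin: "c < \<infinity>" by (simp add: order_le_less_trans)
  have "(\<integral>\<^sup>+s. ennreal (exp (- 2)) * indicator {-1/2..1/2} s \<partial>(lborel :: real measure)) \<le> c"
    unfolding c_def
  proof (intro nn_integral_mono)
    fix s :: real
    show "ennreal (exp (- 2)) * indicator {-1/2..1/2} s \<le> ennreal (\<beta> 0 s)"
    proof (cases "s \<in> {-1/2..1/2}")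
      case True
      then have "s\<^sup>2 \<le> (1/2)\<^sup>2" by (subst abs_le_square_iff[symmetric]) auto
      then have "1 / (1 - s\<^sup>2) \<le> 2" by (simp add: field_simps power2_eq_square)
      then show ?thesis using True by (auto simp: \<beta>0)
    qed simp
  qed
  then have "ennreal (exp (- 2)) \<le> c" by (simp add: nn_integral_cmult)
  then have "c > 0" by (rule order.strict_trans2[rotated]) simp
  then obtain r where r: "c = ennreal r" "r > 0"
    using c_fin by (cases c) auto
  \<comment> \<open>Rescaling to \<open>[-\<epsilon>, \<epsilon>]\<close> contributes one factor \<open>1 / \<epsilon>\<close> per derivative and one to keep the mass.\<close>
  define \<eta> where "\<eta> n x = \<beta> n (x / \<epsilon>) / (r * \<epsilon> ^ (n + 1))" for n x
  have "deriv_family \<eta>"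
    unfolding deriv_family_def
  proof (intro allI)
    fix n s
    have "((\<lambda>x. \<beta> n (x / \<epsilon>)) has_real_derivative \<beta> (Suc n) (s / \<epsilon>) * (1 / \<epsilon>)) (at s)"
      by (rule DERIV_chain2[OF deriv_familyD[OF \<beta>]]) (use \<epsilon> in \<open>auto intro!: derivative_eq_intros\<close>)
    then have "(\<eta> n has_real_derivative \<beta> (Suc n) (s / \<epsilon>) * (1 / \<epsilon>) / (r * \<epsilon> ^ (n + 1))) (at s)"
      unfolding \<eta>_def by (rule DERIV_cdivide)
    then show "(\<eta> n has_real_derivative \<eta> (Suc n) s) (at s)"
      by (simp add: \<eta>_def mult_ac)
  qed
  moreover have "\<forall>n s. \<epsilon> < \<bar>s\<bar> \<longrightarrow> \<eta> n s = 0"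
    using \<epsilon> by (auto simp: \<eta>_def \<beta>_def bump_term_def abs_divide)
  moreover have nonneg: "\<forall>s. 0 \<le> \<eta> 0 s" using r \<epsilon> by (auto simp: \<eta>_def \<beta>0)
  moreover have "(\<integral>\<^sup>+s. ennreal (\<eta> 0 s) \<partial>lborel) = 1"
  proof -
    have m: "(\<lambda>s. ennreal (\<eta> 0 s)) \<in> borel_measurable borel"
      using deriv_family_measurable[OF \<open>deriv_family \<eta>\<close>] by simp
    have "(\<integral>\<^sup>+s. ennreal (\<eta> 0 s) \<partial>lborel) = ennreal \<bar>\<epsilon>\<bar> * (\<integral>\<^sup>+s. ennreal (\<eta> 0 (0 + \<epsilon> * s)) \<partial>lborel)"
      using nn_integral_real_affine[OF m, of \<epsilon> 0] \<epsilon> by simp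
    also have "(\<integral>\<^sup>+s. ennreal (\<eta> 0 (0 + \<epsilon> * s)) \<partial>lborel) = (\<integral>\<^sup>+s. ennreal (1 / (r * \<epsilon>)) * ennreal (\<beta> 0 s) \<partial>lborel)"
      using r \<epsilon> by (intro nn_integral_cong) (simp add: \<eta>_def ennreal_mult'[symmetric])
    also have "\<dots> = ennreal (1 / (r * \<epsilon>)) * ennreal r"
      by (subst nn_integral_cmult) (simp_all add: c_def[symmetric] r)
    finally show ?thesis using r \<epsilon> by (simp add: ennreal_mult[symmetric])
  qed
  ultimately show ?thesis by blast
qed

definition mollify :: "(real \<Rightarrow> real) \<Rightarrow> (real \<Rightarrow> real) \<Rightarrow> real \<Rightarrow> real" where
  "mollify f \<eta> x = (\<integral>t. f t * \<eta> (x - t) \<partial>lborel)"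

lemma deriv_family_bounded:
  assumes \<eta>: "deriv_family \<eta>" and supp: "\<forall>n s. \<epsilon> < \<bar>s\<bar> \<longrightarrow> \<eta> n s = 0"
  shows "\<exists>B. \<forall>s. \<bar>\<eta> n s\<bar> \<le> B"
proof -
  have "compact (\<eta> n ` {- \<epsilon>..\<epsilon>})"
    by (intro compact_continuous_image continuous_on_subset[OF deriv_family_continuous[OF \<eta>]]) auto
  then obtain B where B: "\<forall>s\<in>{- \<epsilon>..\<epsilon>}. \<bar>\<eta> n s\<bar> \<le> B"
    using compact_imp_bounded[of "\<eta> n ` {- \<epsilon>..\<epsilon>}"] unfolding bounded_iff by fastforce
  have "\<bar>\<eta> n s\<bar> \<le> max B 0" for s
  proof (cases "\<epsilon> < \<bar>s\<bar>")
    case False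
    then have "s \<in> {- \<epsilon>..\<epsilon>}" by auto
    then show ?thesis using B by (auto simp: le_max_iff_disj)
  qed (use supp in auto)
  then show ?thesis by blast
qed

lemma integrable_mollify:
  assumes f: "integrable lborel f" and \<eta>: "deriv_family \<eta>" and supp: "\<forall>n s. \<epsilon> < \<bar>s\<bar> \<longrightarrow> \<eta> n s = 0"
  shows "integrable lborel (\<lambda>t. f t * \<eta> n (x - t))"
proof -
  obtain B where B: "\<And>s. \<bar>\<eta> n s\<bar> \<le> B" using deriv_family_bounded[OF \<eta> supp] by blast
  note [measurable] = deriv_family_measurable[OF \<eta>] borel_measurable_integrable[OF f]
  show ?thesis
  proof (rule Bochner_Integration.integrable_bound)
    show "integrable lborel (\<lambda>t. B * f t)" using f by simp
    show "AE t in lborel. norm (f t * \<eta> n (x - t)) \<le> norm (B * f t)"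
    proof (intro AE_I2)
      fix t
      have "\<bar>f t\<bar> * \<bar>\<eta> n (x - t)\<bar> \<le> \<bar>f t\<bar> * \<bar>B\<bar>"
        using B[of "x - t"] by (intro mult_left_mono) auto
      then show "norm (f t * \<eta> n (x - t)) \<le> norm (B * f t)" by (simp add: abs_mult mult.commute)
    qed
  qed measurable
qed

text \<open>Differentiation under the integral sign: by the mean value theorem the difference quotients of \<open>\<eta> n\<close>
  converge uniformly, at a rate given by the bound on \<open>\<eta> (n + 2)\<close>.\<close>

lemma deriv_family_mollify:
  assumes f: "integrable lborel f" and \<eta>: "deriv_family \<eta>" and supp: "\<forall>n s. \<epsilon> < \<bar>s\<bar> \<longrightarrow> \<eta> n s = 0"
  shows "deriv_family (\<lambda>n. mollify f (\<eta> n))"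
  unfolding deriv_family_def
proof (intro allI)
  fix n x
  obtain B where B: "\<And>s. \<bar>\<eta> (Suc (Suc n)) s\<bar> \<le> B" using deriv_family_bounded[OF \<eta> supp] by blast
  have B0: "0 \<le> B" using B[of 0] by linarith
  note int = integrable_mollify[OF f \<eta> supp]
  have lip: "\<bar>\<eta> (Suc n) b - \<eta> (Suc n) a\<bar> \<le> B * \<bar>b - a\<bar>" for a b
    using field_differentiable_bound[of UNIV "\<eta> (Suc n)" "\<eta> (Suc (Suc n))" B b a]
      deriv_familyD[OF \<eta>] B by auto
  have taylor: "\<bar>\<eta> n b - \<eta> n a - (b - a) * \<eta> (Suc n) a\<bar> \<le> B * (b - a)\<^sup>2" for a b
  proof -
    have "\<bar>(\<eta> n b - b * \<eta> (Suc n) a) - (\<eta> n a - a * \<eta> (Suc n) a)\<bar> \<le> (B * \<bar>b - a\<bar>) * \<bar>b - a\<bar>"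
    proof -
      have "((\<lambda>s. \<eta> n s - s * \<eta> (Suc n) a) has_real_derivative \<eta> (Suc n) s - \<eta> (Suc n) a) (at s within closed_segment a b)" for s
        by (rule has_field_derivative_at_within) (auto intro!: derivative_eq_intros deriv_familyD[OF \<eta>])
      moreover have "\<bar>\<eta> (Suc n) s - \<eta> (Suc n) a\<bar> \<le> B * \<bar>b - a\<bar>" if "s \<in> closed_segment a b" for s
      proof -
        have "\<bar>s - a\<bar> \<le> \<bar>b - a\<bar>" using that by (auto simp: closed_segment_eq_real_ivl split: if_splits)
        then show ?thesis using lip[of s a] B0 mult_left_mono[of "\<bar>s - a\<bar>" "\<bar>b - a\<bar>" B] by linarith
      qed
      ultimately show ?thesis
        using field_differentiable_bound[of "closed_segment a b" "\<lambda>s. \<eta> n s - s * \<eta> (Suc n) a"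
            "\<lambda>s. \<eta> (Suc n) s - \<eta> (Suc n) a" "B * \<bar>b - a\<bar>" b a] by auto
    qed
    moreover have "(\<eta> n b - b * \<eta> (Suc n) a) - (\<eta> n a - a * \<eta> (Suc n) a) = \<eta> n b - \<eta> n a - (b - a) * \<eta> (Suc n) a"
      by (simp add: algebra_simps)
    ultimately show ?thesis by (simp add: power2_eq_square abs_mult_self_eq mult.assoc)
  qed
  define F where "F y = mollify f (\<eta> n) y - mollify f (\<eta> n) x - (y - x) * mollify f (\<eta> (Suc n)) x" for y
  have "\<bar>F y\<bar> \<le> (B * (\<integral>t. \<bar>f t\<bar> \<partial>lborel)) * (y - x)\<^sup>2" for y
  proof -
    have "F y = (\<integral>t. f t * (\<eta> n (y - t) - \<eta> n (x - t) - (y - x) * \<eta> (Suc n) (x - t)) \<partial>lborel)"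
      unfolding F_def mollify_def
      by (subst Bochner_Integration.integral_mult_right_zero[symmetric],
          subst Bochner_Integration.integral_diff[symmetric], rule int, rule int,
          subst Bochner_Integration.integral_diff[symmetric])
        (auto intro!: int Bochner_Integration.integrable_diff Bochner_Integration.integrable_mult_right
           Bochner_Integration.integral_cong simp: algebra_simps)
    also have "\<bar>\<dots>\<bar> \<le> (\<integral>t. \<bar>f t\<bar> * (B * (y - x)\<^sup>2) \<partial>lborel)"
    proof -
      have "norm (\<integral>t. f t * (\<eta> n (y - t) - \<eta> n (x - t) - (y - x) * \<eta> (Suc n) (x - t)) \<partial>lborel)
          \<le> (\<integral>t. \<bar>f t\<bar> * (B * (y - x)\<^sup>2) \<partial>lborel)"
      proof (rule Bochner_Integration.integral_norm_bound_integral)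
        show "norm (f t * (\<eta> n (y - t) - \<eta> n (x - t) - (y - x) * \<eta> (Suc n) (x - t))) \<le> \<bar>f t\<bar> * (B * (y - x)\<^sup>2)" for t
          using taylor[of "y - t" "x - t"] by (auto simp: abs_mult intro!: mult_left_mono)
        show "integrable lborel (\<lambda>t. \<bar>f t\<bar> * (B * (y - x)\<^sup>2))" using f by auto
        have "integrable lborel (\<lambda>t. f t * \<eta> n (y - t) - f t * \<eta> n (x - t) - (y - x) * (f t * \<eta> (Suc n) (x - t)))"
          by (intro Bochner_Integration.integrable_diff int Bochner_Integration.integrable_mult_right)
        then show "integrable lborel (\<lambda>t. f t * (\<eta> n (y - t) - \<eta> n (x - t) - (y - x) * \<eta> (Suc n) (x - t)))"
          by (simp add: algebra_simps)
      qed
      then show ?thesis by simp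
    qed
    finally show ?thesis by (simp add: mult_ac)
  qed
  then have "(F has_real_derivative 0) (at x)"
    by (intro has_real_derivative_zero_of_quadratic_bound[where C = "B * (\<integral>t. \<bar>f t\<bar> \<partial>lborel)"]) (simp_all add: F_def)
  then have "((\<lambda>y. F y + mollify f (\<eta> n) x + (y - x) * mollify f (\<eta> (Suc n)) x) has_real_derivative mollify f (\<eta> (Suc n)) x) (at x)"
    by (auto intro!: derivative_eq_intros)
  then show "(mollify f (\<eta> n) has_real_derivative mollify f (\<eta> (Suc n)) x) (at x)"
    by (simp add: F_def)
qed

lemma mollify_eq_0:
  assumes f: "AE t in lborel. K < \<bar>t\<bar> \<longrightarrow> f t = 0" and supp: "\<forall>s. \<epsilon> < \<bar>s\<bar> \<longrightarrow> \<eta> s = 0" and x: "K + \<epsilon> < \<bar>x\<bar>"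
  shows "mollify f \<eta> x = 0"
  unfolding mollify_def
proof (rule integral_eq_zero_AE)
  show "AE t in lborel. f t * \<eta> (x - t) = 0"
    using f
  proof eventually_elim
    case (elim t)
    have "\<epsilon> < \<bar>x - t\<bar>" if "\<bar>t\<bar> \<le> K" using x that by linarith
    then show ?case using elim supp by (cases "K < \<bar>t\<bar>") auto
  qed
qed

text \<open>Young's inequality: the mollifier is a probability density.\<close>

lemma nn_integral_mollify_le:
  assumes f: "integrable lborel f" and \<eta>: "deriv_family \<eta>" and supp: "\<forall>n s. \<epsilon> < \<bar>s\<bar> \<longrightarrow> \<eta> n s = 0"
    and nonneg: "\<forall>s. 0 \<le> \<eta> 0 s" and mass: "(\<integral>\<^sup>+s. ennreal (\<eta> 0 s) \<partial>lborel) = 1"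
  shows "(\<integral>\<^sup>+x. ennreal \<bar>mollify f (\<eta> 0) x\<bar> \<partial>lborel) \<le> ennreal (L1_norm f)"
proof -
  note [measurable] = deriv_family_measurable[OF \<eta>, of 0] borel_measurable_integrable[OF f]
  have "(\<integral>\<^sup>+x. ennreal \<bar>mollify f (\<eta> 0) x\<bar> \<partial>lborel) \<le> (\<integral>\<^sup>+x. (\<integral>\<^sup>+t. ennreal \<bar>f t\<bar> * ennreal (\<eta> 0 (x - t)) \<partial>lborel) \<partial>lborel)"
  proof (intro nn_integral_mono)
    fix x
    have "ennreal (norm (mollify f (\<eta> 0) x)) \<le> (\<integral>\<^sup>+t. ennreal (norm (f t * \<eta> 0 (x - t))) \<partial>lborel)"
      unfolding mollify_def by (rule integral_norm_bound_ennreal[OF integrable_mollify[OF f \<eta> supp]])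
    also have "\<dots> = (\<integral>\<^sup>+t. ennreal \<bar>f t\<bar> * ennreal (\<eta> 0 (x - t)) \<partial>lborel)"
      using nonneg by (intro nn_integral_cong) (simp add: abs_mult ennreal_mult)
    finally show "ennreal \<bar>mollify f (\<eta> 0) x\<bar> \<le> (\<integral>\<^sup>+t. ennreal \<bar>f t\<bar> * ennreal (\<eta> 0 (x - t)) \<partial>lborel)" by simp
  qed
  also have "\<dots> = (\<integral>\<^sup>+t. (\<integral>\<^sup>+x. ennreal \<bar>f t\<bar> * ennreal (\<eta> 0 (x - t)) \<partial>lborel) \<partial>lborel)"
    by (rule lborel_pair.Fubini') measurable
  also have "\<dots> = (\<integral>\<^sup>+t. ennreal \<bar>f t\<bar> * (\<integral>\<^sup>+x. ennreal (\<eta> 0 x) \<partial>lborel) \<partial>lborel)"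
  proof (rule nn_integral_cong)
    fix t
    have "(\<integral>\<^sup>+x. ennreal (\<eta> 0 (x - t)) \<partial>lborel) = (\<integral>\<^sup>+x. ennreal (\<eta> 0 x) \<partial>lborel)"
      using nn_integral_real_affine[of "\<lambda>x. ennreal (\<eta> 0 x)" 1 "- t"] by (simp add: add.commute)
    then show "(\<integral>\<^sup>+x. ennreal \<bar>f t\<bar> * ennreal (\<eta> 0 (x - t)) \<partial>lborel) = ennreal \<bar>f t\<bar> * (\<integral>\<^sup>+x. ennreal (\<eta> 0 x) \<partial>lborel)"
      by (subst nn_integral_cmult) auto
  qed
  also have "\<dots> = ennreal (L1_norm f)"
    unfolding mass L1_norm_def using f by (simp add: nn_integral_eq_integral)
  finally show ?thesis .
qed

text \<open>The weak derivative, tested against \<open>t \<mapsto> \<eta> n (x - t)\<close>, moves a derivative from the mollifier to the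
  function.\<close>

lemma mollify_weak_derivative:
  assumes weak: "has_weak_derivative f g" and \<eta>: "deriv_family \<eta>" and supp: "\<forall>n s. \<epsilon> < \<bar>s\<bar> \<longrightarrow> \<eta> n s = 0"
  shows "mollify f (\<eta> (Suc n)) x = mollify g (\<eta> n) x"
proof -
  define h where "h k t = (- 1) ^ k * \<eta> (n + k) (x - t)" for k t
  have h: "(h k has_real_derivative h (Suc k) t) (at t)" for k t
  proof -
    have "((\<lambda>t. \<eta> (n + k) (x - t)) has_real_derivative \<eta> (Suc (n + k)) (x - t) * - 1) (at t)"
      by (rule DERIV_chain2[OF deriv_familyD[OF \<eta>]]) (auto intro!: derivative_eq_intros)
    from DERIV_cmult[OF this, of "(- 1) ^ k"] show ?thesis by (simp add: h_def[abs_def])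
  qed
  have iter: "(deriv ^^ k) (h 0) = h k" for k
  proof (induction k)
    case (Suc k)
    have "deriv (h k) = h (Suc k)" by (rule ext) (rule DERIV_imp_deriv[OF h])
    then show ?case by (simp add: Suc.IH)
  qed simp
  have "h 0 \<in> test_functions"
    unfolding test_functions_def
  proof (intro CollectI conjI allI)
    show "(deriv ^^ k) (h 0) field_differentiable at t" for k t
      unfolding iter field_differentiable_def using h by blast
    have "{t. h 0 t \<noteq> 0} \<subseteq> cball x \<epsilon>"
      using supp by (auto simp: h_def dist_real_def not_less[symmetric])
    then have "bounded {t. h 0 t \<noteq> 0}" by (rule bounded_subset[OF bounded_cball])
    then show "compact (closure {t. h 0 t \<noteq> 0})" by (simp add: compact_closure)
  qed
  then have "(\<integral>t. f t * deriv (h 0) t \<partial>lborel) = - (\<integral>t. g t * h 0 t \<partial>lborel)"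
    using weak unfolding has_weak_derivative_def by blast
  moreover have "deriv (h 0) = h 1" using iter[of 1] by simp
  ultimately show ?thesis by (simp add: h_def mollify_def)
qed

text \<open>The complement of the support is a union of open null sets; by Lindelof's theorem countably many suffice, so it
  is a null set itself.\<close>

lemma density_vanishes_outside_bounded_set:
  assumes \<mu>: "\<mu> = density lborel (\<lambda>t. ennreal (\<rho> t))" and comp: "compact (measure_support \<mu>)"
    and nonneg: "AE t in lborel. 0 \<le> \<rho> t" and \<rho>[measurable]: "\<rho> \<in> borel_measurable borel"
  shows "\<exists>K. AE t in lborel. K < \<bar>t\<bar> \<longrightarrow> \<rho> t = 0"
proof -
  define \<U> where "\<U> = {U. open U \<and> emeasure \<mu> U = 0}"
  obtain \<U>' where \<U>': "\<U>' \<subseteq> \<U>" "countable \<U>'" "\<Union>\<U>' = \<Union>\<U>"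
    using Lindelof[of \<U>] by (auto simp: \<U>_def)
  have "(\<Union>U\<in>\<U>'. U) \<in> null_sets \<mu>"
    using \<U>' by (intro null_sets_UN') (auto simp: \<U>_def null_sets_def \<mu>)
  then have null: "\<Union>\<U> \<in> null_sets \<mu>" using \<U>'(3) by simp
  obtain K where K: "\<And>t. t \<in> measure_support \<mu> \<Longrightarrow> \<bar>t\<bar> \<le> K"
    using compact_imp_bounded[OF comp] by (auto simp: bounded_iff)
  have "{t. K < \<bar>t\<bar>} \<subseteq> \<Union>\<U>"
  proof
    fix t assume "t \<in> {t. K < \<bar>t\<bar>}"
    then have "t \<notin> measure_support \<mu>" using K[of t] by auto
    then show "t \<in> \<Union>\<U>" by (auto simp: measure_support_def \<U>_def)
  qed
  then have "{t. K < \<bar>t\<bar>} \<in> null_sets \<mu>"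
    by (rule null_sets_subset[OF null, rotated]) (simp add: \<mu>)
  then have "AE t in lborel. t \<in> {t. K < \<bar>t\<bar>} \<longrightarrow> ennreal (\<rho> t) = 0"
    unfolding \<mu> by (subst (asm) null_sets_density_iff) auto
  with nonneg have "AE t in lborel. K < \<bar>t\<bar> \<longrightarrow> \<rho> t = 0"
    by eventually_elim (auto simp: ennreal_eq_0_iff)
  then show ?thesis by blast
qed

text \<open>Smoothing the density amounts to adding independent small noise to every coordinate, which changes a
  uniformly continuous \<open>F\<close> by little.\<close>

lemma nn_integral_noise_le:
  fixes F :: "('i \<Rightarrow> real) \<Rightarrow> ennreal" and r g :: "real \<Rightarrow> ennreal"
  assumes I: "finite I" and F[measurable]: "F \<in> borel_measurable (lborel_on I)"
    and r[measurable]: "r \<in> borel_measurable borel" and r1: "(\<integral>\<^sup>+t. r t \<partial>lborel) = 1"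
    and g[measurable]: "g \<in> borel_measurable borel" and g1: "(\<integral>\<^sup>+t. g t \<partial>lborel) = 1"
    and supp: "\<And>s. \<epsilon> < \<bar>s\<bar> \<Longrightarrow> g s = 0"
    and F_le: "\<And>\<omega> y. y \<in> space (lborel_on I) \<Longrightarrow> (\<And>i. i \<in> I \<Longrightarrow> \<bar>\<omega> i\<bar> \<le> \<epsilon>) \<Longrightarrow> F y \<le> F (\<lambda>i\<in>I. \<omega> i + y i) + \<delta>"
  shows "(\<integral>\<^sup>+y. F y * (\<Prod>i\<in>I. r (y i)) \<partial>lborel_on I)
    \<le> (\<integral>\<^sup>+\<omega>. F \<omega> * (\<Prod>i\<in>I. \<integral>\<^sup>+t. r t * g (\<omega> i - t) \<partial>lborel) \<partial>lborel_on I) + \<delta>"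
proof -
  interpret L: product_sigma_finite "\<lambda>_. lborel :: real measure" by (rule product_sigma_finite_lborel)
  interpret PL: sigma_finite_measure "lborel_on I" by (rule L.sigma_finite[OF I])
  interpret P: pair_sigma_finite "lborel_on I" "lborel_on I" by unfold_locales
  have mass_r: "(\<integral>\<^sup>+y. (\<Prod>i\<in>I. r (y i)) \<partial>lborel_on I) = 1"
    by (subst L.product_nn_integral_prod[OF I]) (simp_all add: r1)
  have mass_g: "(\<integral>\<^sup>+y. (\<Prod>i\<in>I. g (y i)) \<partial>lborel_on I) = 1"
    by (subst L.product_nn_integral_prod[OF I]) (simp_all add: g1)
  have sh[measurable]: "(\<lambda>\<omega>. \<lambda>i\<in>I. \<omega> i + y i) \<in> lborel_on I \<rightarrow>\<^sub>M lborel_on I" for y by measurable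
  have sh2[measurable]: "(\<lambda>(y, \<omega>). \<lambda>i\<in>I. \<omega> i + y i) \<in> lborel_on I \<Otimes>\<^sub>M lborel_on I \<rightarrow>\<^sub>M lborel_on I" by measurable
  have pointwise: "F y \<le> (\<integral>\<^sup>+\<omega>. F (\<lambda>i\<in>I. \<omega> i + y i) * (\<Prod>i\<in>I. g (\<omega> i)) \<partial>lborel_on I) + \<delta>"
    if y: "y \<in> space (lborel_on I)" for y
  proof -
    have "F y = (\<integral>\<^sup>+\<omega>. F y * (\<Prod>i\<in>I. g (\<omega> i)) \<partial>lborel_on I)"
      by (subst nn_integral_cmult) (simp_all add: mass_g)
    also have "\<dots> \<le> (\<integral>\<^sup>+\<omega>. F (\<lambda>i\<in>I. \<omega> i + y i) * (\<Prod>i\<in>I. g (\<omega> i)) + \<delta> * (\<Prod>i\<in>I. g (\<omega> i)) \<partial>lborel_on I)"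
    proof (rule nn_integral_mono)
      fix \<omega>
      show "F y * (\<Prod>i\<in>I. g (\<omega> i)) \<le> F (\<lambda>i\<in>I. \<omega> i + y i) * (\<Prod>i\<in>I. g (\<omega> i)) + \<delta> * (\<Prod>i\<in>I. g (\<omega> i))"
      proof (cases "\<forall>i\<in>I. \<bar>\<omega> i\<bar> \<le> \<epsilon>")
        case True
        then show ?thesis
          unfolding distrib_right[symmetric] using y by (intro mult_right_mono F_le) auto
      next
        case False
        then have zero: "(\<Prod>i\<in>I. g (\<omega> i)) = 0" using supp by (intro prod_zero[OF I]) (auto simp: not_le)
        show ?thesis unfolding zero by simp
      qed
    qed
    also have "\<dots> = (\<integral>\<^sup>+\<omega>. F (\<lambda>i\<in>I. \<omega> i + y i) * (\<Prod>i\<in>I. g (\<omega> i)) \<partial>lborel_on I) + \<delta>"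
      by (subst nn_integral_add) (simp_all add: nn_integral_cmult mass_g)
    finally show ?thesis .
  qed
  have "(\<integral>\<^sup>+y. F y * (\<Prod>i\<in>I. r (y i)) \<partial>lborel_on I)
      \<le> (\<integral>\<^sup>+y. (\<integral>\<^sup>+\<omega>. F (\<lambda>i\<in>I. \<omega> i + y i) * (\<Prod>i\<in>I. g (\<omega> i)) \<partial>lborel_on I) * (\<Prod>i\<in>I. r (y i)) + \<delta> * (\<Prod>i\<in>I. r (y i)) \<partial>lborel_on I)"
    unfolding distrib_right[symmetric] by (intro nn_integral_mono mult_right_mono pointwise) auto
  also have "\<dots> = (\<integral>\<^sup>+y. (\<integral>\<^sup>+\<omega>. F (\<lambda>i\<in>I. \<omega> i + y i) * (\<Prod>i\<in>I. g (\<omega> i)) \<partial>lborel_on I) * (\<Prod>i\<in>I. r (y i)) \<partial>lborel_on I) + \<delta>"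
    by (subst nn_integral_add) (simp_all add: nn_integral_cmult mass_r)
  also have "(\<integral>\<^sup>+y. (\<integral>\<^sup>+\<omega>. F (\<lambda>i\<in>I. \<omega> i + y i) * (\<Prod>i\<in>I. g (\<omega> i)) \<partial>lborel_on I) * (\<Prod>i\<in>I. r (y i)) \<partial>lborel_on I)
      = (\<integral>\<^sup>+y. (\<integral>\<^sup>+\<omega>. F \<omega> * (\<Prod>i\<in>I. r (y i) * g (\<omega> i - y i)) \<partial>lborel_on I) \<partial>lborel_on I)"
  proof (rule nn_integral_cong)
    fix y
    have "(\<integral>\<^sup>+\<omega>. F (\<lambda>i\<in>I. \<omega> i + y i) * (\<Prod>i\<in>I. g (\<omega> i)) \<partial>lborel_on I)
        = (\<integral>\<^sup>+\<omega>. F (\<lambda>i\<in>I. \<omega> i + y i) * (\<Prod>i\<in>I. g ((\<lambda>i\<in>I. \<omega> i + y i) i - y i)) \<partial>lborel_on I)"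
      by (intro nn_integral_cong arg_cong2[where f = "(*)"] refl prod.cong) simp_all
    also have "\<dots> = (\<integral>\<^sup>+\<omega>. F \<omega> * (\<Prod>i\<in>I. g (\<omega> i - y i)) \<partial>lborel_on I)"
      by (rule nn_integral_shift[OF I]) measurable
    finally have "(\<integral>\<^sup>+\<omega>. F (\<lambda>i\<in>I. \<omega> i + y i) * (\<Prod>i\<in>I. g (\<omega> i)) \<partial>lborel_on I) * (\<Prod>i\<in>I. r (y i))
        = (\<integral>\<^sup>+\<omega>. F \<omega> * (\<Prod>i\<in>I. g (\<omega> i - y i)) * (\<Prod>i\<in>I. r (y i)) \<partial>lborel_on I)"
      by (simp add: nn_integral_multc)
    then show "(\<integral>\<^sup>+\<omega>. F (\<lambda>i\<in>I. \<omega> i + y i) * (\<Prod>i\<in>I. g (\<omega> i)) \<partial>lborel_on I) * (\<Prod>i\<in>I. r (y i))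
        = (\<integral>\<^sup>+\<omega>. F \<omega> * (\<Prod>i\<in>I. r (y i) * g (\<omega> i - y i)) \<partial>lborel_on I)"
      by (simp add: prod.distrib mult_ac)
  qed
  also have "\<dots> = (\<integral>\<^sup>+\<omega>. (\<integral>\<^sup>+y. F \<omega> * (\<Prod>i\<in>I. r (y i) * g (\<omega> i - y i)) \<partial>lborel_on I) \<partial>lborel_on I)"
    by (rule P.Fubini') measurable
  also have "\<dots> = (\<integral>\<^sup>+\<omega>. F \<omega> * (\<Prod>i\<in>I. \<integral>\<^sup>+t. r t * g (\<omega> i - t) \<partial>lborel) \<partial>lborel_on I)"
  proof (rule nn_integral_cong)
    fix \<omega>
    have "(\<integral>\<^sup>+y. (\<Prod>i\<in>I. r (y i) * g (\<omega> i - y i)) \<partial>lborel_on I) = (\<Prod>i\<in>I. \<integral>\<^sup>+t. r t * g (\<omega> i - t) \<partial>lborel)"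
      by (rule L.product_nn_integral_prod[OF I, of "\<lambda>i t. r t * g (\<omega> i - t)"]) measurable
    then show "(\<integral>\<^sup>+y. F \<omega> * (\<Prod>i\<in>I. r (y i) * g (\<omega> i - y i)) \<partial>lborel_on I)
        = F \<omega> * (\<Prod>i\<in>I. \<integral>\<^sup>+t. r t * g (\<omega> i - t) \<partial>lborel)"
      by (subst nn_integral_cmult) simp_all
  qed
  finally show ?thesis .
qed

section \<open>The discrete alloy-type model\<close>

lemma im_det_cong:
  assumes "\<And>k. k \<in> \<Lambda> \<Longrightarrow> v k = v' k"
  shows "im_det h \<Lambda> z x y v = im_det h \<Lambda> z x y v'"
proof -
  have "shifted_op (\<lambda>j k. h j k + (if j = k then v j else 0)) \<Lambda> z
      = shifted_op (\<lambda>j k. h j k + (if j = k then v' j else 0)) \<Lambda> z"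
    using assms by (auto simp: shifted_op_def fun_eq_iff intro!: sum.cong)
  then show ?thesis by (simp add: im_det_def potential_green_def finite_green_def)
qed

text \<open>By the Lipschitz estimate the determinant is continuous in the product topology, whose Borel sets are the product
  \<open>\<sigma>\<close>-algebra since the index set is countable.\<close>

lemma borel_measurable_im_det:
  fixes W :: "'b \<Rightarrow> ('a :: countable \<Rightarrow> real)"
  assumes sym: "\<forall>j k. h j k = h k j" and fin: "finite \<Lambda>" and z: "Im z > 0" and x: "x \<in> \<Lambda>" and y: "y \<in> \<Lambda>"
    and W: "\<And>k. k \<in> \<Lambda> \<Longrightarrow> (\<lambda>p. W p k) \<in> borel_measurable M"
  shows "(\<lambda>p. im_det h \<Lambda> z x y (W p)) \<in> borel_measurable M"
proof -
  let ?\<Phi> = "im_det h \<Lambda> z x y"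
  have "continuous_on UNIV ?\<Phi>"
    unfolding continuous_on_def
  proof
    fix v
    have "((\<lambda>v'. 4 / (Im z) ^ 3 * (\<Sum>k\<in>\<Lambda>. \<bar>v' k - v k\<bar>)) \<longlongrightarrow> 4 / (Im z) ^ 3 * (\<Sum>k\<in>\<Lambda>. \<bar>v k - v k\<bar>)) (at v within UNIV)"
      by (intro tendsto_intros continuous_on_product_coordinates[unfolded continuous_on_def, rule_format]) simp
    then have "((\<lambda>v'. 4 / (Im z) ^ 3 * (\<Sum>k\<in>\<Lambda>. \<bar>v' k - v k\<bar>)) \<longlongrightarrow> 0) (at v within UNIV)" by simp
    then have "((\<lambda>v'. ?\<Phi> v' - ?\<Phi> v) \<longlongrightarrow> 0) (at v within UNIV)"
      by (rule Lim_null_comparison[rotated])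
        (use im_det_lipschitz[OF sym fin z x y] in \<open>auto intro!: always_eventually\<close>)
    then show "(?\<Phi> \<longlongrightarrow> ?\<Phi> v) (at v within UNIV)" by (rule LIM_zero_cancel)
  qed
  then have "?\<Phi> \<in> borel_measurable borel" by (rule borel_measurable_continuous_onI)
  moreover have "sets (borel :: ('a \<Rightarrow> real) measure) = sets (Pi\<^sub>M UNIV (\<lambda>_. borel))"
    by (simp add: sets_PiM_equal_borel)
  ultimately have "?\<Phi> \<in> borel_measurable (Pi\<^sub>M UNIV (\<lambda>_. borel))"
    using measurable_cong_sets by blast
  moreover have "(\<lambda>p k. if k \<in> \<Lambda> then W p k else 0) \<in> M \<rightarrow>\<^sub>M Pi\<^sub>M UNIV (\<lambda>_. borel)"
  proof (rule measurable_PiM_single')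
    fix k show "(\<lambda>p. if k \<in> \<Lambda> then W p k else 0) \<in> borel_measurable M"
      using W by (cases "k \<in> \<Lambda>") auto
  qed simp
  ultimately have "(\<lambda>p. ?\<Phi> (\<lambda>k. if k \<in> \<Lambda> then W p k else 0)) \<in> borel_measurable M"
    by (rule measurable_compose[rotated])
  moreover have "?\<Phi> (\<lambda>k. if k \<in> \<Lambda> then W p k else 0) = ?\<Phi> (W p)" for p
    by (intro im_det_cong) auto
  ultimately show ?thesis by simp
qed

lemma nn_integral_im_det_two_sites_scaled_le:
  fixes v :: "'a :: countable \<Rightarrow> real"
  assumes sym: "\<forall>j k. h j k = h k j" and fin: "finite \<Lambda>" and z: "Im z > 0" and x: "x \<in> \<Lambda>" and y: "y \<in> \<Lambda>"
    and "x \<noteq> y" and lam: "lam > 0"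
  shows "(\<integral>\<^sup>+t. (\<integral>\<^sup>+s. ennreal (im_det h \<Lambda> z x y
      (\<lambda>k. lam * (v k + (if k = y then t else 0) + (if k = x then s else 0)))) \<partial>lborel) \<partial>lborel)
    \<le> ennreal ((pi / lam)\<^sup>2)"
proof -
  define J where "J t s = ennreal (im_det h \<Lambda> z x y
      (\<lambda>k. lam * v k + (if k = x then s else 0) + (if k = y then t else 0)))" for t s
  have J[measurable]: "(\<lambda>(t, s). J t s) \<in> borel_measurable (borel \<Otimes>\<^sub>M borel)"
  proof -
    have "(\<lambda>p. im_det h \<Lambda> z x y (\<lambda>k. lam * v k + (if k = x then snd p else 0) + (if k = y then fst p else 0)))
        \<in> borel_measurable (borel \<Otimes>\<^sub>M borel)"
      by (intro borel_measurable_im_det[OF sym fin z x y]) measurable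
    then show ?thesis by (simp add: J_def case_prod_beta)
  qed
  have eq: "(\<lambda>k. lam * (v k + (if k = y then t else 0) + (if k = x then s else 0)))
      = (\<lambda>k. lam * v k + (if k = x then lam * s else 0) + (if k = y then lam * t else 0))" for s t
    by (auto simp: algebra_simps)
  let ?A = "\<integral>\<^sup>+t. (\<integral>\<^sup>+s. J (lam * t) (lam * s) \<partial>lborel) \<partial>lborel"
  have "ennreal lam * (ennreal lam * ?A) = ennreal lam * (\<integral>\<^sup>+t. (\<integral>\<^sup>+s. J t (lam * s) \<partial>lborel) \<partial>lborel)"
    using lam nn_integral_real_affine[of "\<lambda>t. \<integral>\<^sup>+s. J t (lam * s) \<partial>lborel" lam 0] by simp
  also have "\<dots> = (\<integral>\<^sup>+t. ennreal lam * (\<integral>\<^sup>+s. J t (lam * s) \<partial>lborel) \<partial>lborel)"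
    by (rule nn_integral_cmult[symmetric]) measurable
  also have "\<dots> = (\<integral>\<^sup>+t. (\<integral>\<^sup>+s. J t s \<partial>lborel) \<partial>lborel)"
  proof (rule nn_integral_cong)
    fix t
    show "ennreal lam * (\<integral>\<^sup>+s. J t (lam * s) \<partial>lborel) = (\<integral>\<^sup>+s. J t s \<partial>lborel)"
      using lam nn_integral_real_affine[of "J t" lam 0] by simp
  qed
  also have "\<dots> \<le> ennreal (pi\<^sup>2)"
    unfolding J_def by (rule nn_integral_im_det_two_sites_le[OF sym fin z x y \<open>x \<noteq> y\<close>])
  finally have le: "ennreal lam * (ennreal lam * ?A) \<le> ennreal (pi\<^sup>2)" .
  have "ennreal (1 / lam\<^sup>2) * (ennreal lam * ennreal lam) = 1"
    using lam by (simp add: ennreal_mult[symmetric] power2_eq_square)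
  then have "?A = ennreal (1 / lam\<^sup>2) * (ennreal lam * (ennreal lam * ?A))"
    by (simp add: mult.assoc[symmetric])
  also have "\<dots> \<le> ennreal (1 / lam\<^sup>2) * ennreal (pi\<^sup>2)" by (intro mult_left_mono le) auto
  also have "\<dots> = ennreal ((pi / lam)\<^sup>2)" using lam by (simp add: ennreal_mult[symmetric] power_divide)
  finally show ?thesis unfolding eq J_def[symmetric] .
qed

text \<open>The matrix of \<open>-\<Delta>\<close>.\<close>

definition hopping :: "int ^ 'd::finite \<Rightarrow> int ^ 'd \<Rightarrow> real" where
  "hopping j k = (if lattice_norm1 (k - j) = 1 then -1 else 0)"

lemma hopping_sym: "\<forall>j k. hopping j k = hopping k j"
  by (auto simp: hopping_def lattice_norm1_def abs_minus_commute)

lemma l2_inner_delta: "l2_inner (delta x) f = f x"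
proof -
  have "l2_inner (delta x) f = (\<Sum>\<^sub>\<infinity>k\<in>{x}. cnj (delta x k) * f k)"
    unfolding l2_inner_def by (intro infsum_cong_neutral) (auto simp: delta_def)
  then show ?thesis by (simp add: delta_def)
qed

lemma finite_neighbours: "finite {w :: int ^ 'd::finite. lattice_norm1 (w - x) = 1}"
proof -
  have "{w. lattice_norm1 (w - x) = 1} \<subseteq> (\<lambda>k. k + x) ` {k :: int ^ 'd. \<forall>i. \<bar>k $ i\<bar> \<le> int 1}"
  proof
    fix w assume w: "w \<in> {w. lattice_norm1 (w - x) = 1}"
    have "\<bar>(w - x) $ i\<bar> \<le> lattice_norm1 (w - x)" for i
      unfolding lattice_norm1_def by (rule member_le_sum) auto
    then show "w \<in> (\<lambda>k. k + x) ` {k. \<forall>i. \<bar>k $ i\<bar> \<le> int 1}"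
      using w by (intro image_eqI[of _ _ "w - x"]) auto
  qed
  then show ?thesis by (rule finite_subset) (intro finite_imageI card_box)
qed

lemma hamiltonian_matrix_element:
  "l2_inner (delta x) (hamiltonian u lam \<omega> (delta y))
    = of_real (hopping x y + (if x = y then lam * alloy_potential u \<omega> x else 0))"
proof -
  have "laplacian (delta y) x = (\<Sum>w | lattice_norm1 (w - x) = 1. if w = y then 1 else 0)"
    by (simp add: laplacian_def delta_def)
  also have "\<dots> = (if lattice_norm1 (y - x) = 1 then 1 else 0)"
    using finite_neighbours[of x] by simp
  finally show ?thesis by (simp add: l2_inner_delta hamiltonian_def hopping_def delta_def)
qed

text \<open>The matrix elements of \<open>H\<^sub>\<omega>\<close> are those of \<open>-\<Delta>\<close> plus the diagonal \<open>\<lambda>V\<^sub>\<omega>\<close>, so the resolvent of the model is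
  literally an instance of the general construction.\<close>

lemma green_eq_potential_green:
  "green u lam \<omega> \<Lambda> z x y = potential_green hopping \<Lambda> z (\<lambda>k. lam * alloy_potential u \<omega> k) x y"
proof -
  have "(\<lambda>\<psi> x. hamiltonian_on u lam \<omega> \<Lambda> \<psi> x - z * \<psi> x)
      = shifted_op (\<lambda>j k. hopping j k + (if j = k then lam * alloy_potential u \<omega> j else 0)) \<Lambda> z"
    unfolding fun_eq_iff by (simp add: hamiltonian_on_def shifted_op_def hamiltonian_matrix_element)
  then show ?thesis
    by (simp add: green_def l2_inner_delta resolvent_on_def potential_green_def finite_green_def)
qed

lemma Re_det_green_matrix:
  assumes "finite \<Lambda>" "Im z > 0" "x \<in> \<Lambda>" "y \<in> \<Lambda>"
  shows "Re (det (matrix_Im (green_matrix u lam \<omega> \<Lambda> z x y)))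
    = im_det hopping \<Lambda> z x y (\<lambda>k. lam * alloy_potential u \<omega> k)"
proof -
  have Im: "(c - cnj c) / (2 * \<i>) = of_real (Im c)" for c :: complex
    by (simp add: complex_diff_cnj) (simp add: complex_eq_iff)
  show ?thesis
    using potential_green_sym[OF hopping_sym assms(1,2,4,3)]
    by (simp add: det_2 matrix_Im_def conj_transpose_def green_matrix_def Im green_eq_potential_green
        im_det_def power2_eq_square)
qed

lemma alloy_potential_eq_sum:
  assumes fin: "finite {k. u k \<noteq> 0}"
  shows "alloy_potential u \<omega> x = (\<Sum>m | u m \<noteq> 0. u m * \<omega> (x - m))"
proof -
  have *: "{k. u (x - k) \<noteq> 0} = (\<lambda>m. x - m) ` {m. u m \<noteq> 0}"
    by (auto intro!: image_eqI[of _ _ "x - _"])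
  have "alloy_potential u \<omega> x = (\<Sum>\<^sub>\<infinity>k\<in>{k. u (x - k) \<noteq> 0}. \<omega> k * u (x - k))"
    unfolding alloy_potential_def by (intro infsum_cong_neutral) auto
  also have "\<dots> = (\<Sum>k\<in>(\<lambda>m. x - m) ` {m. u m \<noteq> 0}. \<omega> k * u (x - k))"
    unfolding * using fin by simp
  also have "\<dots> = (\<Sum>m | u m \<noteq> 0. u m * \<omega> (x - m))"
    by (subst sum.reindex) (auto simp: inj_on_def mult.commute)
  finally show ?thesis .
qed

theorem theorem3p2:
  fixes u :: "int ^ 'd::finite \<Rightarrow> real"
    and \<mu> :: "real measure"
    and \<rho> \<rho>' \<rho>'' :: "real \<Rightarrow> real"
    and \<Lambda> :: "(int ^ 'd) set"
    and x y :: "int ^ 'd"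
    and z :: complex
    and lam :: real
  assumes "prob_space \<mu>" and "sets \<mu> = sets borel"
    and "compact (measure_support \<mu>)"
    and "AE t in lborel. 0 \<le> \<rho> t" and "\<mu> = density lborel (\<lambda>t. ennreal (\<rho> t))"
    and "sobolev_W21 \<rho> \<rho>' \<rho>''"
    and "finite {k. u k \<noteq> 0}"
    and "\<And>\<theta>. (\<forall>i. 0 \<le> \<theta> $ i \<and> \<theta> $ i < 2 * pi) \<Longrightarrow> symbol u \<theta> \<noteq> 0"
    and "finite \<Lambda>" and "x \<in> \<Lambda>" and "y \<in> \<Lambda>" and "x \<noteq> y"
    and "Im z > 0" and "lam > 0"
  shows "integrable (disorder_measure \<mu>)
           (\<lambda>\<omega>. Re (det (matrix_Im (green_matrix u lam \<omega> \<Lambda> z x y)))) \<and>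
         (\<integral>\<omega>. Re (det (matrix_Im (green_matrix u lam \<omega> \<Lambda> z x y))) \<partial>disorder_measure \<mu>)
           \<le> (pi / lam)\<^sup>2 * C_Min u \<rho>' \<rho>''"
proof -
  note fin_u = assms(7) and fin = assms(9) and x = assms(10) and y = assms(11) and xy = assms(12)
    and z = assms(13) and lam = assms(14) and \<mu> = assms(5)
  define S where "S = {m. u m \<noteq> 0}"
  have S: "finite S" using fin_u by (simp add: S_def)
  define V where "V \<omega> k = (\<Sum>m\<in>S. u m * \<omega> (k - m))" for \<omega> k
  have V: "alloy_potential u \<omega> = V \<omega>" for \<omega>
    by (rule ext) (simp add: alloy_potential_eq_sum[OF fin_u] V_def S_def)
  \<comment> \<open>The lattice sites \<open>i\<close> for which \<open>\<omega>\<^sub>i\<close> influences the potential on \<open>\<Lambda>\<close>.\<close>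
  define I where "I = (\<lambda>(k, m). k - m) ` (\<Lambda> \<times> S)"
  have I: "finite I" using fin S by (simp add: I_def)
  have in_I: "k - m \<in> I" if "k \<in> \<Lambda>" "m \<in> S" for k m using that by (force simp: I_def)
  define \<Phi> where "\<Phi> \<omega> = im_det hopping \<Lambda> z x y (\<lambda>k. lam * V \<omega> k)" for \<omega>
  have \<Phi>: "Re (det (matrix_Im (green_matrix u lam \<omega> \<Lambda> z x y))) = \<Phi> \<omega>" for \<omega>
    unfolding \<Phi>_def V[symmetric] by (rule Re_det_green_matrix[OF fin z x y])
  have \<Phi>_nonneg: "0 \<le> \<Phi> \<omega>" and \<Phi>_le: "\<Phi> \<omega> \<le> (1 / Im z)\<^sup>2" for \<omega>
    unfolding \<Phi>_def using im_det_nonneg(1)[OF hopping_sym fin z x y] im_det_le[OF hopping_sym fin z x y] by auto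
  have \<Phi>_cong: "\<Phi> \<omega> = \<Phi> \<omega>'" if "\<And>i. i \<in> I \<Longrightarrow> \<omega> i = \<omega>' i" for \<omega> \<omega>'
    unfolding \<Phi>_def V_def using that in_I by (intro im_det_cong) (auto intro!: sum.cong)
  have \<Phi>_meas: "\<Phi> \<in> borel_measurable M" if "\<And>i. i \<in> I \<Longrightarrow> (\<lambda>\<omega>. \<omega> i) \<in> borel_measurable M" for M
    unfolding \<Phi>_def[abs_def] V_def
    by (intro borel_measurable_im_det[OF hopping_sym fin z x y] borel_measurable_times borel_measurable_sum
        borel_measurable_const that in_I)
  have \<Phi>_I[measurable]: "\<Phi> \<in> borel_measurable (lborel_on I)"
    by (rule \<Phi>_meas) simp

  have \<rho>_int: "integrable lborel \<rho>" "integrable lborel \<rho>'" "integrable lborel \<rho>''"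
    and weak: "has_weak_derivative \<rho> \<rho>'" "has_weak_derivative \<rho>' \<rho>''"
    using assms(6) by (auto simp: sobolev_W21_def)
  have \<rho>[measurable]: "\<rho> \<in> borel_measurable borel" using \<rho>_int(1) by simp
  define r where "r = (\<lambda>t. ennreal (\<rho> t))"
  have r[measurable]: "r \<in> borel_measurable borel" unfolding r_def by measurable
  interpret \<mu>: prob_space \<mu> by (rule assms(1))
  have mass: "(\<integral>\<^sup>+t. r t \<partial>lborel) = 1"
    using \<mu>.emeasure_space_1 unfolding \<mu> r_def by (simp add: emeasure_density)
  have L1_\<rho>: "ennreal (L1_norm \<rho>) = 1"
  proof -
    have "ennreal (L1_norm \<rho>) = (\<integral>\<^sup>+t. ennreal \<bar>\<rho> t\<bar> \<partial>lborel)"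
      unfolding L1_norm_def using \<rho>_int(1) by (simp add: nn_integral_eq_integral)
    also have "\<dots> = (\<integral>\<^sup>+t. r t \<partial>lborel)"
      using assms(4) unfolding r_def by (intro nn_integral_cong_AE) (auto elim!: eventually_mono)
    finally show ?thesis using mass by simp
  qed
  obtain K where K: "AE t in lborel. K < \<bar>t\<bar> \<longrightarrow> \<rho> t = 0"
    using density_vanishes_outside_bounded_set[OF \<mu> assms(3,4) \<rho>] by blast

  interpret P: product_prob_space "\<lambda>_ :: int ^ 'd. \<mu>" UNIV
    by (simp add: product_prob_space_def product_prob_space_axioms_def product_sigma_finite_def
        assms(1) \<mu>.sigma_finite_measure_axioms)
  have \<Phi>_P[measurable]: "\<Phi> \<in> borel_measurable (Pi\<^sub>M UNIV (\<lambda>_. \<mu>))"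
  proof (rule \<Phi>_meas)
    fix i :: "int ^ 'd"
    have "(\<lambda>\<omega>. \<omega> i) \<in> Pi\<^sub>M UNIV (\<lambda>_. \<mu>) \<rightarrow>\<^sub>M \<mu>" by (rule measurable_component_singleton) simp
    then show "(\<lambda>\<omega>. \<omega> i) \<in> borel_measurable (Pi\<^sub>M UNIV (\<lambda>_. \<mu>))"
      by (simp add: measurable_cong_sets[OF refl assms(2)])
  qed
  have \<Phi>_int: "integrable (disorder_measure \<mu>) \<Phi>"
    unfolding disorder_measure_def
    by (rule P.P.integrable_const_bound[where B = "(1 / Im z)\<^sup>2"]) (use \<Phi>_nonneg \<Phi>_le in auto)
  \<comment> \<open>Only the finitely many coordinates in \<open>I\<close> matter, and on these there is a Lebesgue density.\<close>
  have expectation: "ennreal (\<integral>\<omega>. \<Phi> \<omega> \<partial>disorder_measure \<mu>) = (\<integral>\<^sup>+\<omega>. ennreal (\<Phi> \<omega>) * (\<Prod>i\<in>I. r (\<omega> i)) \<partial>lborel_on I)"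
  proof -
    have \<Phi>_\<mu>: "\<Phi> \<in> borel_measurable (Pi\<^sub>M I (\<lambda>_. \<mu>))"
      using \<Phi>_I by (subst measurable_cong_sets[OF sets_PiM_cong[OF refl] refl]) (auto simp: assms(2))
    have "ennreal (\<integral>\<omega>. \<Phi> \<omega> \<partial>disorder_measure \<mu>) = (\<integral>\<^sup>+\<omega>. ennreal (\<Phi> \<omega>) \<partial>Pi\<^sub>M UNIV (\<lambda>_. \<mu>))"
      using \<Phi>_int \<Phi>_nonneg by (subst nn_integral_eq_integral) (auto simp: disorder_measure_def)
    also have "\<dots> = (\<integral>\<^sup>+\<omega>. ennreal (\<Phi> (restrict \<omega> I)) \<partial>Pi\<^sub>M UNIV (\<lambda>_. \<mu>))"
      by (intro nn_integral_cong arg_cong[where f = ennreal] \<Phi>_cong) simp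
    also have "\<dots> = (\<integral>\<^sup>+\<omega>. ennreal (\<Phi> \<omega>) \<partial>distr (Pi\<^sub>M UNIV (\<lambda>_. \<mu>)) (Pi\<^sub>M I (\<lambda>_. \<mu>)) (\<lambda>\<omega>. restrict \<omega> I))"
      using \<Phi>_\<mu> by (subst nn_integral_distr) (auto intro!: measurable_restrict_subset)
    also have "\<dots> = (\<integral>\<^sup>+\<omega>. ennreal (\<Phi> \<omega>) \<partial>Pi\<^sub>M I (\<lambda>_. \<mu>))"
      using P.distr_PiM_restrict_finite[OF I] by simp
    also have "Pi\<^sub>M I (\<lambda>_. \<mu>) = density (lborel_on I) (\<lambda>\<omega>. \<Prod>i\<in>I. r (\<omega> i))"
      using PiM_density_lborel[OF I r] \<mu>.sigma_finite_measure_axioms unfolding \<mu> r_def by simp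
    also have "(\<integral>\<^sup>+\<omega>. ennreal (\<Phi> \<omega>) \<partial>\<dots>) = (\<integral>\<^sup>+\<omega>. ennreal (\<Phi> \<omega>) * (\<Prod>i\<in>I. r (\<omega> i)) \<partial>lborel_on I)"
      by (subst nn_integral_density) (auto simp: mult.commute)
    finally show ?thesis .
  qed

  obtain a where a: "\<And>j. (\<Sum>m\<in>S. u m * a (j - m)) = (if j = x then 1 else 0)"
    and a_le: "(\<Sum>i\<in>I. \<bar>a i\<bar>) \<le> C_u u"
    using real_inverse_column[OF fin_u assms(8), of x] I unfolding S_def by blast
  obtain b where b: "\<And>j. (\<Sum>m\<in>S. u m * b (j - m)) = (if j = y then 1 else 0)"
    and b_le: "(\<Sum>i\<in>I. \<bar>b i\<bar>) \<le> C_u u"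
    using real_inverse_column[OF fin_u assms(8), of y] I unfolding S_def by blast
  have nonzero: "\<exists>i\<in>I. c i \<noteq> 0" if "(\<Sum>m\<in>S. u m * c (k - m)) = 1" "k \<in> \<Lambda>" for c :: "int ^ 'd \<Rightarrow> real" and k
  proof (rule ccontr)
    assume "\<not> ?thesis"
    then have "(\<Sum>m\<in>S. u m * c (k - m)) = 0" using in_I that by (intro sum.neutral) auto
    then show False using that by simp
  qed
  \<comment> \<open>Shifting along the columns \<open>a\<close> and \<open>b\<close> of the inverse moves the potential at \<open>x\<close> and at \<open>y\<close> only.\<close>
  have average: "(\<integral>\<^sup>+t. (\<integral>\<^sup>+s. ennreal (\<Phi> (\<lambda>k\<in>I. \<omega> k + t * b k + s * a k)) \<partial>lborel) \<partial>lborel) \<le> ennreal ((pi / lam)\<^sup>2)" for \<omega>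
  proof -
    have "\<Phi> (\<lambda>k\<in>I. \<omega> k + t * b k + s * a k)
        = im_det hopping \<Lambda> z x y (\<lambda>k. lam * (V \<omega> k + (if k = y then t else 0) + (if k = x then s else 0)))" for s t
    proof -
      have "V (\<lambda>k. \<omega> k + t * b k + s * a k) k = V \<omega> k + t * (\<Sum>m\<in>S. u m * b (k - m)) + s * (\<Sum>m\<in>S. u m * a (k - m))" for k
        by (simp add: V_def sum.distrib sum_distrib_left algebra_simps)
      then have "(\<lambda>k. lam * V (\<lambda>k. \<omega> k + t * b k + s * a k) k)
          = (\<lambda>k. lam * (V \<omega> k + (if k = y then t else 0) + (if k = x then s else 0)))"
        by (auto simp: a b fun_eq_iff)
      then have "\<Phi> (\<lambda>k. \<omega> k + t * b k + s * a k)
        = im_det hopping \<Lambda> z x y (\<lambda>k. lam * (V \<omega> k + (if k = y then t else 0) + (if k = x then s else 0)))"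
        by (simp add: \<Phi>_def)
      moreover have "\<Phi> (\<lambda>k\<in>I. \<omega> k + t * b k + s * a k) = \<Phi> (\<lambda>k. \<omega> k + t * b k + s * a k)"
        by (rule \<Phi>_cong) simp
      ultimately show ?thesis by simp
    qed
    then show ?thesis
      using nn_integral_im_det_two_sites_scaled_le[OF hopping_sym fin z x y xy lam, of "V \<omega>"] by simp
  qed

  define C where "C = (pi / lam)\<^sup>2 * C_Min u \<rho>' \<rho>''"
  \<comment> \<open>A Lipschitz constant of \<open>\<Phi>\<close> for the maximum norm on the coordinates in \<open>I\<close>.\<close>
  define L where "L = 4 / (Im z) ^ 3 * (\<Sum>k\<in>\<Lambda>. lam * (\<Sum>m\<in>S. \<bar>u m\<bar>))"
  have L: "0 \<le> L" using z lam by (simp add: L_def sum_nonneg)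
  have main: "ennreal (\<integral>\<omega>. \<Phi> \<omega> \<partial>disorder_measure \<mu>) \<le> ennreal C + ennreal (L * \<epsilon>)" if \<epsilon>: "\<epsilon> > 0" for \<epsilon>
  proof -
    obtain \<eta> where \<eta>: "deriv_family \<eta>" and supp: "\<forall>n s. \<epsilon> < \<bar>s\<bar> \<longrightarrow> \<eta> n s = 0"
      and \<eta>_nonneg: "\<forall>s. 0 \<le> \<eta> 0 s" and \<eta>_mass: "(\<integral>\<^sup>+s. ennreal (\<eta> 0 s) \<partial>lborel) = 1"
      using mollifier_exists[OF \<epsilon>] by blast
    have [measurable]: "\<eta> 0 \<in> borel_measurable borel" by (rule deriv_family_measurable[OF \<eta>])
    define \<psi> where "\<psi> n = mollify \<rho> (\<eta> n)" for n
    have \<psi>1: "\<psi> 1 = mollify \<rho>' (\<eta> 0)"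
      using mollify_weak_derivative[OF weak(1) \<eta> supp, of 0] by (auto simp: \<psi>_def fun_eq_iff)
    have \<psi>2: "\<psi> 2 = mollify \<rho>'' (\<eta> 0)"
      using mollify_weak_derivative[OF weak(1) \<eta> supp, of 1] mollify_weak_derivative[OF weak(2) \<eta> supp, of 0]
      by (auto simp: \<psi>_def fun_eq_iff numeral_2_eq_2)
    have shift: "\<bar>\<Phi> y' - \<Phi> (\<lambda>i\<in>I. \<omega> i + y' i)\<bar> \<le> L * \<epsilon>" if \<omega>: "\<And>i. i \<in> I \<Longrightarrow> \<bar>\<omega> i\<bar> \<le> \<epsilon>" for \<omega> y'
    proof -
      have "\<Phi> (\<lambda>i\<in>I. \<omega> i + y' i) = \<Phi> (\<lambda>i. \<omega> i + y' i)" by (rule \<Phi>_cong) simp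
      then have "\<bar>\<Phi> y' - \<Phi> (\<lambda>i\<in>I. \<omega> i + y' i)\<bar> \<le> 4 / (Im z) ^ 3 * (\<Sum>k\<in>\<Lambda>. \<bar>lam * V y' k - lam * V (\<lambda>i. \<omega> i + y' i) k\<bar>)"
        unfolding \<Phi>_def using im_det_lipschitz[OF hopping_sym fin z x y] by simp
      also have "\<dots> \<le> 4 / (Im z) ^ 3 * (\<Sum>k\<in>\<Lambda>. lam * (\<Sum>m\<in>S. \<bar>u m\<bar>) * \<epsilon>)"
      proof (intro mult_left_mono sum_mono)
        fix k assume k: "k \<in> \<Lambda>"
        have "lam * V y' k - lam * V (\<lambda>i. \<omega> i + y' i) k = - (lam * (\<Sum>m\<in>S. u m * \<omega> (k - m)))"
          by (simp add: V_def sum.distrib algebra_simps)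
        then have "\<bar>lam * V y' k - lam * V (\<lambda>i. \<omega> i + y' i) k\<bar> = lam * \<bar>\<Sum>m\<in>S. u m * \<omega> (k - m)\<bar>"
          using lam by (simp add: abs_mult)
        also have "\<dots> \<le> lam * (\<Sum>m\<in>S. \<bar>u m\<bar> * \<epsilon>)"
          using lam \<omega> in_I[OF k] by (intro mult_left_mono order.trans[OF sum_abs] sum_mono) (auto simp: abs_mult intro!: mult_left_mono)
        finally show "\<bar>lam * V y' k - lam * V (\<lambda>i. \<omega> i + y' i) k\<bar> \<le> lam * (\<Sum>m\<in>S. \<bar>u m\<bar>) * \<epsilon>"
          by (simp add: sum_distrib_right mult.assoc)
      qed (use z in simp)
      also have "\<dots> = L * \<epsilon>" by (simp add: L_def sum_distrib_right mult.assoc)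
      finally show ?thesis .
    qed
    have "(\<integral>\<^sup>+\<omega>. ennreal (\<Phi> \<omega>) * (\<Prod>i\<in>I. r (\<omega> i)) \<partial>lborel_on I)
        \<le> (\<integral>\<^sup>+\<omega>. ennreal (\<Phi> \<omega>) * (\<Prod>i\<in>I. \<integral>\<^sup>+t. r t * ennreal (\<eta> 0 (\<omega> i - t)) \<partial>lborel) \<partial>lborel_on I) + ennreal (L * \<epsilon>)"
    proof (rule nn_integral_noise_le[OF I _ r mass _ \<eta>_mass, of _ \<epsilon>])
      fix \<omega> y' :: "int ^ 'd \<Rightarrow> real" assume "\<And>i. i \<in> I \<Longrightarrow> \<bar>\<omega> i\<bar> \<le> \<epsilon>"
      then have "\<bar>\<Phi> y' - \<Phi> (\<lambda>i\<in>I. \<omega> i + y' i)\<bar> \<le> L * \<epsilon>" by (rule shift)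
      then have "\<Phi> y' \<le> \<Phi> (\<lambda>i\<in>I. \<omega> i + y' i) + L * \<epsilon>" by simp
      then have "ennreal (\<Phi> y') \<le> ennreal (\<Phi> (\<lambda>i\<in>I. \<omega> i + y' i) + L * \<epsilon>)" by (rule ennreal_leI)
      also have "\<dots> = ennreal (\<Phi> (\<lambda>i\<in>I. \<omega> i + y' i)) + ennreal (L * \<epsilon>)"
        using \<Phi>_nonneg L \<epsilon> by (intro ennreal_plus) auto
      finally show "ennreal (\<Phi> y') \<le> ennreal (\<Phi> (\<lambda>i\<in>I. \<omega> i + y' i)) + ennreal (L * \<epsilon>)" .
    qed (use supp in auto)
    also have "(\<integral>\<^sup>+\<omega>. ennreal (\<Phi> \<omega>) * (\<Prod>i\<in>I. \<integral>\<^sup>+t. r t * ennreal (\<eta> 0 (\<omega> i - t)) \<partial>lborel) \<partial>lborel_on I)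
        = (\<integral>\<^sup>+\<omega>. ennreal (\<Phi> \<omega>) * ennreal \<bar>\<Prod>i\<in>I. \<psi> 0 (\<omega> i)\<bar> \<partial>lborel_on I)"
    proof -
      have "(\<integral>\<^sup>+t. r t * ennreal (\<eta> 0 (s - t)) \<partial>lborel) = ennreal \<bar>\<psi> 0 s\<bar>" for s
      proof -
        have nn: "AE t in lborel. 0 \<le> \<rho> t * \<eta> 0 (s - t)"
          using assms(4) \<eta>_nonneg by (auto elim!: eventually_mono)
        have "(\<integral>\<^sup>+t. r t * ennreal (\<eta> 0 (s - t)) \<partial>lborel) = (\<integral>\<^sup>+t. ennreal (\<rho> t * \<eta> 0 (s - t)) \<partial>lborel)"
          unfolding r_def using \<eta>_nonneg by (simp add: ennreal_mult'')
        also have "\<dots> = ennreal (\<psi> 0 s)"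
          unfolding \<psi>_def mollify_def by (rule nn_integral_eq_integral[OF integrable_mollify[OF \<rho>_int(1) \<eta> supp] nn])
        also have "\<psi> 0 s = \<bar>\<psi> 0 s\<bar>"
          unfolding \<psi>_def mollify_def using integral_nonneg_AE[OF nn] by simp
        finally show ?thesis .
      qed
      then show ?thesis by (simp add: abs_prod prod_ennreal)
    qed
    also have "\<dots> \<le> ennreal ((pi / lam)\<^sup>2 / 4 * (\<Sum>i\<in>I. \<bar>a i\<bar>) * (\<Sum>i\<in>I. \<bar>b i\<bar>) * max ((L1_norm \<rho>')\<^sup>2) (L1_norm \<rho>''))"
    proof (rule nn_integral_tensor_density_le[OF I, where K = "K + \<epsilon>"])
      show "deriv_family \<psi>" unfolding \<psi>_def by (rule deriv_family_mollify[OF \<rho>_int(1) \<eta> supp])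
      show "\<forall>n s. K + \<epsilon> < \<bar>s\<bar> \<longrightarrow> \<psi> n s = 0"
        unfolding \<psi>_def using mollify_eq_0[OF K] supp by blast
      show "\<exists>k\<in>I. a k \<noteq> 0" using nonzero[of a x] a x by simp
      show "\<exists>k\<in>I. b k \<noteq> 0" using nonzero[of b y] b y by simp
      note young = nn_integral_mollify_le[OF _ \<eta> supp \<eta>_nonneg \<eta>_mass]
      show "(\<integral>\<^sup>+s. ennreal \<bar>\<psi> 0 s\<bar> \<partial>lborel) \<le> 1" using young[OF \<rho>_int(1)] by (simp add: \<psi>_def L1_\<rho>)
      show "(\<integral>\<^sup>+s. ennreal \<bar>\<psi> 1 s\<bar> \<partial>lborel) \<le> ennreal (L1_norm \<rho>')" unfolding \<psi>1 by (rule young[OF \<rho>_int(2)])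
      show "(\<integral>\<^sup>+s. ennreal \<bar>\<psi> 2 s\<bar> \<partial>lborel) \<le> ennreal (L1_norm \<rho>'')" unfolding \<psi>2 by (rule young[OF \<rho>_int(3)])
    qed (use average in \<open>auto simp: L1_norm_def\<close>)
    also have "\<dots> \<le> ennreal C"
    proof (rule ennreal_leI)
      have "(\<Sum>i\<in>I. \<bar>a i\<bar>) * (\<Sum>i\<in>I. \<bar>b i\<bar>) \<le> C_u u * C_u u"
        using a_le b_le order.trans[OF sum_nonneg a_le] by (intro mult_mono) (auto simp: sum_nonneg)
      then have "(pi / lam)\<^sup>2 / 4 * max ((L1_norm \<rho>')\<^sup>2) (L1_norm \<rho>'') * ((\<Sum>i\<in>I. \<bar>a i\<bar>) * (\<Sum>i\<in>I. \<bar>b i\<bar>))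
          \<le> (pi / lam)\<^sup>2 / 4 * max ((L1_norm \<rho>')\<^sup>2) (L1_norm \<rho>'') * (C_u u * C_u u)"
        by (intro mult_left_mono) (auto simp: le_max_iff_disj)
      then show "(pi / lam)\<^sup>2 / 4 * (\<Sum>i\<in>I. \<bar>a i\<bar>) * (\<Sum>i\<in>I. \<bar>b i\<bar>) * max ((L1_norm \<rho>')\<^sup>2) (L1_norm \<rho>'') \<le> C"
        by (simp add: C_def C_Min_def power2_eq_square mult_ac)
    qed
    finally show ?thesis unfolding expectation by (simp add: add_right_mono)
  qed
  have C: "0 \<le> C" by (simp add: C_def C_Min_def le_max_iff_disj)
  have "(\<integral>\<omega>. \<Phi> \<omega> \<partial>disorder_measure \<mu>) \<le> C"
  proof (rule field_le_epsilon)
    fix e :: real assume e: "e > 0"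
    define \<epsilon> where "\<epsilon> = e / (L + 1)"
    have \<epsilon>: "\<epsilon> > 0" using e L by (simp add: \<epsilon>_def)
    have "L * \<epsilon> \<le> e" using e L by (simp add: \<epsilon>_def field_simps)
    moreover have "(\<integral>\<omega>. \<Phi> \<omega> \<partial>disorder_measure \<mu>) \<le> C + L * \<epsilon>"
      using main[OF \<epsilon>] C L \<epsilon> by (simp add: ennreal_plus[symmetric] ennreal_le_iff del: ennreal_plus)
    ultimately show "(\<integral>\<omega>. \<Phi> \<omega> \<partial>disorder_measure \<mu>) \<le> C + e" by linarith
  qed
  then show ?thesis unfolding \<Phi> C_def using \<Phi>_int by simp
qed

end
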